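(* Let $k\ge 3$ and $d>k$ be integers such that $N_{k,d}(r)\eqsim r^{d-k}$ for all sufficiently large $r\in\mathcal R_{k,d}$. If the Sup Hypothesis $H_k(\theta)$ is true for some $\theta\in\big(0,\frac1{k(k+2)}\big)$ and $d>\max\{k(k+2),\,k/\theta\}$, then the full maximal operator $M_{\mathcal R_{k,d}}$ is of restricted weak-type $(p,p)$ with $p=\frac{d}{d-k/(2\theta)}$.
   Context: Write $e(t)=e^{2\pi i t}$. For $r>0$ let $S_r^{k,d}=\{m\in\mathbb Z^d:\sum_{i=1}^d|m_i|^k=r^k\}$, $N_{k,d}(r)=\#S_r^{k,d}$, and let $\mathcal R_{k,d}$ be the set of $r>0$ for which $S_r^{k,d}\neq\emptyset$. For $f:\mathbb Z^d\to\mathbb C$ and $r\in\mathcal R_{k,d}$ put $A_rf(x)=\frac1{N_{k,d}(r)}\sum_{y\in S_r^{k,d}}f(x-y)$, and $M_{\mathcal R_{k,d}}f=\sup_{r\in\mathcal R_{k,d}}|A_rf|$. $f\eqsim g$ means that each is bounded by a constant multiple of the other. All implicit constants may depend on $d$ and $k$. Restricted weak-type $(p,p)$ for a sublinear operator $T$: there is a constant $C$ with $\#\{x\in\mathbb Z^d:|T\mathbf 1_F(x)|>\alpha\}\le C\alpha^{-p}\,\#F$ for every finite $F\subset\mathbb Z^d$ and every $\alpha>0$. Sup Hypothesis $H_k(\theta)$: there is a constant $C$ such that for all $N\in\mathbb N$, all $t,\xi\in\mathbb R$, and all relatively prime integers $1\le a<q\le N^k$ with $|t-a/q|\le q^{-2}$,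 $$\Big|\sum_{n=1}^N e(tn^k+\xi n)\Big|\le C\,N\,(q^{-1}+N^{-1}+qN^{-k})^\theta,$$ the constant $C$ being independent of $\xi,t,a,q,N$. *)

theory Defs
  imports "HOL-Analysis.Analysis"
begin

text \<open>
  The lattice of integer points in dimension d is the type \<open>int ^ 'd\<close> with d = \<open>CARD('d)\<close>.
  Constants in which d is not visible from the other arguments take an argument of type
  \<open>'d itself\<close>.
\<close>

definition e :: "real \<Rightarrow> complex" where
  "e t = exp (2 * complex_of_real pi * \<i> * complex_of_real t)"

definition lattice_sphere :: "nat \<Rightarrow> real \<Rightarrow> (int ^ 'd::finite) set" where
  "lattice_sphere k r = {m. real_of_int (\<Sum>i\<in>UNIV. \<bar>m $ i\<bar> ^ k) = r ^ k}"

definition sphere_count :: "'d::finite itself \<Rightarrow> nat \<Rightarrow> real \<Rightarrow> nat" where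
  "sphere_count D k r = card (lattice_sphere k r :: (int ^ 'd) set)"

definition radii :: "'d::finite itself \<Rightarrow> nat \<Rightarrow> real set" where
  "radii D k = {r. r > 0 \<and> (lattice_sphere k r :: (int ^ 'd) set) \<noteq> {}}"

definition sphere_avg ::
    "nat \<Rightarrow> real \<Rightarrow> (int ^ 'd::finite \<Rightarrow> complex) \<Rightarrow> int ^ 'd \<Rightarrow> complex" where
  "sphere_avg k r f x =
     1 / of_nat (sphere_count TYPE('d) k r) * (\<Sum>y\<in>lattice_sphere k r. f (x - y))"

text \<open>
  The supremum is taken in \<open>ennreal\<close>, because for unbounded f it may be infinite.
\<close>

definition full_maximal ::
    "nat \<Rightarrow> (int ^ 'd::finite \<Rightarrow> complex) \<Rightarrow> int ^ 'd \<Rightarrow> ennreal" where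
  "full_maximal k f x = (SUP r\<in>radii TYPE('d) k. ennreal (cmod (sphere_avg k r f x)))"

text \<open>
  The values of T stand for the absolute values of the operator. Finiteness of the superlevel
  set is required explicitly, as \<open>card\<close> is 0 on infinite sets.
\<close>

definition restricted_weak_type ::
    "real \<Rightarrow> ((int ^ 'd::finite \<Rightarrow> complex) \<Rightarrow> int ^ 'd \<Rightarrow> ennreal) \<Rightarrow> bool" where
  "restricted_weak_type p T \<longleftrightarrow>
     (\<exists>C::real. \<forall>F. \<forall>\<alpha>::real. finite F \<longrightarrow> \<alpha> > 0 \<longrightarrow>
        finite {x. T (indicator F) x > ennreal \<alpha>} \<and>
        real (card {x. T (indicator F) x > ennreal \<alpha>}) \<le> C * \<alpha> powr (- p) * real (card F))"

definition comparable_on :: "'a set \<Rightarrow> ('a \<Rightarrow> real) \<Rightarrow> ('a \<Rightarrow> real) \<Rightarrow> bool" where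
  "comparable_on A f g \<longleftrightarrow> (\<exists>C>0. \<forall>x\<in>A. f x \<le> C * g x \<and> g x \<le> C * f x)"

definition sup_hypothesis :: "nat \<Rightarrow> real \<Rightarrow> bool" where
  "sup_hypothesis k \<theta> \<longleftrightarrow>
     (\<exists>C::real. \<forall>(N::nat) (t::real) (\<xi>::real) (a::int) (q::int).
        1 \<le> a \<longrightarrow> a < q \<longrightarrow> q \<le> int N ^ k \<longrightarrow> coprime a q \<longrightarrow>
        \<bar>t - real_of_int a / real_of_int q\<bar> \<le> 1 / (real_of_int q)\<^sup>2 \<longrightarrow>
        cmod (\<Sum>n=1..N. e (t * real n ^ k + \<xi> * real n))
          \<le> C * real N *
              (1 / real_of_int q + 1 / real N + real_of_int q / real N ^ k) powr \<theta>)"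

end

theory Submission
  imports Defs
begin

text \<open>
  Detect the condition \<open>\<Sum>i. m i ^ k = r ^ k\<close> by additive characters, with \<open>N\<close> the power of two just
  above \<open>r\<close>; the circle is replaced by a finite grid. The average over the sphere is then \<open>N ^ k\<close> times
  an average over the circle of operators whose multipliers are products of Weyl sums of length \<open>N\<close>.
  Fix a cutoff \<open>\<Lambda> = 2 ^ \<sigma>\<close>. For \<open>N \<le> \<Lambda>\<close> the spherical average is trivially at most \<open>\<Lambda> ^ k\<close> times
  an average over a cube. For \<open>N > \<Lambda>\<close> the arcs around fractions with denominator at most \<open>\<Lambda>\<close> have
  total length \<open>O (\<Lambda> ^ 2 / N ^ k)\<close> and contribute at most \<open>\<Lambda> ^ 2\<close> cube averages. On the remaining arcs,
  grouped into levels \<open>2 ^ s \<ge> \<Lambda>\<close> of length \<open>O (4 ^ s / N ^ k)\<close>, Dirichlet's theorem and the Sup Hypothesis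
  bound the multiplier by \<open>2 ^ (- s \<theta> d)\<close>, so they are estimated in \<open>\<ell>\<^sup>2\<close>.

  A level has to be summed over all scales \<open>N\<close>. The scales that are at most a fixed power of \<open>2 ^ s\<close>
  cost only a factor \<open>O (s)\<close>. For larger \<open>N\<close> the operator attached to \<open>a / q + \<tau> / N ^ k\<close> is, up to a
  summable error, a Gauss sum operator independent of \<open>N\<close> followed by a smooth average over cubes in the
  multiples of \<open>q\<close>. Up to a part that is square-summable over \<open>N\<close>, the latter is a multiple of the plain average,
  whose maximal function is controlled by the covering lemma. Altogether the superlevel set at height
  \<open>\<alpha>\<close> has size \<open>O (\<Lambda> ^ k / \<alpha> + \<Lambda> ^ (2 (k - \<theta> d)) / \<alpha> ^ 2) \<cdot> #F\<close>, and it remains to choose \<open>\<Lambda>\<close>.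
\<close>

section \<open>Additive characters\<close>

text \<open>The obstacle is that the scale varies with the point. It is met by linearising: a finite
  set \<open>X\<close> carries one scale for each of its points, and all estimates are uniform in
  \<open>X\<close>, so that no supremum is formed. The density \<open>W\<close> of the grid must be
  divisible by every relevant denominator and so depends on \<open>X\<close>; it cancels in every
  estimate. Cauchy-Schwarz over one level costs \<open>16 ^ s\<close>, the sum over scales at most a
  further \<open>3 ^ s\<close>, and the division of the height among the levels
  \<open>(4 / 3) ^ s\<close>. The product \<open>64 ^ s\<close> is at most
  \<open>4 ^ (k * s)\<close> because \<open>k\<close> is at least 3, and this much is already the
  price of the minor arcs at scale \<open>2 ^ s\<close>. Hence everything is dominated by powers of
  \<open>4 powr (k - \<theta> d)\<close>, which sum because \<open>k < \<theta> d\<close>. The Sup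
  Hypothesis serves three times: on minor arcs, for complete Gauss sums (length \<open>q\<close>),
  and for the decay of the smooth factor (fractions \<open>1 / q\<close> with \<open>q\<close> near
  \<open>M ^ k / \<tau>\<close>). Balancing the two final terms means
  \<open>\<Lambda> powr (2 \<theta> d - k) = 1 / \<alpha>\<close>, whence
  \<open>p = 2 \<theta> d / (2 \<theta> d - k)\<close>.\<close>

lemma e_cis: "e t = cis (2 * pi * t)"
  by (simp add: e_def cis_conv_exp mult_ac)

lemma e_add: "e (s + t) = e s * e t"
  by (simp add: e_cis cis_mult ring_distribs)

lemma norm_e [simp]: "cmod (e t) = 1"
  by (simp add: e_cis)

lemma e_0 [simp]: "e 0 = 1"
  by (simp add: e_cis)

lemma e_of_int [simp]: "e (of_int n) = 1"
  using cis_multiple_2pi[of "of_int n"] by (simp add: e_cis)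

lemma e_minus: "e (- t) = cnj (e t)"
  by (simp add: e_cis cis_cnj)

lemma e_diff: "e (s - t) = e s * cnj (e t)"
  using e_add[of s "- t"] by (simp add: e_minus)

lemma e_sum: "e (\<Sum>i\<in>I. f i) = (\<Prod>i\<in>I. e (f i))"
  by (induction I rule: infinite_finite_induct) (auto simp: e_add)

lemma e_power: "e t ^ n = e (real n * t)"
  by (induction n) (auto simp: e_add ring_distribs)

lemma norm_e_diff: "cmod (e x - e y) \<le> 2 * pi * \<bar>x - y\<bar>"
proof -
  have "e x - e y = e y * (e (x - y) - 1)"
    using e_add[of y "x - y"] by (simp add: algebra_simps)
  then have "cmod (e x - e y) = cmod (e (x - y) - 1)"
    by (simp add: norm_mult)
  also have "\<dots> = 2 * \<bar>sin (2 * pi * (x - y) / 2)\<bar>"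
    unfolding e_cis cis_conv_exp by (rule dist_exp_i_1)
  also have "\<dots> \<le> 2 * \<bar>2 * pi * (x - y) / 2\<bar>"
    by (intro mult_left_mono abs_sin_x_le_abs_x) auto
  finally show ?thesis
    by (simp add: abs_mult)
qed

lemma e_eq_1_imp_int:
  assumes "e t = 1"
  shows "\<exists>n::int. t = of_int n"
proof -
  have "cos (2 * pi * t) = 1"
    using assms by (simp add: e_cis complex_eq_iff)
  then obtain n where "2 * pi * t = of_int n * 2 * pi"
    using cos_one_2pi_int by auto
  then show ?thesis by (intro exI[of _ n]) (simp add: mult_ac)
qed

lemma sum_e_roots:
  assumes "L > 0"
  shows "(\<Sum>v<L. e (real_of_int m * real v / real L)) = (if int L dvd m then of_nat L else 0)"
proof -
  define z where "z = e (real_of_int m / real L)"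
  have "(\<Sum>v<L. e (real_of_int m * real v / real L)) = (\<Sum>v<L. z ^ v)"
    by (simp add: z_def e_power mult_ac)
  also have "\<dots> = (if int L dvd m then of_nat L else 0)"
  proof (cases "int L dvd m")
    case True
    then obtain c where "m = int L * c" by auto
    then have "z = 1" using assms by (simp add: z_def)
    then show ?thesis using True by simp
  next
    case False
    have "z \<noteq> 1"
    proof
      assume "z = 1"
      then obtain n :: int where "real_of_int m / real L = of_int n"
        unfolding z_def using e_eq_1_imp_int by blast
      then have "real_of_int m = real_of_int (int L * n)"
        using assms by (simp add: field_simps)
      then have "m = int L * n" by linarith
      then show False using False by simp
    qed
    moreover have "z ^ L = 1"
      using assms by (simp add: z_def e_power)
    ultimately show ?thesis using False by (simp add: sum_gp_strict)
  qed
  finally show ?thesis .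
qed

section \<open>Fourier multipliers on the lattice\<close>

definition nbox :: "nat \<Rightarrow> ('d::finite \<Rightarrow> nat) set" where
  "nbox N = {v. \<forall>i. v i < N}"

lemma nbox_PiE: "nbox N = (UNIV \<rightarrow>\<^sub>E {..<N})"
  by (auto simp: nbox_def PiE_def)

lemma finite_nbox [simp]: "finite (nbox N)"
  by (simp add: nbox_PiE finite_PiE)

lemma card_nbox [simp]: "card (nbox N :: ('d::finite \<Rightarrow> nat) set) = N ^ CARD('d)"
  by (simp add: nbox_PiE card_PiE)

lemma sum_nbox_prod:
  fixes g :: "'d::finite \<Rightarrow> nat \<Rightarrow> 'a::comm_semiring_1"
  shows "(\<Sum>v\<in>nbox N. \<Prod>i\<in>UNIV. g i (v i)) = (\<Prod>i\<in>UNIV. \<Sum>n<N. g i n)"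
  by (simp add: nbox_PiE prod_sum_PiE)

definition dotp :: "int ^ 'd::finite \<Rightarrow> ('d \<Rightarrow> real) \<Rightarrow> real" where
  "dotp x \<xi> = (\<Sum>i\<in>UNIV. real_of_int (x $ i) * \<xi> i)"

lemma dotp_add: "dotp (x + y) \<xi> = dotp x \<xi> + dotp y \<xi>"
  by (simp add: dotp_def sum.distrib ring_distribs)

lemma dotp_diff: "dotp (x - y) \<xi> = dotp x \<xi> - dotp y \<xi>"
  by (simp add: dotp_def sum_subtractf ring_distribs)

abbreviation finsupp :: "('a \<Rightarrow> 'b::zero) \<Rightarrow> bool" where
  "finsupp f \<equiv> finite {x. f x \<noteq> 0}"

definition ft :: "(int ^ 'd::finite \<Rightarrow> complex) \<Rightarrow> ('d \<Rightarrow> real) \<Rightarrow> complex" where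
  "ft f \<xi> = (\<Sum>x | f x \<noteq> 0. f x * e (dotp x \<xi>))"

definition l2 :: "('a \<Rightarrow> complex) \<Rightarrow> real" where
  "l2 f = (\<Sum>x | f x \<noteq> 0. (cmod (f x))\<^sup>2)"

lemma ft_superset:
  assumes "finite Y" "{x. f x \<noteq> 0} \<subseteq> Y"
  shows "ft f \<xi> = (\<Sum>x\<in>Y. f x * e (dotp x \<xi>))"
  unfolding ft_def using assms by (intro sum.mono_neutral_left) auto

lemma l2_superset:
  assumes "finite Y" "{x. f x \<noteq> 0} \<subseteq> Y"
  shows "l2 f = (\<Sum>x\<in>Y. (cmod (f x))\<^sup>2)"
  unfolding l2_def using assms by (intro sum.mono_neutral_left) auto

lemma l2_nonneg: "0 \<le> l2 f"
  by (simp add: l2_def sum_nonneg)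

lemma sum_le_l2:
  assumes "finite X" "finsupp f"
  shows "(\<Sum>x\<in>X. (cmod (f x))\<^sup>2) \<le> l2 f"
proof -
  have "l2 f = (\<Sum>x\<in>X \<union> {x. f x \<noteq> 0}. (cmod (f x))\<^sup>2)"
    using assms by (intro l2_superset) auto
  also have "\<dots> \<ge> (\<Sum>x\<in>X. (cmod (f x))\<^sup>2)"
    using assms by (intro sum_mono2) auto
  finally show ?thesis .
qed

text \<open>If \<open>L\<close> exceeds all coordinate differences within \<open>Y\<close>, distinct
  points of \<open>Y\<close> stay distinct modulo \<open>L\<close>, and averaging the characters
  over the grid of \<open>L\<close>-th parts separates them. The grid takes the place of integration
  over the torus.\<close>

lemma plancherel_grid:
  fixes Y :: "(int ^ 'd::finite) set"
  assumes "finite Y"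
  shows "\<exists>(V :: ('d \<Rightarrow> nat) set) \<Xi>. finite V \<and> V \<noteq> {} \<and>
    (\<forall>f. {x. f x \<noteq> 0} \<subseteq> Y \<longrightarrow> (\<Sum>v\<in>V. (cmod (ft f (\<Xi> v)))\<^sup>2) = real (card V) * l2 f)"
proof -
  \<comment> \<open>The inserted 0 covers an empty \<open>Y\<close> and makes \<open>m\<close>
    nonnegative.\<close>
  define m where "m = Max (insert 0 ((\<lambda>(x, y, i). \<bar>x $ i - y $ i\<bar>) ` (Y \<times> Y \<times> (UNIV :: 'd set))))"
  have m0: "0 \<le> m" unfolding m_def using assms by (intro Max_ge) auto
  have m: "\<bar>x $ i - y $ i\<bar> \<le> m" if "x \<in> Y" "y \<in> Y" for x y i
  proof -
    have "(\<lambda>(x, y, i). \<bar>x $ i - y $ i\<bar>) (x, y, i) \<in> (\<lambda>(x, y, i). \<bar>x $ i - y $ i\<bar>) ` (Y \<times> Y \<times> (UNIV :: 'd set))"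
      using that by blast
    then show ?thesis unfolding m_def using assms by (intro Max_ge) auto
  qed
  define L where "L = nat (m + 1)"
  have L: "L > 0" "int L = m + 1" using m0 by (auto simp: L_def)
  define \<Xi> where "\<Xi> = (\<lambda>(v :: 'd \<Rightarrow> nat) i. real (v i) / real L)"
  have orth: "(\<Sum>v\<in>nbox L. e (dotp (x - y) (\<Xi> v))) = (if x = y then of_nat (L ^ CARD('d)) else 0)"
    if "x \<in> Y" "y \<in> Y" for x y
  proof -
    have "(\<Sum>v\<in>nbox L. e (dotp (x - y) (\<Xi> v))) =
      (\<Sum>v\<in>nbox L. \<Prod>i\<in>UNIV. e (real_of_int (x $ i - y $ i) * real (v i) / real L))"
      by (simp add: dotp_def e_sum \<Xi>_def)
    also have "\<dots> = (\<Prod>i\<in>UNIV. \<Sum>n<L. e (real_of_int (x $ i - y $ i) * real n / real L))"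
      by (rule sum_nbox_prod)
    also have "\<dots> = (\<Prod>i\<in>UNIV. if int L dvd x $ i - y $ i then of_nat L else 0)"
      by (simp only: sum_e_roots[OF L(1)])
    also have "\<dots> = (if x = y then of_nat (L ^ CARD('d)) else 0)"
    proof (cases "x = y")
      case False
      then obtain i where i: "x $ i \<noteq> y $ i" by (auto simp: vec_eq_iff)
      have "\<not> int L dvd x $ i - y $ i"
      proof
        assume "int L dvd x $ i - y $ i"
        then have "int L \<le> \<bar>x $ i - y $ i\<bar>"
          using i by (meson dvd_abs_iff zdvd_imp_le eq_iff_diff_eq_0 zero_less_abs_iff)
        then show False using m[OF that, of i] L by linarith
      qed
      then show ?thesis using False by (auto intro!: prod_zero)
    qed simp
    finally show ?thesis .
  qed
  have "(\<Sum>v\<in>nbox L. (cmod (ft f (\<Xi> v)))\<^sup>2) = real (card (nbox L :: ('d \<Rightarrow> nat) set)) * l2 f"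
    if f: "{x. f x \<noteq> 0} \<subseteq> Y" for f
  proof -
    have "complex_of_real (\<Sum>v\<in>nbox L. (cmod (ft f (\<Xi> v)))\<^sup>2)
        = (\<Sum>v\<in>nbox L. (\<Sum>x\<in>Y. f x * e (dotp x (\<Xi> v))) * cnj (\<Sum>y\<in>Y. f y * e (dotp y (\<Xi> v))))"
      by (simp add: ft_superset[OF assms f] complex_norm_square del: of_real_power)
    also have "\<dots> = (\<Sum>v\<in>nbox L. \<Sum>x\<in>Y. \<Sum>y\<in>Y. f x * cnj (f y) * e (dotp (x - y) (\<Xi> v)))"
      by (simp add: sum_product dotp_diff e_diff mult_ac)
    also have "\<dots> = (\<Sum>x\<in>Y. \<Sum>y\<in>Y. f x * cnj (f y) * (\<Sum>v\<in>nbox L. e (dotp (x - y) (\<Xi> v))))"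
      unfolding sum_distrib_left
      by (subst sum.swap, intro sum.cong refl, subst sum.swap, rule refl)
    also have "\<dots> = (\<Sum>x\<in>Y. \<Sum>y\<in>Y. f x * cnj (f y) * (if x = y then of_nat (L ^ CARD('d)) else 0))"
      by (intro sum.cong refl) (simp add: orth)
    also have "\<dots> = (\<Sum>x\<in>Y. f x * cnj (f x) * of_nat (L ^ CARD('d)))"
      using assms by (simp add: if_distrib[of "(*) _"] cong: if_cong)
    also have "\<dots> = complex_of_real (real (card (nbox L :: ('d \<Rightarrow> nat) set)) * l2 f)"
      by (simp add: l2_superset[OF assms f] sum_distrib_left complex_norm_square mult_ac
          del: of_real_power) (simp add: mult_ac)
    finally show ?thesis using of_real_eq_iff by blast
  qed
  moreover have "(nbox L :: ('d \<Rightarrow> nat) set) \<noteq> {}"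
    using L by (auto simp: nbox_def intro!: exI[of _ "\<lambda>_. 0"])
  ultimately show ?thesis
    by (intro exI[of _ "nbox L"] exI[of _ \<Xi>]) auto
qed

text \<open>All that is needed of a Fourier multiplier: an identity between finite trigonometric
  sums. The multiplier is a function of every real frequency vector, so bounds can be stated without
  passing to the torus.\<close>

definition mult_op ::
    "((int ^ 'd::finite \<Rightarrow> complex) \<Rightarrow> int ^ 'd \<Rightarrow> complex) \<Rightarrow> (('d \<Rightarrow> real) \<Rightarrow> complex) \<Rightarrow> bool" where
  "mult_op T m \<longleftrightarrow> (\<forall>f. finsupp f \<longrightarrow> finsupp (T f) \<and> (\<forall>\<xi>. ft (T f) \<xi> = m \<xi> * ft f \<xi>))"

lemma mult_op_finsupp: "mult_op T m \<Longrightarrow> finsupp f \<Longrightarrow> finsupp (T f)"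
  by (simp add: mult_op_def)

lemma mult_op_compose:
  "mult_op S m \<Longrightarrow> mult_op T n \<Longrightarrow> mult_op (\<lambda>f. S (T f)) (\<lambda>\<xi>. m \<xi> * n \<xi>)"
  by (simp add: mult_op_def)

lemma mult_op_scale:
  assumes "mult_op T m"
  shows "mult_op (\<lambda>f x. c * T f x) (\<lambda>\<xi>. c * m \<xi>)"
  unfolding mult_op_def
proof (intro allI impI conjI)
  fix f :: "int ^ 'a \<Rightarrow> complex" assume "finsupp f"
  then have T: "finsupp (T f)" "\<And>\<xi>. ft (T f) \<xi> = m \<xi> * ft f \<xi>"
    using assms by (auto simp: mult_op_def)
  show "finsupp (\<lambda>x. c * T f x)" by (rule finite_subset[OF _ T(1)]) auto
  fix \<xi>
  have "ft (\<lambda>x. c * T f x) \<xi> = (\<Sum>x | T f x \<noteq> 0. c * T f x * e (dotp x \<xi>))"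
    by (intro ft_superset T(1)) auto
  also have "\<dots> = c * ft (T f) \<xi>"
    by (simp add: ft_def sum_distrib_left mult_ac)
  finally show "ft (\<lambda>x. c * T f x) \<xi> = c * m \<xi> * ft f \<xi>"
    using T(2) by simp
qed

lemma mult_op_diff:
  assumes "mult_op S m" "mult_op T n"
  shows "mult_op (\<lambda>f x. S f x - T f x) (\<lambda>\<xi>. m \<xi> - n \<xi>)"
  unfolding mult_op_def
proof (intro allI impI conjI)
  fix f :: "int ^ 'a \<Rightarrow> complex" assume "finsupp f"
  then have ST: "finsupp (S f)" "\<And>\<xi>. ft (S f) \<xi> = m \<xi> * ft f \<xi>"
      "finsupp (T f)" "\<And>\<xi>. ft (T f) \<xi> = n \<xi> * ft f \<xi>"
    using assms by (auto simp: mult_op_def)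
  let ?Y = "{x. S f x \<noteq> 0} \<union> {x. T f x \<noteq> 0}"
  have Y: "finite ?Y" using ST by simp
  show "finsupp (\<lambda>x. S f x - T f x)" by (rule finite_subset[OF _ Y]) auto
  fix \<xi>
  have "ft (\<lambda>x. S f x - T f x) \<xi> = (\<Sum>x\<in>?Y. (S f x - T f x) * e (dotp x \<xi>))"
    by (intro ft_superset Y) auto
  also have "\<dots> = ft (S f) \<xi> - ft (T f) \<xi>"
    by (simp add: ft_superset[OF Y] sum_subtractf ring_distribs)
  finally show "ft (\<lambda>x. S f x - T f x) \<xi> = (m \<xi> - n \<xi>) * ft f \<xi>"
    using ST by (simp add: ring_distribs)
qed

text \<open>A single grid, adapted to the supports of \<open>f\<close> and of all
  \<open>T j f\<close>, allows the sum over \<open>J\<close> to be moved inside Plancherel, onto the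
  multipliers. This is the only device for summing over scales.\<close>

theorem l2_square_function:
  fixes f :: "int ^ 'd::finite \<Rightarrow> complex"
  assumes "finite J" "\<And>j. j \<in> J \<Longrightarrow> mult_op (T j) (m j)"
    and B: "\<And>\<xi>. (\<Sum>j\<in>J. (cmod (m j \<xi>))\<^sup>2) \<le> B" and f: "finsupp f"
  shows "(\<Sum>j\<in>J. l2 (T j f)) \<le> B * l2 f"
proof -
  define Y where "Y = {x. f x \<noteq> 0} \<union> (\<Union>j\<in>J. {x. T j f x \<noteq> 0})"
  have "finite Y"
    using assms(1) f mult_op_finsupp[OF assms(2) f] by (simp add: Y_def)
  from plancherel_grid[OF this] obtain V :: "('d \<Rightarrow> nat) set" and \<Xi> where V: "finite V" "V \<noteq> {}"
    and P: "\<And>f. {x. f x \<noteq> 0} \<subseteq> Y \<Longrightarrow> (\<Sum>v\<in>V. (cmod (ft f (\<Xi> v)))\<^sup>2) = real (card V) * l2 f"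
    by metis
  have "real (card V) * (\<Sum>j\<in>J. l2 (T j f)) = (\<Sum>j\<in>J. \<Sum>v\<in>V. (cmod (ft (T j f) (\<Xi> v)))\<^sup>2)"
    unfolding sum_distrib_left by (intro sum.cong refl P[symmetric]) (auto simp: Y_def)
  also have "\<dots> = (\<Sum>v\<in>V. (\<Sum>j\<in>J. (cmod (m j (\<Xi> v)))\<^sup>2) * (cmod (ft f (\<Xi> v)))\<^sup>2)"
    using assms(2) f
    by (subst sum.swap) (simp add: mult_op_def norm_mult power_mult_distrib sum_distrib_right)
  also have "\<dots> \<le> (\<Sum>v\<in>V. B * (cmod (ft f (\<Xi> v)))\<^sup>2)"
    by (intro sum_mono mult_right_mono B) auto
  also have "\<dots> = B * (real (card V) * l2 f)"
    by (subst P[symmetric]) (auto simp: Y_def sum_distrib_left)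
  finally have "real (card V) * (\<Sum>j\<in>J. l2 (T j f)) \<le> real (card V) * (B * l2 f)"
    by (simp add: mult_ac)
  moreover have "real (card V) > 0" using V by (simp add: card_gt_0_iff)
  ultimately show ?thesis by (simp only: mult_le_cancel_left_pos)
qed

lemma l2_mult_op:
  assumes "mult_op T m" "\<And>\<xi>. cmod (m \<xi>) \<le> B" "finsupp f"
  shows "l2 (T f) \<le> B\<^sup>2 * l2 f"
  using l2_square_function[of "{()}" "\<lambda>_. T" "\<lambda>_. m" "B\<^sup>2" f] assms
  by (simp add: power_mono)

section \<open>Convolutions with product kernels on boxes in the multiples of q\<close>

definition emb :: "nat \<Rightarrow> ('d::finite \<Rightarrow> nat) \<Rightarrow> int ^ 'd" where
  "emb q v = (\<chi> i. int q * int (v i))"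

text \<open>The kernel is a product over the coordinates, so that the multiplier factors into
  one-dimensional exponential sums.\<close>

definition bconv ::
    "nat \<Rightarrow> nat \<Rightarrow> (nat \<Rightarrow> complex) \<Rightarrow> (int ^ 'd::finite \<Rightarrow> complex) \<Rightarrow> int ^ 'd \<Rightarrow> complex" where
  "bconv q N u f x =
     (\<Sum>v\<in>nbox N. (\<Prod>i\<in>UNIV. u (v i)) * f (x - emb q v)) / of_nat (N ^ CARD('d))"

lemma mult_op_bconv:
  "mult_op (bconv q N u :: (int ^ 'd::finite \<Rightarrow> complex) \<Rightarrow> _)
     (\<lambda>\<xi>. \<Prod>i\<in>UNIV. (\<Sum>n<N. u n * e (real n * (real q * \<xi> i))) / of_nat N)"
  unfolding mult_op_def
proof (intro allI impI conjI)
  fix f :: "int ^ 'd \<Rightarrow> complex" assume f: "finsupp f"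
  define Y where "Y = (\<lambda>(x, v). x + emb q v) ` ({x. f x \<noteq> 0} \<times> (nbox N :: ('d \<Rightarrow> nat) set))"
  have Y: "finite Y" using f by (simp add: Y_def)
  have sub: "{x. bconv q N u f x \<noteq> 0} \<subseteq> Y"
  proof
    fix x assume "x \<in> {x. bconv q N u f x \<noteq> 0}"
    then have "(\<Sum>v\<in>nbox N. (\<Prod>i\<in>UNIV. u (v i)) * f (x - emb q v)) \<noteq> 0"
      by (auto simp: bconv_def)
    then obtain v :: "'d \<Rightarrow> nat" where v: "v \<in> nbox N" "f (x - emb q v) \<noteq> 0"
      by (metis (no_types, lifting) mult_zero_right sum.neutral)
    then show "x \<in> Y" unfolding Y_def by (intro image_eqI[of _ _ "(x - emb q v, v)"]) auto
  qed
  show "finsupp (bconv q N u f)" using finite_subset[OF sub Y] .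
  fix \<xi>
  have shift: "(\<Sum>x\<in>Y. f (x - emb q v) * e (dotp x \<xi>)) = e (dotp (emb q v) \<xi>) * ft f \<xi>"
    if v: "v \<in> nbox N" for v
  proof -
    have "(\<Sum>x\<in>Y. f (x - emb q v) * e (dotp x \<xi>))
        = (\<Sum>x\<in>(\<lambda>x. x + emb q v) ` {x. f x \<noteq> 0}. f (x - emb q v) * e (dotp x \<xi>))"
    proof (rule sum.mono_neutral_right[OF Y])
      show "(\<lambda>x. x + emb q v) ` {x. f x \<noteq> 0} \<subseteq> Y"
        using v by (auto simp: Y_def)
      show "\<forall>x\<in>Y - (\<lambda>x. x + emb q v) ` {x. f x \<noteq> 0}. f (x - emb q v) * e (dotp x \<xi>) = 0"
        by (auto simp: image_iff) (metis diff_add_cancel)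
    qed
    also have "\<dots> = (\<Sum>x | f x \<noteq> 0. f x * e (dotp (x + emb q v) \<xi>))"
      by (subst sum.reindex) (auto simp: inj_on_def)
    also have "\<dots> = e (dotp (emb q v) \<xi>) * ft f \<xi>"
      by (simp add: ft_def dotp_add e_add sum_distrib_left mult_ac)
    finally show ?thesis .
  qed
  have "ft (bconv q N u f) \<xi> = (\<Sum>x\<in>Y. bconv q N u f x * e (dotp x \<xi>))"
    by (rule ft_superset[OF Y sub])
  also have "\<dots> = (\<Sum>v\<in>nbox N. (\<Prod>i\<in>UNIV. u (v i)) * (\<Sum>x\<in>Y. f (x - emb q v) * e (dotp x \<xi>)))
      / of_nat (N ^ CARD('d))"
    unfolding bconv_def sum_distrib_left sum_divide_distrib sum_distrib_right
    by (subst sum.swap) (simp add: mult_ac)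
  also have "\<dots> = (\<Sum>v\<in>nbox N. (\<Prod>i\<in>UNIV. u (v i)) * e (dotp (emb q v) \<xi>)) * ft f \<xi>
      / of_nat (N ^ CARD('d))"
    by (simp add: shift sum_distrib_right mult.assoc)
  also have "(\<Sum>v\<in>nbox N. (\<Prod>i\<in>UNIV. u (v i)) * e (dotp (emb q v) \<xi>))
      = (\<Sum>v\<in>nbox N. \<Prod>i\<in>UNIV. u (v i) * e (real (v i) * (real q * \<xi> i)))"
    by (simp add: dotp_def emb_def e_sum prod.distrib mult_ac)
  also have "\<dots> = (\<Prod>i\<in>UNIV. \<Sum>n<N. u n * e (real n * (real q * \<xi> i)))"
    by (rule sum_nbox_prod)
  finally show "ft (bconv q N u f) \<xi>
      = (\<Prod>i\<in>UNIV. (\<Sum>n<N. u n * e (real n * (real q * \<xi> i))) / of_nat N) * ft f \<xi>"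
    by (simp add: prod_dividef)
qed

section \<open>The maximal inequality for averages over cubes\<close>

text \<open>The cube has \<open>x\<close> as a corner, not as its centre, because the Weyl sums run
  over nonnegative coordinates.\<close>

definition bavg :: "nat \<Rightarrow> nat \<Rightarrow> (int ^ 'd::finite \<Rightarrow> real) \<Rightarrow> int ^ 'd \<Rightarrow> real" where
  "bavg q N h x = (\<Sum>v\<in>nbox N. h (x - emb q v)) / real (N ^ CARD('d))"

lemma emb_eq_iff: "q \<ge> 1 \<Longrightarrow> emb q v = emb q w \<longleftrightarrow> v = w"
  by (auto simp: emb_def vec_eq_iff fun_eq_iff)

lemma bavg_nonneg: "(\<And>x. 0 \<le> h x) \<Longrightarrow> 0 \<le> bavg q N h x"
  by (simp add: bavg_def sum_nonneg)

text \<open>Vitali's covering argument: choose a largest cube and discard the points whose cubes meet it;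
  these lie in a cube of twice the side length.\<close>

lemma hardy_littlewood_cubes:
  fixes X :: "(int ^ 'd::finite) set" and M :: "int ^ 'd \<Rightarrow> nat"
  assumes "finite X" "q \<ge> 1" "\<mu> \<ge> 0" and h: "\<And>x. 0 \<le> h x"
    and "\<And>x. x \<in> X \<Longrightarrow> M x \<ge> 1 \<and> \<mu> \<le> bavg q (M x) h x"
  shows "real (card X) * \<mu> \<le> 2 ^ CARD('d) * (\<Sum>y\<in>(\<Union>x\<in>X. (\<lambda>v. x - emb q v) ` nbox (M x)). h y)"
  using assms(1,5)
proof (induction X rule: finite_psubset_induct)
  case (psubset X)
  let ?Q = "\<lambda>x. (\<lambda>v. x - emb q v) ` nbox (M x)"
  show ?case
  proof (cases "X = {}")
    case False
    have "Max (M ` X) \<in> M ` X"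
      using psubset False by (intro Max_in) auto
    then obtain x where x: "x \<in> X" "M x = Max (M ` X)" by auto
    have Mx: "M y \<le> M x" if "y \<in> X" for y
      unfolding x(2) using that psubset by (intro Max_ge) auto
    have M1: "M x \<ge> 1" and avg: "\<mu> \<le> bavg q (M x) h x"
      using psubset.prems[OF x(1)] by blast+
    define Z where "Z = {y \<in> X. ?Q y \<inter> ?Q x \<noteq> {}}"
    have Q0: "x \<in> ?Q x"
      using M1 by (intro image_eqI[of _ _ "\<lambda>_. 0"]) (auto simp: emb_def nbox_def vec_eq_iff)
    have xZ: "x \<in> Z" using Q0 x by (auto simp: Z_def)
    have Z: "Z \<subseteq> (\<lambda>w. x + emb q w - emb q (\<lambda>_. M x)) ` nbox (2 * M x)"
    proof
      fix y assume "y \<in> Z"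
      then obtain v v' where y: "y \<in> X" "v \<in> nbox (M x)" "v' \<in> nbox (M y)" "y - emb q v' = x - emb q v"
        by (auto simp: Z_def)
      \<comment> \<open>Adding \<open>M x\<close> turns the coordinates of \<open>v' - v\<close>
        into natural numbers; they stay below \<open>2 * M x\<close> because
        \<open>M y \<le> M x\<close>.\<close>
      define w where "w = (\<lambda>i. v' i + M x - v i)"
      have v: "v i < M x" "v' i < M x" for i
        using y Mx[OF y(1)] by (auto simp: nbox_def intro: less_le_trans)
      have "w \<in> nbox (2 * M x)"
        unfolding nbox_def w_def
      proof (intro CollectI allI)
        fix i show "v' i + M x - v i < 2 * M x" using v[of i] by linarith
      qed
      moreover have "y = x + emb q w - emb q (\<lambda>_. M x)"
      proof -
        have "int (w i) = int (v' i) + int (M x) - int (v i)" for i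
          using v[of i] by (simp add: w_def)
        then have "int q * int (w i) - int q * int (M x) = int q * int (v' i) - int q * int (v i)" for i
          by (simp only:) (simp add: algebra_simps)
        then have "emb q w - emb q (\<lambda>_. M x) = emb q v' - emb q v"
          by (simp add: vec_eq_iff emb_def)
        then have "x + emb q w - emb q (\<lambda>_. M x) = x + (emb q v' - emb q v)"
          by (simp only: add_diff_eq[symmetric])
        also have "\<dots> = y" using y(4) by (simp add: algebra_simps)
        finally show ?thesis ..
      qed
      ultimately show "y \<in> (\<lambda>w. x + emb q w - emb q (\<lambda>_. M x)) ` nbox (2 * M x)" by blast
    qed
    have "card Z \<le> card (nbox (2 * M x) :: ('d \<Rightarrow> nat) set)"
      by (rule order_trans[OF card_mono[OF _ Z] card_image_le]) auto
    then have "real (card Z) \<le> real (2 ^ CARD('d) * M x ^ CARD('d))"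
      unfolding of_nat_le_iff by (simp add: power_mult_distrib)
    then have cZ: "real (card Z) \<le> 2 ^ CARD('d) * real (M x ^ CARD('d))" by simp
    have inj: "inj_on (\<lambda>v. x - emb q v) (nbox (M x))"
      using assms(2) by (auto simp: inj_on_def emb_eq_iff)
    have "real (card Z) * \<mu> \<le> 2 ^ CARD('d) * real (M x ^ CARD('d)) * bavg q (M x) h x"
      using cZ avg assms(3) by (intro mult_mono) auto
    also have "\<dots> = 2 ^ CARD('d) * (\<Sum>y\<in>?Q x. h y)"
      using M1 by (simp add: bavg_def sum.reindex[OF inj])
    finally have 1: "real (card Z) * \<mu> \<le> 2 ^ CARD('d) * (\<Sum>y\<in>?Q x. h y)" .
    \<comment> \<open>The cubes of the points outside \<open>Z\<close> miss the chosen cube, so the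
      two sums of \<open>h\<close> run over disjoint sets and can be added.\<close>
    have 2: "real (card (X - Z)) * \<mu> \<le> 2 ^ CARD('d) * (\<Sum>y\<in>(\<Union>x\<in>X - Z. ?Q x). h y)"
      using x xZ psubset.prems by (intro psubset.IH) auto
    have "card X = card Z + card (X - Z)"
      using psubset.hyps by (subst card_Diff_subset) (auto simp: Z_def card_mono)
    then have "real (card X) * \<mu> \<le> 2 ^ CARD('d) * ((\<Sum>y\<in>?Q x. h y) + (\<Sum>y\<in>(\<Union>x\<in>X - Z. ?Q x). h y))"
      using 1 2 by (simp add: ring_distribs)
    also have "(\<Sum>y\<in>?Q x. h y) + (\<Sum>y\<in>(\<Union>x\<in>X - Z. ?Q x). h y) = (\<Sum>y\<in>?Q x \<union> (\<Union>x\<in>X - Z. ?Q x). h y)"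
      using psubset.hyps by (intro sum.union_disjoint[symmetric]) (auto simp: Z_def)
    also have "\<dots> \<le> (\<Sum>y\<in>(\<Union>x\<in>X. ?Q x). h y)"
      using psubset.hyps x h by (intro sum_mono2) auto
    finally show ?thesis by simp
  qed simp
qed

text \<open>The choice function \<open>M\<close> linearises the maximal function: any cube with a
  large average may be assigned to a point, and the bound does not depend on the choice.\<close>

lemma weak_type_cubes:
  fixes X :: "(int ^ 'd::finite) set" and M :: "int ^ 'd \<Rightarrow> nat"
  assumes "finite X" "q \<ge> 1" "\<mu> > 0" and h: "\<And>x. 0 \<le> h x"
    and "\<And>x. x \<in> X \<Longrightarrow> M x \<ge> 1 \<and> \<mu> \<le> bavg q (M x) h x"
    and Y: "finite Y" "{x. h x \<noteq> 0} \<subseteq> Y"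
  shows "real (card X) \<le> 2 ^ CARD('d) * (\<Sum>y\<in>Y. h y) / \<mu>"
proof -
  let ?U = "\<Union>x\<in>X. (\<lambda>v. x - emb q v) ` nbox (M x)"
  have "real (card X) * \<mu> \<le> 2 ^ CARD('d) * (\<Sum>y\<in>?U. h y)"
    using assms by (intro hardy_littlewood_cubes) auto
  also have "(\<Sum>y\<in>?U. h y) = (\<Sum>y\<in>?U \<inter> Y. h y)"
    using assms by (intro sum.mono_neutral_right) auto
  also have "\<dots> \<le> (\<Sum>y\<in>Y. h y)"
    using Y h by (intro sum_mono2) auto
  finally show ?thesis using assms(3) by (simp add: field_simps)
qed

lemma card_le_sum_div:
  fixes g :: "'a \<Rightarrow> real"
  assumes "finite X" "\<beta> > 0" "\<And>x. x \<in> X \<Longrightarrow> \<beta> \<le> g x"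
  shows "real (card X) \<le> (\<Sum>x\<in>X. g x) / \<beta>"
proof -
  have "real (card X) * \<beta> = (\<Sum>x\<in>X. \<beta>)" by simp
  also have "\<dots> \<le> (\<Sum>x\<in>X. g x)" using assms by (intro sum_mono)
  finally show ?thesis using assms by (simp add: field_simps)
qed

section \<open>Arcs\<close>

text \<open>The circle is replaced by the grid of the points \<open>i / (W * 2 ^ (j * k))\<close>; here
  \<open>arcs k W j s\<close> collects those within \<open>2 ^ s / (q * 2 ^ (j * k))\<close> of a reduced fraction with
  denominator \<open>q \<le> 2 ^ s\<close>.\<close>

definition arcs :: "nat \<Rightarrow> nat \<Rightarrow> nat \<Rightarrow> nat \<Rightarrow> nat set" where
  "arcs k W j s = {i \<in> {..<W * 2 ^ (j * k)}. \<exists>q a::int. 1 \<le> q \<and> q \<le> 2 ^ s \<and> coprime a q \<and>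
     \<bar>int i * q - a * int W * 2 ^ (j * k)\<bar> \<le> 2 ^ s * int W}"

text \<open>If \<open>q\<close> divides \<open>W\<close>, the triple \<open>(q, a, v)\<close> encodes the point \<open>a / q + (v / W) / 2 ^ (j * k)\<close> at
  every scale \<open>j\<close>; thus the index sets do not depend on the scale, as is needed to sum over all scales.\<close>

definition arc_index :: "nat \<Rightarrow> nat \<Rightarrow> (int \<times> int \<times> int) set" where
  "arc_index W s = {(q, a, v). 1 \<le> q \<and> q \<le> 2 ^ s \<and> 0 \<le> a \<and> a \<le> q \<and> \<bar>v\<bar> * q \<le> 2 ^ s * int W}"

text \<open>The excluded part is level \<open>s\<close>, so either the denominator or the distance
  to the fraction is large. With \<open>\<tau> = v / W\<close> both cases give
  \<open>2 ^ s \<le> q * (1 + \<bar>\<tau>\<bar>)\<close>, the quantity that governs the decay.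
  Coprimality is kept for the Gauss sums.\<close>

definition outer_index :: "nat \<Rightarrow> nat \<Rightarrow> (int \<times> int \<times> int) set" where
  "outer_index W s = {(q, a, v) \<in> arc_index W (Suc s).
     coprime a q \<and> \<not> (q \<le> 2 ^ s \<and> \<bar>v\<bar> * q \<le> 2 ^ s * int W)}"

definition arc_point :: "nat \<Rightarrow> nat \<Rightarrow> nat \<Rightarrow> int \<times> int \<times> int \<Rightarrow> int" where
  "arc_point k W j = (\<lambda>(q, a, v). v + a * (int W div q) * 2 ^ (j * k))"

text \<open>For fixed \<open>q\<close> there are \<open>q + 1\<close> choices of \<open>a\<close>
  and about \<open>2 * 2 ^ s * W / q\<close> choices of \<open>v\<close>: the window shrinks like
  \<open>1 / q\<close>, so \<open>q\<close> cancels and each of the \<open>2 ^ s\<close>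
  denominators contributes \<open>O (2 ^ s * W)\<close>.\<close>

lemma arc_index_bound:
  assumes "W \<ge> 1"
  shows "finite (arc_index W s)" "real (card (arc_index W s)) \<le> 6 * 4 ^ s * real W"
proof -
  define b where "b = (\<lambda>q::int. 2 ^ s * int W div q)"
  define S where "S = Sigma {1..2 ^ s :: int} (\<lambda>q. {0..q} \<times> {- b q..b q})"
  have sub: "arc_index W s \<subseteq> S"
  proof
    fix x assume "x \<in> arc_index W s"
    then obtain q a v where x: "x = (q, a, v)" "1 \<le> q" "q \<le> 2 ^ s" "0 \<le> a" "a \<le> q" "\<bar>v\<bar> * q \<le> 2 ^ s * int W"
      by (auto simp: arc_index_def)
    have "\<bar>v\<bar> = \<bar>v\<bar> * q div q" using x(2) by simp
    also have "\<dots> \<le> b q" unfolding b_def using x(2,6) by (intro zdiv_mono1) auto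
    finally have "\<bar>v\<bar> \<le> b q" .
    then show "x \<in> S" using x by (auto simp: S_def)
  qed
  have fin: "finite S" by (simp add: S_def)
  show "finite (arc_index W s)" using finite_subset[OF sub fin] .
  have "card S = (\<Sum>q\<in>{1..2 ^ s :: int}. card {0..q} * card {- b q..b q})"
    unfolding S_def by (subst card_SigmaI) (auto simp: card_cartesian_product)
  also have "real \<dots> \<le> (\<Sum>q\<in>{1..2 ^ s :: int}. 6 * 2 ^ s * real W)"
    unfolding of_nat_sum
  proof (rule sum_mono)
    fix q :: int assume q: "q \<in> {1..2 ^ s}"
    have b0: "0 \<le> b q" using q by (simp add: b_def pos_imp_zdiv_nonneg_iff)
    have bq: "b q * q \<le> 2 ^ s * int W" using q by (simp add: b_def minus_mod_eq_div_mult [symmetric])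
    have "q * 1 \<le> 2 ^ s * int W" using q assms by (intro mult_mono) auto
    then have "int (card {0..q} * card {- b q..b q}) = (q + 1) * (2 * b q + 1)"
      using q b0 by simp
    also have "\<dots> \<le> (2 * q) * (2 * b q + 1)" using q b0 by (intro mult_right_mono) auto
    also have "\<dots> = 4 * (b q * q) + 2 * q" by (simp add: algebra_simps)
    also have "\<dots> \<le> 6 * (2 ^ s * int W)" using bq \<open>q * 1 \<le> _\<close> by linarith
    finally have "real_of_int (int (card {0..q} * card {- b q..b q})) \<le> real_of_int (6 * (2 ^ s * int W))"
      by (simp only: of_int_le_iff)
    then show "real (card {0..q} * card {- b q..b q}) \<le> 6 * 2 ^ s * real W"
      unfolding of_int_of_nat_eq by (simp only: of_int_mult of_int_power of_int_numeral of_int_of_nat_eq mult.assoc)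
  qed
  also have "\<dots> = 6 * 4 ^ s * real W"
    by (simp add: power_mult_distrib[symmetric] flip: power_mult_distrib)
  finally show "real (card (arc_index W s)) \<le> 6 * 4 ^ s * real W"
    using card_mono[OF fin sub] by linarith
qed

lemma outer_index_bound:
  assumes "W \<ge> 1"
  shows "finite (outer_index W s)" "real (card (outer_index W s)) \<le> 24 * 4 ^ s * real W"
proof -
  have sub: "outer_index W s \<subseteq> arc_index W (Suc s)" by (auto simp: outer_index_def)
  show "finite (outer_index W s)" using finite_subset[OF sub arc_index_bound(1)[OF assms]] .
  show "real (card (outer_index W s)) \<le> 24 * 4 ^ s * real W"
    using card_mono[OF arc_index_bound(1)[OF assms] sub] arc_index_bound(2)[OF assms, of "Suc s"] by simp
qed

lemma finite_arcs [simp]: "finite (arcs k W j s)"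
  by (simp add: arcs_def)

lemma arcs_mono: "s \<le> t \<Longrightarrow> arcs k W j s \<subseteq> arcs k W j t"
proof -
  assume "s \<le> t"
  then have *: "(2::int) ^ s \<le> 2 ^ t" by simp
  then have **: "2 ^ s * int W \<le> 2 ^ t * int W" by (intro mult_right_mono) auto
  show ?thesis
  proof
    fix i assume "i \<in> arcs k W j s"
    then obtain q a where "i < W * 2 ^ (j * k)" "1 \<le> q" "q \<le> 2 ^ s" "coprime a q"
      "\<bar>int i * q - a * int W * 2 ^ (j * k)\<bar> \<le> 2 ^ s * int W"
      unfolding arcs_def by blast
    moreover from this have "q \<le> 2 ^ t" "\<bar>int i * q - a * int W * 2 ^ (j * k)\<bar> \<le> 2 ^ t * int W"
      using * ** by linarith+
    ultimately show "i \<in> arcs k W j t"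
      unfolding arcs_def by blast
  qed
qed

text \<open>The range of \<open>a\<close> is not part of the definition of \<open>arcs\<close>. It
  follows since \<open>s < j * k\<close> makes the window shorter than the full circle
  \<open>P = W * 2 ^ (j * k)\<close>, which puts \<open>a * P\<close> strictly between
  \<open>- P\<close> and \<open>(q + 1) * P\<close>.\<close>

lemma arc_witness:
  assumes i: "i < W * 2 ^ (j * k)" and s: "s < j * k" and dvd: "q dvd int W" and q: "1 \<le> q" "q \<le> 2 ^ s"
    and c: "\<bar>int i * q - a * int W * 2 ^ (j * k)\<bar> \<le> 2 ^ s * int W" and W: "W \<ge> 1"
  defines "v \<equiv> int i - a * (int W div q) * 2 ^ (j * k)"
  shows "(q, a, v) \<in> arc_index W s" "arc_point k W j (q, a, v) = int i"
proof -
  define P where "P = int W * 2 ^ (j * k)"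
  have Wq: "int W div q * q = int W" using dvd by simp
  have vq: "v * q = int i * q - a * int W * 2 ^ (j * k)"
  proof -
    have "v * q = int i * q - a * (int W div q * q) * 2 ^ (j * k)"
      unfolding v_def by (simp only: left_diff_distrib) (simp only: mult_ac)
    then show ?thesis by (simp only: Wq)
  qed
  have "(2::int) ^ s < 2 ^ (j * k)" using s by simp
  then have sP: "2 ^ s * int W < P" using W by (simp add: P_def)
  have iP: "int i < P" using i unfolding P_def by (metis of_nat_less_iff of_nat_mult of_nat_numeral of_nat_power)
  have c': "\<bar>int i * q - a * P\<bar> \<le> 2 ^ s * int W" using c by (simp add: P_def mult_ac)
  have P0: "0 < P" using W by (simp add: P_def)
  have "0 \<le> int i * q" using q by simp
  then have "(- 1) * P < a * P" using c' sP by linarith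
  then have a0: "0 \<le> a" using P0 by (simp only: mult_less_cancel_right_pos)
  have "int i * q \<le> (P - 1) * q" using iP q by (intro mult_right_mono) auto
  also have "\<dots> \<le> q * P" using q by (simp add: algebra_simps)
  finally have "a * P < (q + 1) * P" using c' sP by (simp add: algebra_simps)
  then have aq: "a \<le> q" using P0 by (simp only: mult_less_cancel_right_pos)
  have "\<bar>v\<bar> * q = \<bar>v * q\<bar>" using q by (simp add: abs_mult)
  then show "(q, a, v) \<in> arc_index W s"
    using c a0 aq q vq by (auto simp: arc_index_def)
  show "arc_point k W j (q, a, v) = int i" by (simp add: arc_point_def v_def)
qed

lemma arcs_subset_image:
  assumes "s < j * k" "\<And>q. 1 \<le> q \<Longrightarrow> q \<le> 2 ^ s \<Longrightarrow> q dvd int W" "W \<ge> 1"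
  shows "int ` arcs k W j s \<subseteq> arc_point k W j ` arc_index W s"
proof
  fix z assume "z \<in> int ` arcs k W j s"
  then obtain i where i: "z = int i" "i \<in> arcs k W j s" by blast
  then obtain q a where *: "i < W * 2 ^ (j * k)" "1 \<le> q" "q \<le> 2 ^ s"
    "\<bar>int i * q - a * int W * 2 ^ (j * k)\<bar> \<le> 2 ^ s * int W"
    by (auto simp: arcs_def)
  from i(1) arc_witness[OF *(1) assms(1) assms(2)[OF *(2,3)] *(2,3,4) assms(3)]
  show "z \<in> arc_point k W j ` arc_index W s" by (metis image_eqI)
qed

lemma card_arcs:
  assumes "s < j * k" "\<And>q. 1 \<le> q \<Longrightarrow> q \<le> 2 ^ s \<Longrightarrow> q dvd int W" "W \<ge> 1"
  shows "real (card (arcs k W j s)) \<le> 6 * 4 ^ s * real W"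
proof -
  have "card (int ` arcs k W j s) \<le> card (arc_index W s)"
    using surj_card_le[OF arc_index_bound(1)[OF assms(3)] arcs_subset_image[OF assms]] .
  then have "card (arcs k W j s) \<le> card (arc_index W s)"
    by (simp add: card_image)
  then show ?thesis using arc_index_bound(2)[OF assms(3), of s] by linarith
qed

text \<open>A point off level \<open>s\<close> violates the conditions of level \<open>s\<close> for
  every fraction, in particular for the one that puts it on level \<open>Suc s\<close>; this is the
  exclusion in \<open>outer_index\<close>.\<close>

lemma outer_arcs_subset_image:
  assumes "Suc s < j * k" "\<And>q. 1 \<le> q \<Longrightarrow> q \<le> 2 ^ Suc s \<Longrightarrow> q dvd int W" "W \<ge> 1"
  shows "int ` (arcs k W j (Suc s) - arcs k W j s) \<subseteq> arc_point k W j ` outer_index W s"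
proof
  fix z assume "z \<in> int ` (arcs k W j (Suc s) - arcs k W j s)"
  then obtain i where z: "z = int i" and i: "i \<in> arcs k W j (Suc s) - arcs k W j s" by blast
  then obtain q a where *: "i < W * 2 ^ (j * k)" "1 \<le> q" "q \<le> 2 ^ Suc s" 
    "\<bar>int i * q - a * int W * 2 ^ (j * k)\<bar> \<le> 2 ^ Suc s * int W" and cop: "coprime a q"
    unfolding arcs_def by blast
  define v where "v = int i - a * (int W div q) * 2 ^ (j * k)"
  note w = arc_witness[OF *(1) assms(1) assms(2)[OF *(2,3)] *(2,3,4) assms(3), folded v_def]
  have Wq: "int W div q * q = int W" using assms(2)[OF *(2,3)] by simp
  have "v * q = int i * q - a * int W * 2 ^ (j * k)"
  proof -
    have "v * q = int i * q - a * (int W div q * q) * 2 ^ (j * k)"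
      unfolding v_def by (simp only: left_diff_distrib) (simp only: mult_ac)
    then show ?thesis by (simp only: Wq)
  qed
  then have "\<bar>v\<bar> * q = \<bar>int i * q - a * int W * 2 ^ (j * k)\<bar>"
    using *(2) by (metis abs_mult abs_of_nonneg order.trans zero_le_one)
  then have "\<not> (q \<le> 2 ^ s \<and> \<bar>v\<bar> * q \<le> 2 ^ s * int W)"
    using i cop *(1,2) by (auto simp: arcs_def)
  then have "(q, a, v) \<in> outer_index W s" using w(1) cop by (auto simp: outer_index_def)
  then show "z \<in> arc_point k W j ` outer_index W s" using w(2) z by (metis image_eqI)
qed

section \<open>Normalised Weyl sums\<close>

definition wsum :: "nat \<Rightarrow> nat \<Rightarrow> real \<Rightarrow> real \<Rightarrow> complex" where
  "wsum k N t \<xi> = (\<Sum>n<N. e (t * real n ^ k + \<xi> * real n)) / of_nat N"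

text \<open>The Sup Hypothesis for normalised sums that start at 0. Having \<open>C \<ge> 1\<close>
  lets the trivial bound 1 be absorbed in degenerate cases.\<close>

definition weyl_bound :: "nat \<Rightarrow> real \<Rightarrow> real \<Rightarrow> bool" where
  "weyl_bound k \<theta> C \<longleftrightarrow> C \<ge> 1 \<and> (\<forall>(N::nat) (t::real) (\<xi>::real) (a::int) (q::int).
     1 \<le> N \<longrightarrow> 1 \<le> a \<longrightarrow> a < q \<longrightarrow> q \<le> int N ^ k \<longrightarrow> coprime a q \<longrightarrow>
     \<bar>t - real_of_int a / real_of_int q\<bar> \<le> 1 / (real_of_int q)\<^sup>2 \<longrightarrow>
     cmod (wsum k N t \<xi>) \<le> C * (1 / real_of_int q + 1 / real N + real_of_int q / real N ^ k) powr \<theta>)"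

lemma weyl_boundD:
  assumes "weyl_bound k \<theta> C" "1 \<le> N" "1 \<le> a" "a < q" "q \<le> int N ^ k" "coprime a q"
    "\<bar>t - real_of_int a / real_of_int q\<bar> \<le> 1 / (real_of_int q)\<^sup>2"
  shows "cmod (wsum k N t \<xi>) \<le> C * (1 / real_of_int q + 1 / real N + real_of_int q / real N ^ k) powr \<theta>"
  using assms unfolding weyl_bound_def by blast

lemma weyl_bound_ge_1: "weyl_bound k \<theta> C \<Longrightarrow> 1 \<le> C"
  by (simp add: weyl_bound_def)

lemma norm_wsum_le_1: "cmod (wsum k N t \<xi>) \<le> 1"
proof (cases "N = 0")
  case False
  have "cmod (\<Sum>n<N. e (t * real n ^ k + \<xi> * real n)) \<le> (\<Sum>n<N. 1)"
    by (intro sum_norm_le) simp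
  then show ?thesis using False by (simp add: wsum_def norm_divide)
qed (simp add: wsum_def)

text \<open>Changing the range \<open>1..N\<close> to \<open>0..N - 1\<close> alters two terms of
  modulus 1. They are absorbed by the bound because
  \<open>1 / N \<le> (1 / N) powr \<theta>\<close>.\<close>

lemma sup_hypothesis_imp_weyl_bound:
  assumes "sup_hypothesis k \<theta>" "0 < \<theta>" "\<theta> \<le> 1" "k \<ge> 1"
  shows "\<exists>C. weyl_bound k \<theta> C"
proof -
  obtain C where C: "\<And>(N::nat) (t::real) (\<xi>::real) (a::int) (q::int).
     1 \<le> a \<Longrightarrow> a < q \<Longrightarrow> q \<le> int N ^ k \<Longrightarrow> coprime a q \<Longrightarrow>
     \<bar>t - real_of_int a / real_of_int q\<bar> \<le> 1 / (real_of_int q)\<^sup>2 \<Longrightarrow>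
     cmod (\<Sum>n=1..N. e (t * real n ^ k + \<xi> * real n))
       \<le> C * real N * (1 / real_of_int q + 1 / real N + real_of_int q / real N ^ k) powr \<theta>"
    using assms(1) unfolding sup_hypothesis_def by blast
  have "weyl_bound k \<theta> (max C 0 + 2)"
    unfolding weyl_bound_def
  proof (intro conjI allI impI)
    fix N :: nat and t \<xi> :: real and a q :: int
    assume N: "1 \<le> N" and a: "1 \<le> a" "a < q" "q \<le> int N ^ k" "coprime a q"
      and t: "\<bar>t - real_of_int a / real_of_int q\<bar> \<le> 1 / (real_of_int q)\<^sup>2"
    define B where "B = (1 / real_of_int q + 1 / real N + real_of_int q / real N ^ k) powr \<theta>"
    define F where "F = (\<lambda>n::nat. e (t * real n ^ k + \<xi> * real n))"
    have "(1 / real N) powr 1 \<le> (1 / real N) powr \<theta>"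
      using N assms by (intro powr_mono') auto
    also have "\<dots> \<le> B"
      unfolding B_def using N a assms by (intro powr_mono2) auto
    finally have B: "1 \<le> real N * B" using N by (simp add: field_simps)
    have "(\<Sum>n<N. F n) + F N = (\<Sum>n<Suc N. F n)" by simp
    also have "\<dots> = F 0 + (\<Sum>n=1..N. F n)"
      unfolding sum.lessThan_Suc_shift by (simp add: sum.atLeast1_atMost_eq)
    finally have eq: "(\<Sum>n<N. F n) = F 0 + (\<Sum>n=1..N. F n) - F N"
      by (simp add: algebra_simps)
    have F1: "cmod (F n) = 1" for n by (simp add: F_def)
    have "cmod (\<Sum>n<N. F n) \<le> cmod (F 0) + cmod (\<Sum>n=1..N. F n) + cmod (F N)"
      unfolding eq by (rule order_trans[OF norm_triangle_ineq4 add_right_mono[OF norm_triangle_ineq]])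
    also have "\<dots> \<le> 1 + C * real N * B + 1"
      using C[OF a t, of \<xi>] F1 by (simp add: B_def F_def)
    also have "\<dots> \<le> 2 * (real N * B) + max C 0 * (real N * B)"
      using B mult_right_mono[of C "max C 0" "real N * B"] by (simp add: mult_ac)
    finally have "cmod (\<Sum>n<N. F n) \<le> (max C 0 + 2) * B * real N"
      by (simp add: algebra_simps)
    then show "cmod (wsum k N t \<xi>) \<le> (max C 0 + 2) * B"
      using N by (simp add: wsum_def F_def norm_divide divide_le_eq)
  qed simp
  then show ?thesis by blast
qed

section \<open>Three consequences of the Sup Hypothesis\<close>

lemma powr_scale_le:
  fixes c x \<theta> :: real
  assumes "c \<ge> 1" "x > 0" "0 < \<theta>" "\<theta> \<le> 1" "0 \<le> y" "y \<le> c / x"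
  shows "y powr \<theta> \<le> c * x powr (- \<theta>)"
proof -
  have "y powr \<theta> \<le> (c / x) powr \<theta>"
    using assms by (intro powr_mono2) auto
  also have "\<dots> = c powr \<theta> * x powr (- \<theta>)"
    using assms by (simp add: powr_divide powr_minus_divide)
  also have "\<dots> \<le> c powr 1 * x powr (- \<theta>)"
    using assms by (intro mult_right_mono powr_mono) auto
  finally show ?thesis using assms by simp
qed

text \<open>Dirichlet's theorem with denominators up to \<open>n = 2 ^ (j * k - s)\<close> produces
  a fraction whose window would put \<open>i\<close> on level \<open>s\<close> if its denominator
  were at most \<open>2 ^ s\<close>. Hence \<open>2 ^ s < q \<le> n\<close>, and together with
  \<open>s \<le> j\<close> each of the three terms in the Weyl bound is at most
  \<open>1 / 2 ^ s\<close>.\<close>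

lemma minor_arc_bound:
  assumes C: "weyl_bound k \<theta> C" and \<theta>: "0 < \<theta>" "\<theta> \<le> 1" and k: "k \<ge> 1" and W: "W \<ge> 1"
    and i: "i < W * 2 ^ (j * k)" "i \<notin> arcs k W j s" and s: "s \<le> j"
  shows "cmod (wsum k (2 ^ j) (real i / (real W * 2 ^ (j * k))) \<xi>) \<le> 3 * C * (2 ^ s) powr (- \<theta>)"
proof -
  define t where "t = real i / (real W * 2 ^ (j * k))"
  define n where "n = (2::nat) ^ (j * k - s)"
  have sjk: "s \<le> j * k" using s k by (metis mult.right_neutral mult_le_mono)
  have ns: "real n * 2 ^ s = 2 ^ (j * k)"
    using sjk by (simp add: n_def flip: power_add)
  have n0: "n > 0" by (simp add: n_def)
  obtain h q where hq: "coprime h q" "0 < q" "q \<le> int n" "\<bar>of_int q * t - of_int h\<bar> < 1 / n"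
    using Dirichlet_approx_coprime[OF n0, of t] by blast
  have "real i < real (W * 2 ^ (j * k))" using i by (simp only: of_nat_less_iff)
  then have iW: "real i < real W * 2 ^ (j * k)" by simp
  have P0: "0 < real W * 2 ^ (j * k)" using W by simp
  have t: "0 \<le> t" "t < 1" using iW P0 by (auto simp: t_def field_simps)
  have q2: "2 ^ s < q"
  proof (rule ccontr)
    assume "\<not> 2 ^ s < q"
    have "real i = t * (real W * 2 ^ (j * k))" using P0 W by (simp add: t_def)
    then have "real_of_int (int i * q - h * int W * 2 ^ (j * k)) = (of_int q * t - of_int h) * (real W * 2 ^ (j * k))"
      by (simp add: algebra_simps)
    then have "\<bar>real_of_int (int i * q - h * int W * 2 ^ (j * k))\<bar> = \<bar>of_int q * t - of_int h\<bar> * (real W * 2 ^ (j * k))"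
      by (simp add: abs_mult)
    also have "\<dots> \<le> 1 / n * (real W * 2 ^ (j * k))"
      using hq by (intro mult_right_mono) auto
    also have "\<dots> = real_of_int (2 ^ s * int W)"
      using n0 by (simp add: ns[symmetric])
    finally have "\<bar>int i * q - h * int W * 2 ^ (j * k)\<bar> \<le> 2 ^ s * int W"
      by (simp only: of_int_abs[symmetric] of_int_le_iff)
    then have "i \<in> arcs k W j s"
      using i hq \<open>\<not> 2 ^ s < q\<close> unfolding arcs_def by (auto intro!: exI[of _ q])
    then show False using i by simp
  qed
  have "(1::int) \<le> 2 ^ s" by simp
  then have q1: "1 < q" using q2 by linarith
  have n1: "1 / real n \<le> 1" using n0 by simp
  \<comment> \<open>The hypothesis asks for a numerator strictly between 0 and \<open>q\<close>. The
    end values are excluded because they are not coprime to \<open>q > 1\<close>.\<close>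
  have "- 1 < real_of_int h" using hq(4) n1 t hq(2) mult_nonneg_nonneg[of "of_int q" t] by linarith
  then have "h \<ge> 0" by linarith
  moreover have "h \<noteq> 0" using hq(1) q1 by auto
  ultimately have h1: "1 \<le> h" by linarith
  have "of_int q * t \<le> of_int q" using t hq(2) by (simp add: mult_left_le)
  moreover have "real_of_int h - of_int q * t < 1" using hq(4) n1 by linarith
  ultimately have "h < q + 1" by linarith
  moreover have "h \<noteq> q" using hq(1) q1 by auto
  ultimately have h2: "h < q" by linarith
  have qn: "real_of_int q \<le> real n" using hq(3) by linarith
  have "n \<le> 2 ^ (j * k)" unfolding n_def by (intro power_increasing) auto
  then have "int n \<le> 2 ^ (j * k)" by (metis of_nat_le_iff of_nat_numeral of_nat_power)
  then have qN: "q \<le> int (2 ^ j) ^ k" using hq(3) by (simp add: power_mult)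
  have "\<bar>t - real_of_int h / real_of_int q\<bar> = \<bar>of_int q * t - of_int h\<bar> / of_int q"
    using hq(2) by (simp add: field_simps abs_divide flip: abs_mult)
  also have "\<dots> \<le> (1 / n) / of_int q" using hq by (intro divide_right_mono) auto
  also have "\<dots> \<le> (1 / of_int q) / of_int q"
    using hq qn by (intro divide_right_mono divide_left_mono) auto
  finally have "\<bar>t - real_of_int h / real_of_int q\<bar> \<le> 1 / (real_of_int q)\<^sup>2"
    by (simp add: power2_eq_square)
  with C h1 h2 qN hq(1) have
    "cmod (wsum k (2 ^ j) t \<xi>) \<le> C * (1 / real_of_int q + 1 / real (2 ^ j) + real_of_int q / real (2 ^ j) ^ k) powr \<theta>"
    by (intro weyl_boundD) auto
  also have "\<dots> \<le> C * (3 * (2 ^ s) powr (- \<theta>))"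
  proof (intro mult_left_mono powr_scale_le \<theta>)
    have "(2::real) ^ s < q" using q2 by (metis of_int_less_iff of_int_numeral of_int_power)
    then have "1 / real_of_int q \<le> 1 / 2 ^ s" using q1 by (intro divide_left_mono) auto
    moreover have "1 / real (2 ^ j) \<le> 1 / 2 ^ s"
      using s by (simp add: divide_left_mono)
    moreover have "real_of_int q / real (2 ^ j) ^ k \<le> real n / 2 ^ (j * k)"
      using qn by (simp add: power_mult divide_right_mono)
    moreover have "real n / 2 ^ (j * k) = 1 / 2 ^ s"
      using n0 by (simp add: ns[symmetric])
    ultimately show "1 / real_of_int q + 1 / real (2 ^ j) + real_of_int q / real (2 ^ j) ^ k \<le> 3 / 2 ^ s"
      by linarith
    show "0 \<le> 1 / real_of_int q + 1 / real (2 ^ j) + real_of_int q / real (2 ^ j) ^ k"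
      using q1 by simp
  qed (use weyl_bound_ge_1[OF C] in auto)
  finally show ?thesis by (simp add: t_def mult_ac)
qed

text \<open>A complete sum has length \<open>q\<close>, so for \<open>k \<ge> 2\<close> all three
  terms of the Weyl bound are at most \<open>1 / q\<close>. The denominator 1 admits no numerator
  and falls under the trivial bound.\<close>

lemma gauss_sum_bound:
  assumes C: "weyl_bound k \<theta> C" and \<theta>: "0 < \<theta>" "\<theta> \<le> 1" and k: "k \<ge> 2"
    and q: "q \<ge> 1" and a: "0 \<le> a" "a \<le> int q" "coprime a (int q)"
  shows "cmod (wsum k q (of_int a / real q) \<xi>) \<le> 3 * C * real q powr (- \<theta>)"
proof (cases "q = 1")
  case True
  have "C \<ge> 1" using weyl_bound_ge_1[OF C] .
  then show ?thesis using True norm_wsum_le_1[of k 1 "of_int a" \<xi>] by simp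
next
  case False
  then have q2: "q \<ge> 2" using q by simp
  have "a \<noteq> 0" "a \<noteq> int q" using a(3) q2 by auto
  then have a': "1 \<le> a" "a < int q" using a by auto
  have "q ^ 1 \<le> q ^ k" using q k by (intro power_increasing) auto
  then have qk: "int q \<le> int q ^ k" by (metis of_nat_le_iff of_nat_power power_one_right)
  have "cmod (wsum k q (of_int a / real q) \<xi>)
      \<le> C * (1 / real_of_int (int q) + 1 / real q + real_of_int (int q) / real q ^ k) powr \<theta>"
    using weyl_boundD[OF C q a' qk a(3), of "of_int a / real q"] by simp
  also have "\<dots> \<le> C * (3 * real q powr (- \<theta>))"
  proof (intro mult_left_mono powr_scale_le \<theta>)
    have "real q ^ 2 \<le> real q ^ k" using q k by (intro power_increasing) auto
    then have "real q / real q ^ k \<le> real q / real q ^ 2"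
      using q by (intro divide_left_mono) auto
    then show "1 / real_of_int (int q) + 1 / real q + real_of_int (int q) / real q ^ k \<le> 3 / real q"
      using q by (simp add: power2_eq_square)
  qed (use weyl_bound_ge_1[OF C] q in auto)
  finally show ?thesis by (simp add: mult_ac)
qed

lemma wsum_cnj: "wsum k N (- t) \<xi> = cnj (wsum k N t (- \<xi>))"
  by (simp add: wsum_def flip: e_minus)

text \<open>For \<open>\<tau> > 1\<close>, the number \<open>\<tau> / M ^ k\<close> is approximated by the reciprocal of the integer part of
  \<open>M ^ k / \<tau>\<close>.\<close>

lemma oscillation_bound_pos:
  assumes C: "weyl_bound k \<theta> C" and \<theta>: "0 < \<theta>" "\<theta> \<le> 1" and k: "k \<ge> 2"
    and M: "M \<ge> 1" "real M \<ge> 2 * \<tau>" and \<tau>: "0 \<le> \<tau>"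
  shows "cmod (wsum k M (\<tau> / real M ^ k) \<xi>) \<le> 8 * C * (1 + \<tau>) powr (- \<theta>)"
proof (cases "\<tau> \<le> 1")
  case True
  have "C \<ge> 1" using weyl_bound_ge_1[OF C] .
  have "1 \<le> 8 * (1 + \<tau>) powr (- \<theta>)"
    using powr_scale_le[of 8 "1 + \<tau>" \<theta> 1] True \<tau> \<theta> by simp
  also have "\<dots> \<le> C * (8 * (1 + \<tau>) powr (- \<theta>))"
    using mult_right_mono[OF \<open>C \<ge> 1\<close>, of "8 * (1 + \<tau>) powr (- \<theta>)"] by simp
  finally show ?thesis using norm_wsum_le_1[of k M "\<tau> / real M ^ k" \<xi>] by (simp add: mult_ac)
next
  case False
  define x where "x = real M ^ k / \<tau>"
  define q where "q = \<lfloor>x\<rfloor>"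
  have "real M ^ 1 \<le> real M ^ k" "real M ^ 2 \<le> real M ^ k" using M k by (intro power_increasing; simp)+
  then have Mk: "real M \<le> real M ^ k" "real M * real M \<le> real M ^ k" by (auto simp: power2_eq_square)
  have "2 * \<tau> \<le> real M ^ k" using M(2) Mk(1) by linarith
  then have x2: "x \<ge> 2" using False unfolding x_def by (simp add: le_divide_eq)
  have q: "real_of_int q \<le> x" "x \<le> 2 * real_of_int q" "2 \<le> q"
    using x2 by (auto simp: q_def le_floor_iff) linarith
  have "x \<le> real M ^ k" using False Mk M by (simp add: x_def divide_le_eq mult_le_cancel_left1)
  then have "real_of_int q \<le> real_of_int (int M ^ k)" using q by simp
  then have qM: "q \<le> int M ^ k" by (simp only: of_int_le_iff)
  have t: "\<tau> / real M ^ k = 1 / x" using False M by (simp add: x_def)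
  have "\<bar>1 / x - 1 / of_int q\<bar> = (x - of_int q) / (x * of_int q)"
    using q x2 by (subst abs_of_nonpos) (auto simp: field_simps)
  also have "\<dots> \<le> 1 / (of_int q * of_int q)"
  proof (rule frac_le)
    show "x - of_int q \<le> 1" unfolding q_def by linarith
    show "real_of_int q * of_int q \<le> x * of_int q" using q by (intro mult_right_mono) auto
  qed (use q in auto)
  finally have ap: "\<bar>\<tau> / real M ^ k - of_int 1 / of_int q\<bar> \<le> 1 / (real_of_int q)\<^sup>2"
    by (simp add: t power2_eq_square)
  have "cmod (wsum k M (\<tau> / real M ^ k) \<xi>)
      \<le> C * (1 / real_of_int q + 1 / real M + real_of_int q / real M ^ k) powr \<theta>"
    using weyl_boundD[OF C M(1) _ _ qM _ ap] q by simp
  also have "\<dots> \<le> C * (8 * (1 + \<tau>) powr (- \<theta>))"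
  proof (intro mult_left_mono powr_scale_le \<theta>)
    \<comment> \<open>Since \<open>1 / q \<le> 2 / x\<close>, this makes the first term
      \<open>O (1 / \<tau>)\<close>; it is here that \<open>M\<close> has to be large compared with
      \<open>\<tau>\<close>.\<close>
    have x_ge: "2 * \<tau> \<le> x"
    proof -
      have "2 * \<tau> * \<tau> \<le> real M * real M" using False M by (intro mult_mono) auto
      then have "2 * \<tau> * \<tau> \<le> real M ^ k" using Mk by linarith
      then show ?thesis using False by (simp add: x_def field_simps)
    qed
    have "1 / real_of_int q \<le> 1 / \<tau>" using q x_ge False by (intro divide_left_mono) auto
    moreover have "1 / real M \<le> 1 / \<tau>" using M False by (intro divide_left_mono) auto
    moreover have "real_of_int q / real M ^ k \<le> x / real M ^ k" using q by (intro divide_right_mono) auto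
    moreover have "x / real M ^ k = 1 / \<tau>" using M by (simp add: x_def)
    moreover have "3 / \<tau> \<le> 8 / (1 + \<tau>)" using False by (simp add: field_simps)
    ultimately show "1 / real_of_int q + 1 / real M + real_of_int q / real M ^ k \<le> 8 / (1 + \<tau>)"
      by linarith
    show "0 \<le> 1 / real_of_int q + 1 / real M + real_of_int q / real M ^ k"
      using q by simp
  qed (use weyl_bound_ge_1[OF C] \<tau> in auto)
  finally show ?thesis by (simp add: mult_ac)
qed

lemma oscillation_bound:
  assumes C: "weyl_bound k \<theta> C" and \<theta>: "0 < \<theta>" "\<theta> \<le> 1" and k: "k \<ge> 2"
    and M: "M \<ge> 1" "real M \<ge> 2 * \<bar>\<tau>\<bar>"
  shows "cmod (wsum k M (\<tau> / real M ^ k) \<xi>) \<le> 8 * C * (1 + \<bar>\<tau>\<bar>) powr (- \<theta>)"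
proof (cases "0 \<le> \<tau>")
  case True
  then show ?thesis using oscillation_bound_pos[OF C \<theta> k M(1), of \<tau> \<xi>] M by simp
next
  case False
  have "cmod (wsum k M (\<tau> / real M ^ k) \<xi>) = cmod (wsum k M (- \<tau> / real M ^ k) (- \<xi>))"
    using wsum_cnj[of k M "- \<tau> / real M ^ k" \<xi>] by simp
  then show ?thesis using oscillation_bound_pos[OF C \<theta> k M(1), of "- \<tau>" "- \<xi>"] M False by simp
qed

section \<open>Smooth sums near and away from frequency 0\<close>

lemma norm_1_minus_power_le:
  fixes z :: complex
  assumes "cmod z \<le> 1"
  shows "cmod (1 - z ^ n) \<le> real n * cmod (1 - z)"
  using norm_power_diff[of 1 z n] assms by simp

text \<open>Summation by parts: the phase has total variation at most \<open>2 * pi * \<bar>\<tau>\<bar>\<close>.\<close>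

lemma wsum_decay:
  assumes M: "M \<ge> 1"
  shows "cmod (wsum k M (\<tau> / real M ^ k) \<xi>) * (real M * cmod (1 - e \<xi>)) \<le> 2 + 2 * pi * \<bar>\<tau>\<bar>"
proof -
  define b where "b = (\<lambda>u::nat. e (\<tau> * (real u / real M) ^ k))"
  define z where "z = e \<xi>"
  have nz: "cmod (z ^ u) = 1" for u by (simp add: z_def e_power)
  have b1: "cmod (b u) = 1" for u by (simp add: b_def)
  have parts: "(1 - z) * (\<Sum>u<Suc m. b u * z ^ u) = b 0 + (\<Sum>u<m. (b (Suc u) - b u) * z ^ Suc u) - b m * z ^ Suc m" for m
  proof (induction m)
    case (Suc m)
    show ?case
      unfolding sum.lessThan_Suc[of _ "Suc m"] distrib_left Suc.IH
      by (simp add: algebra_simps)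
  qed (simp add: algebra_simps)
  obtain m where m: "M = Suc m" using M by (cases M) auto
  have diff: "cmod (b (Suc u) - b u) \<le> 2 * pi * \<bar>\<tau>\<bar> * ((real (Suc u) / real M) ^ k - (real u / real M) ^ k)" for u
  proof -
    have "(real u / real M) ^ k \<le> (real (Suc u) / real M) ^ k"
      by (intro power_mono divide_right_mono) auto
    then have "\<bar>\<tau> * (real (Suc u) / real M) ^ k - \<tau> * (real u / real M) ^ k\<bar>
        = \<bar>\<tau>\<bar> * ((real (Suc u) / real M) ^ k - (real u / real M) ^ k)"
      by (simp add: abs_mult flip: right_diff_distrib)
    then show ?thesis
      using norm_e_diff[of "\<tau> * (real (Suc u) / real M) ^ k" "\<tau> * (real u / real M) ^ k"]
      by (simp add: b_def mult_ac)
  qed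
  have "(\<Sum>u<m. (real (Suc u) / real M) ^ k - (real u / real M) ^ k) = (real m / real M) ^ k - (0 / real M) ^ k"
    by (subst sum_lessThan_telescope) simp
  also have "\<dots> \<le> 1"
  proof -
    have "(real m / real M) ^ k \<le> 1" using m by (intro power_le_one) auto
    moreover have "0 \<le> (0 / real M) ^ k" by simp
    ultimately show ?thesis by linarith
  qed
  finally have tele: "(\<Sum>u<m. (real (Suc u) / real M) ^ k - (real u / real M) ^ k) \<le> 1" .
  have "cmod (\<Sum>u<m. (b (Suc u) - b u) * z ^ Suc u)
      \<le> (\<Sum>u<m. 2 * pi * \<bar>\<tau>\<bar> * ((real (Suc u) / real M) ^ k - (real u / real M) ^ k))"
    by (intro sum_norm_le) (simp add: norm_mult nz diff del: power_Suc of_nat_Suc)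
  also have "\<dots> \<le> 2 * pi * \<bar>\<tau>\<bar> * 1"
    unfolding sum_distrib_left[symmetric] using tele by (intro mult_left_mono) auto
  finally have mid: "cmod (\<Sum>u<m. (b (Suc u) - b u) * z ^ Suc u) \<le> 2 * pi * \<bar>\<tau>\<bar>" by simp
  have "cmod ((1 - z) * (\<Sum>u<M. b u * z ^ u)) \<le> cmod (b 0) + cmod (\<Sum>u<m. (b (Suc u) - b u) * z ^ Suc u) + cmod (b m * z ^ Suc m)"
    unfolding m parts
    by (rule order_trans[OF norm_triangle_ineq4 add_right_mono[OF norm_triangle_ineq]])
  also have "\<dots> \<le> 2 + 2 * pi * \<bar>\<tau>\<bar>"
    using mid by (simp add: norm_mult nz b1 del: power_Suc)
  finally have *: "cmod (1 - z) * cmod (\<Sum>u<M. b u * z ^ u) \<le> 2 + 2 * pi * \<bar>\<tau>\<bar>"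
    by (simp add: norm_mult)
  have "wsum k M (\<tau> / real M ^ k) \<xi> = (\<Sum>u<M. b u * z ^ u) / of_nat M"
    by (simp add: wsum_def b_def z_def e_add e_power power_divide mult_ac)
  then show ?thesis using * M by (simp add: norm_divide z_def mult_ac)
qed

text \<open>Here \<open>cmod (1 - e \<xi>)\<close> plays the role of the distance from
  \<open>\<xi>\<close> to the nearest integer. Together with \<open>wsum_decay\<close> this controls
  both sides of \<open>real M * cmod (1 - e \<xi>) = 1\<close>.\<close>

lemma wsum_near_0:
  "cmod (wsum k M t \<xi> - wsum k M t 0) \<le> real M * cmod (1 - e \<xi>)"
proof (cases "M = 0")
  case False
  have "cmod (\<Sum>u<M. e (t * real u ^ k + \<xi> * real u) - e (t * real u ^ k)) \<le> (\<Sum>u<M. real M * cmod (1 - e \<xi>))"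
  proof (intro sum_norm_le)
    fix u assume "u \<in> {..<M}"
    have "e (t * real u ^ k + \<xi> * real u) - e (t * real u ^ k) = - e (t * real u ^ k) * (1 - e \<xi> ^ u)"
      by (simp add: e_add e_power algebra_simps)
    then have "cmod (e (t * real u ^ k + \<xi> * real u) - e (t * real u ^ k)) = cmod (1 - e \<xi> ^ u)"
      by (simp add: norm_mult)
    also have "\<dots> \<le> real u * cmod (1 - e \<xi>)" by (intro norm_1_minus_power_le) simp
    also have "\<dots> \<le> real M * cmod (1 - e \<xi>)" using \<open>u \<in> _\<close> by (intro mult_right_mono) auto
    finally show "cmod (e (t * real u ^ k + \<xi> * real u) - e (t * real u ^ k)) \<le> real M * cmod (1 - e \<xi>)" .
  qed
  also have "\<dots> = real M * (real M * cmod (1 - e \<xi>))" by simp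
  finally have "cmod ((\<Sum>u<M. e (t * real u ^ k + \<xi> * real u)) - (\<Sum>u<M. e (t * real u ^ k)))
      \<le> real M * (real M * cmod (1 - e \<xi>))"
    by (simp add: sum_subtractf)
  then show ?thesis
    using False by (simp add: wsum_def norm_divide divide_le_eq mult_ac flip: diff_divide_distrib)
qed (simp add: wsum_def)

text \<open>What is left of the smooth multiplier after a multiple of the plain average is subtracted. It
  is small both near 0 and away from 0, hence square-summable over the dyadic values of \<open>M\<close>.\<close>

definition osc :: "nat \<Rightarrow> nat \<Rightarrow> real \<Rightarrow> real \<Rightarrow> complex" where
  "osc k M \<tau> \<xi> = wsum k M (\<tau> / real M ^ k) \<xi> - wsum k M (\<tau> / real M ^ k) 0 * wsum k M 0 \<xi>"

text \<open>One factor of the square is bounded by the size \<open>2 * A\<close>, the other by the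
  decay in \<open>y\<close>. Using the decay for both would bring a second factor
  \<open>1 + \<bar>\<tau>\<bar>\<close> and no power of \<open>A\<close>.\<close>

lemma osc_bound:
  assumes M: "M \<ge> 1" and A: "\<And>\<xi>. cmod (wsum k M (\<tau> / real M ^ k) \<xi>) \<le> A"
  shows "(cmod (osc k M \<tau> \<xi>))\<^sup>2 \<le> 2 * A * ((4 + 2 * pi * \<bar>\<tau>\<bar>) *
    min (real M * cmod (1 - e \<xi>)) (1 / (real M * cmod (1 - e \<xi>))))"
proof -
  define y where "y = real M * cmod (1 - e \<xi>)"
  let ?\<phi> = "wsum k M (\<tau> / real M ^ k)" and ?D = "wsum k M 0"
  define B where "B = 4 + 2 * pi * \<bar>\<tau>\<bar>"
  have B: "B \<ge> 4" by (simp add: B_def)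
  have y0: "0 \<le> y" by (simp add: y_def)
  have A0: "0 \<le> A" using A[of 0] norm_ge_zero order_trans by blast
  have D1: "cmod (?D \<xi>) \<le> 1" by (rule norm_wsum_le_1)
  have D0: "?D 0 = 1" using M by (simp add: wsum_def)
  have pD: "cmod (?\<phi> 0 * ?D \<xi>) \<le> A * 1"
    unfolding norm_mult using A D1 A0 by (intro mult_mono) auto
  have 1: "cmod (osc k M \<tau> \<xi>) \<le> 2 * A"
    using norm_triangle_ineq4[of "?\<phi> \<xi>" "?\<phi> 0 * ?D \<xi>"] A[of \<xi>] pD by (simp add: osc_def)
  have 2: "cmod (osc k M \<tau> \<xi>) \<le> B * y"
  proof -
    have "osc k M \<tau> \<xi> = (?\<phi> \<xi> - ?\<phi> 0) - ?\<phi> 0 * (?D \<xi> - ?D 0)"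
      by (simp add: osc_def D0 algebra_simps)
    then have "cmod (osc k M \<tau> \<xi>) \<le> cmod (?\<phi> \<xi> - ?\<phi> 0) + cmod (?\<phi> 0) * cmod (?D \<xi> - ?D 0)"
      by (metis norm_mult norm_triangle_ineq4)
    also have "\<dots> \<le> y + 1 * y"
      unfolding y_def by (intro add_mono mult_mono wsum_near_0 norm_wsum_le_1) auto
    also have "\<dots> \<le> B * y" using B y0 mult_right_mono[of 2 B y] by simp
    finally show ?thesis .
  qed
  have 3: "cmod (osc k M \<tau> \<xi>) * y \<le> B"
  proof -
    have "cmod (osc k M \<tau> \<xi>) * y \<le> (cmod (?\<phi> \<xi>) + cmod (?\<phi> 0 * ?D \<xi>)) * y"
      unfolding osc_def using y0 by (intro mult_right_mono norm_triangle_ineq4)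
    also have "\<dots> = cmod (?\<phi> \<xi>) * y + cmod (?\<phi> 0) * (cmod (?D \<xi>) * y)"
      by (simp add: norm_mult algebra_simps)
    also have "\<dots> \<le> (2 + 2 * pi * \<bar>\<tau>\<bar>) + 1 * 2"
      using wsum_decay[OF M, of k \<tau> \<xi>] wsum_decay[OF M, of k 0 \<xi>] y0
      by (intro add_mono mult_mono norm_wsum_le_1) (auto simp: y_def)
    finally show ?thesis by (simp add: B_def)
  qed
  have "cmod (osc k M \<tau> \<xi>) \<le> B * min y (1 / y)"
  \<comment> \<open>At \<open>y = 0\<close> the quotient \<open>1 / y\<close> is 0, so the minimum
    is 0, and the bound by \<open>B * y\<close> covers it.\<close>
  proof (cases "y = 0")
    case True
    then show ?thesis using 2 by simp
  next
    case False
    then have "cmod (osc k M \<tau> \<xi>) \<le> B * (1 / y)" using 3 y0 by (simp add: field_simps)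
    then show ?thesis using 2 by (simp add: min_def)
  qed
  then have "cmod (osc k M \<tau> \<xi>) * cmod (osc k M \<tau> \<xi>) \<le> 2 * A * (B * min y (1 / y))"
    using 1 A0 by (intro mult_mono) auto
  then show ?thesis by (simp add: power2_eq_square B_def y_def)
qed

lemma sum_min_dyadic:
  fixes x :: real
  assumes "finite J" "x > 0"
  shows "(\<Sum>j\<in>J. min (x * 2 ^ j) (1 / (x * 2 ^ j))) \<le> 6"
proof -
  define \<Phi> where "\<Phi> = (\<lambda>j::nat. x * 2 ^ j / (1 + x * 2 ^ j))"
  \<comment> \<open>\<open>min y (1 / y)\<close> is at most six times the increment of \<open>y / (1 + y)\<close> under doubling of \<open>y\<close>\<close>
  have step: "min (x * 2 ^ j) (1 / (x * 2 ^ j)) \<le> 6 * (\<Phi> (Suc j) - \<Phi> j)" for j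
  proof -
    define y where "y = x * 2 ^ j"
    have y: "y > 0" using assms by (simp add: y_def)
    have "\<Phi> (Suc j) - \<Phi> j = 2 * y / (1 + 2 * y) - y / (1 + y)"
      by (simp add: \<Phi>_def y_def mult_ac)
    also have "\<dots> = y / ((1 + y) * (1 + 2 * y))"
      using y by (simp add: divide_simps) (simp add: algebra_simps)
    finally have eq: "\<Phi> (Suc j) - \<Phi> j = y / ((1 + y) * (1 + 2 * y))" .
    show ?thesis
    proof (cases "y \<le> 1")
      case True
      have "y * ((1 + y) * (1 + 2 * y)) \<le> y * (2 * 3)"
        using True y by (intro mult_left_mono mult_mono) auto
      then have "y \<le> 6 * (y / ((1 + y) * (1 + 2 * y)))"
        using y by (simp add: pos_le_divide_eq)
      then show ?thesis unfolding eq y_def[symmetric] by simp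
    next
      case False
      have "(1 + y) * (1 + 2 * y) \<le> (2 * y) * (3 * y)"
        using False y by (intro mult_mono) auto
      then have "1 / y \<le> 6 * (y / ((1 + y) * (1 + 2 * y)))"
        using y by (simp add: pos_le_divide_eq pos_divide_le_eq)
      then show ?thesis unfolding eq y_def[symmetric] by simp
    qed
  qed
  obtain n where n: "J \<subseteq> {..<n}" using assms(1) finite_nat_iff_bounded by auto
  have "(\<Sum>j\<in>J. min (x * 2 ^ j) (1 / (x * 2 ^ j))) \<le> (\<Sum>j<n. min (x * 2 ^ j) (1 / (x * 2 ^ j)))"
    using n assms by (intro sum_mono2) auto
  also have "\<dots> \<le> (\<Sum>j<n. 6 * (\<Phi> (Suc j) - \<Phi> j))" by (intro sum_mono step)
  also have "\<dots> = 6 * (\<Phi> n - \<Phi> 0)"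
    unfolding sum_distrib_left[symmetric] by (subst sum_lessThan_telescope) simp
  also have "\<dots> \<le> 6 * (1 - 0)"
    using assms(2) by (intro mult_left_mono diff_mono) (auto simp: \<Phi>_def divide_le_eq add_pos_pos)
  finally show ?thesis by simp
qed

lemma div_bounds:
  assumes "q \<ge> 1" "q \<le> N"
  shows "N div q \<ge> 1" "real (N div q) \<le> real N / real q" "real N / real q \<le> 2 * real (N div q)"
proof -
  show 1: "N div q \<ge> 1" using assms by (simp add: Suc_le_eq div_greater_zero_iff)
  have "(N div q) * q \<le> N" by simp
  then have "real ((N div q) * q) \<le> real N" by (simp only: of_nat_le_iff)
  then show "real (N div q) \<le> real N / real q" using assms by (simp add: field_simps)
  have "N < (N div q + 1) * q" using assms dividend_less_div_times[of q N] by simp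
  also have "\<dots> \<le> (2 * (N div q)) * q" using 1 by (intro mult_right_mono) auto
  finally have "real N \<le> real ((2 * (N div q)) * q)" by (simp only: of_nat_le_iff less_imp_le)
  then show "real N / real q \<le> 2 * real (N div q)" using assms by (simp add: field_simps)
qed

text \<open>The lengths \<open>2 ^ j div q\<close> are not dyadic, but they agree with
  \<open>2 ^ j / q\<close> up to a factor 2, which changes the minimum by at most that factor; thus
  \<open>24 = 2 * 2 * 6\<close>.\<close>

lemma osc_square_sum:
  assumes "finite J" "q \<ge> 1" "\<And>j. j \<in> J \<Longrightarrow> q \<le> 2 ^ j"
    and A: "\<And>j \<xi>. j \<in> J \<Longrightarrow> cmod (wsum k (2 ^ j div q) (\<tau> / real (2 ^ j div q) ^ k) \<xi>) \<le> A" and A0: "0 \<le> A"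
  shows "(\<Sum>j\<in>J. (cmod (osc k (2 ^ j div q) \<tau> \<xi>))\<^sup>2) \<le> 24 * A * (4 + 2 * pi * \<bar>\<tau>\<bar>)"
proof (cases "cmod (1 - e \<xi>) = 0")
  case True
  have "osc k (2 ^ j div q) \<tau> \<xi> = 0" if "j \<in> J" for j
    using osc_bound[of "2 ^ j div q" k \<tau> A \<xi>] A that div_bounds(1)[OF assms(2) assms(3)[OF that]] True
    by simp
  then show ?thesis using A0 by (simp add: add_nonneg_nonneg)
next
  case False
  define \<delta> where "\<delta> = cmod (1 - e \<xi>)"
  define x where "x = \<delta> / real q"
  have pos: "\<delta> > 0" "x > 0" using False assms(2) by (auto simp: \<delta>_def x_def)
  define B where "B = 4 + 2 * pi * \<bar>\<tau>\<bar>"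
  have B: "B \<ge> 0" by (simp add: B_def add_nonneg_nonneg)
  have "(\<Sum>j\<in>J. (cmod (osc k (2 ^ j div q) \<tau> \<xi>))\<^sup>2) \<le> (\<Sum>j\<in>J. 2 * A * (B * (2 * min (x * 2 ^ j) (1 / (x * 2 ^ j)))))"
  proof (rule sum_mono)
    fix j assume j: "j \<in> J"
    define M where "M = (2::nat) ^ j div q"
    note d = div_bounds[OF assms(2) assms(3)[OF j], folded M_def]
    have xM: "real M * \<delta> \<le> x * 2 ^ j" "x * 2 ^ j \<le> 2 * (real M * \<delta>)"
      using mult_right_mono[OF d(2), of \<delta>] mult_right_mono[OF d(3), of \<delta>] pos by (auto simp: x_def mult_ac)
    have "1 / (real M * \<delta>) \<le> 2 * (1 / (x * 2 ^ j))"
      using xM pos d(1) by (simp add: divide_simps)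
    then have "min (real M * \<delta>) (1 / (real M * \<delta>)) \<le> 2 * min (x * 2 ^ j) (1 / (x * 2 ^ j))"
      using xM(1) mult_pos_pos[OF pos(2), of "2 ^ j"] by (auto simp: min_def)
    then have "2 * A * (B * min (real M * \<delta>) (1 / (real M * \<delta>))) \<le> 2 * A * (B * (2 * min (x * 2 ^ j) (1 / (x * 2 ^ j))))"
      using A0 B by (intro mult_left_mono) auto
    then show "(cmod (osc k (2 ^ j div q) \<tau> \<xi>))\<^sup>2 \<le> 2 * A * (B * (2 * min (x * 2 ^ j) (1 / (x * 2 ^ j))))"
      using osc_bound[OF d(1) A[OF j, folded M_def], of \<xi>] unfolding M_def[symmetric] \<delta>_def[symmetric] B_def[symmetric]
      by linarith
  qed
  also have "\<dots> = 4 * A * B * (\<Sum>j\<in>J. min (x * 2 ^ j) (1 / (x * 2 ^ j)))"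
    by (simp add: sum_distrib_left mult_ac)
  also have "\<dots> \<le> 4 * A * B * 6"
    using A0 B by (intro mult_left_mono sum_min_dyadic assms(1) pos) auto
  finally show ?thesis by (simp add: B_def)
qed

lemma sum_arith_blocks:
  fixes F :: "nat \<Rightarrow> 'a::comm_monoid_add"
  shows "(\<Sum>n<M * q. F n) = (\<Sum>u<M. \<Sum>l<q. F (u * q + l))"
proof -
  have "(\<Sum>n<M * q. F n) = (\<Sum>u<M. sum F {u * q..<u * q + q})"
    by (rule sum.nat_group[symmetric])
  also have "\<dots> = (\<Sum>u<M. \<Sum>l<q. F (u * q + l))"
  proof (rule sum.cong[OF refl])
    fix u show "sum F {u * q..<u * q + q} = (\<Sum>l<q. F (u * q + l))"
      using sum.shift_bounds_nat_ivl[of F 0 "u * q" q] by (simp add: atLeast0LessThan add.commute)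
  qed
  finally show ?thesis .
qed

text \<open>Near a rational with denominator \<open>q\<close>, a Weyl sum factors into a complete Gauss sum and a
  smooth sum over the multiples of \<open>q\<close>.\<close>

lemma wsum_factor:
  assumes q: "q \<ge> 1" "q \<le> N"
  defines "M \<equiv> N div q"
  shows "cmod (wsum k N (of_int a / real q + \<tau> / real N ^ k) \<xi>
      - of_real (real q * real M / real N) * wsum k M (\<tau> / real M ^ k) (real q * \<xi>) * wsum k q (of_int a / real q) \<xi>)
    \<le> (1 + 2 * pi * real k * \<bar>\<tau>\<bar>) * real q / real N"
proof -
  define F where "F = (\<lambda>n::nat. e ((of_int a / real q + \<tau> / real N ^ k) * real n ^ k + \<xi> * real n))"
  define H where "H = (\<lambda>u l::nat. e (\<tau> / real M ^ k * real u ^ k + real q * \<xi> * real u) * e (of_int a / real q * real l ^ k + \<xi> * real l))"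
  note d = div_bounds[OF q, folded M_def]
  have N1: "N \<ge> 1" using q by simp
  have Mq: "M * q \<le> N" by (simp add: M_def)
  have NMq: "N - M * q \<le> q" using q by (simp add: M_def minus_div_mult_eq_mod less_imp_le)
  \<comment> \<open>The arithmetic phase depends only on the residue of \<open>n\<close> modulo
    \<open>q\<close>.\<close>
  have per: "e (of_int a / real q * real (u * q + l) ^ k) = e (of_int a / real q * real l ^ k)" for u l
  proof -
    have "(int u * int q + int l) ^ k mod int q = int l ^ k mod int q"
      by (metis power_mod mod_mult_self3)
    then have "int q dvd int ((u * q + l) ^ k) - int (l ^ k)"
      by (simp add: mod_eq_dvd_iff)
    then obtain c where "int ((u * q + l) ^ k) - int (l ^ k) = int q * c" by (elim dvdE)
    then have "real_of_int (int ((u * q + l) ^ k) - int (l ^ k)) = real_of_int (int q * c)" by simp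
    then have c: "real (u * q + l) ^ k = real l ^ k + real q * of_int c" by simp
    have "of_int a / real q * real (u * q + l) ^ k = of_int a / real q * real l ^ k + of_int (a * c)"
      unfolding c using q by (simp add: field_simps)
    then show ?thesis by (simp only: e_add e_of_int mult_1_right)
  qed
  have step: "cmod (F (u * q + l) - H u l) \<le> 2 * pi * (\<bar>\<tau>\<bar> * (real k * (real q / real N)))"
    if u: "u < M" and l: "l < q" for u l
  proof -
    \<comment> \<open>The relative positions of \<open>n = u * q + l\<close> below \<open>N\<close>
      and of \<open>u\<close> below \<open>M\<close> differ by at most \<open>q / N\<close>, and the
      \<open>k\<close>-th power has Lipschitz constant \<open>k\<close> on the unit
      interval.\<close>
    define x where "x = real (u * q + l) / real N"
    define y where "y = real u / real M"
    have "u * q + l \<le> N"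
    proof -
      have "u * q + l < (u + 1) * q" using l by simp
      also have "\<dots> \<le> M * q" using u by (intro mult_right_mono) auto
      finally show ?thesis using Mq by simp
    qed
    then have "real (u * q + l) \<le> real N" by (simp only: of_nat_le_iff)
    then have x1: "0 \<le> x" "x \<le> 1" using N1 by (auto simp: x_def divide_le_eq)
    have y1: "0 \<le> y" "y \<le> 1" using u d by (auto simp: y_def divide_le_eq)
    have MqR: "real M * real q \<le> real N" using Mq by (metis of_nat_le_iff of_nat_mult)
    have NMqR: "real N - real M * real q \<le> real q"
      using NMq Mq by (metis of_nat_diff of_nat_le_iff of_nat_mult)
    have "x - y \<le> real q / real N"
    proof -
      have "real u * real q / real N \<le> y"
      proof -
        have "real u * (real M * real q) \<le> real u * real N" using MqR by (intro mult_left_mono) auto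
        then show ?thesis using d(1) N1 by (simp add: y_def divide_simps mult_ac)
      qed
      moreover have "real l / real N \<le> real q / real N" using l by (intro divide_right_mono) auto
      moreover have "x = real u * real q / real N + real l / real N" by (simp add: x_def add_divide_distrib)
      ultimately show ?thesis by linarith
    qed
    moreover have "y - x \<le> real q / real N"
    proof -
      have "y * real N - real u * real q = y * (real N - real M * real q)"
        using d by (simp add: y_def algebra_simps)
      also have "\<dots> \<le> 1 * real q" using y1 NMqR by (intro mult_mono) (use MqR in auto)
      finally have "y * real N \<le> real q + real (u * q + l)" by simp
      then have "y \<le> (real q + real (u * q + l)) / real N" using N1 by (simp add: le_divide_eq)
      then show ?thesis by (simp add: x_def add_divide_distrib)
    qed
    ultimately have xy: "\<bar>x - y\<bar> \<le> real q / real N" by linarith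
    have "F (u * q + l) = e (of_int a / real q * real (u * q + l) ^ k) * e (\<tau> * x ^ k) * e (\<xi> * real (u * q + l))"
      by (simp add: F_def x_def power_divide ring_distribs flip: e_add)
    also have "\<dots> = e (of_int a / real q * real l ^ k + \<xi> * real (u * q + l)) * e (\<tau> * x ^ k)"
      unfolding per by (simp add: e_add)
    finally have F: "F (u * q + l) = e (of_int a / real q * real l ^ k + \<xi> * real (u * q + l)) * e (\<tau> * x ^ k)" .
    have H: "H u l = e (of_int a / real q * real l ^ k + \<xi> * real (u * q + l)) * e (\<tau> * y ^ k)"
      by (simp add: H_def y_def power_divide ring_distribs add_ac mult_ac flip: e_add)
    have "cmod (F (u * q + l) - H u l) = cmod (e (\<tau> * x ^ k) - e (\<tau> * y ^ k))"
      unfolding F H by (simp add: norm_mult flip: right_diff_distrib)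
    also have "\<dots> \<le> 2 * pi * \<bar>\<tau> * x ^ k - \<tau> * y ^ k\<bar>" by (rule norm_e_diff)
    also have "\<bar>\<tau> * x ^ k - \<tau> * y ^ k\<bar> = \<bar>\<tau>\<bar> * \<bar>x ^ k - y ^ k\<bar>"
      by (simp add: abs_mult flip: right_diff_distrib)
    also have "\<bar>x ^ k - y ^ k\<bar> \<le> real k * \<bar>x - y\<bar>"
      using norm_power_diff[of x y k] x1 y1 by simp
    also have "\<dots> \<le> real k * (real q / real N)" using xy by (intro mult_left_mono) auto
    finally show ?thesis by (simp add: mult_left_mono)
  qed
  have norm_F: "cmod (F n) = 1" for n by (simp add: F_def)
  \<comment> \<open>Fewer than \<open>q\<close> terms remain after the complete blocks; they are
    estimated trivially.\<close>
  have "(\<Sum>n<N. F n) - (\<Sum>u<M. \<Sum>l<q. H u l) = (\<Sum>u<M. \<Sum>l<q. F (u * q + l) - H u l) + (\<Sum>n\<in>{M * q..<N}. F n)"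
  proof -
    have "(\<Sum>n<N. F n) = (\<Sum>n<M * q. F n) + (\<Sum>n\<in>{M * q..<N}. F n)"
      using sum.atLeastLessThan_concat[of 0 "M * q" N F] Mq by (simp add: atLeast0LessThan)
    then show ?thesis by (simp add: sum_arith_blocks sum_subtractf)
  qed
  then have "cmod ((\<Sum>n<N. F n) - (\<Sum>u<M. \<Sum>l<q. H u l))
      \<le> cmod (\<Sum>u<M. \<Sum>l<q. F (u * q + l) - H u l) + cmod (\<Sum>n\<in>{M * q..<N}. F n)"
    by (simp only: norm_triangle_ineq)
  also have "\<dots> \<le> (\<Sum>u<M. \<Sum>l<q. 2 * pi * (\<bar>\<tau>\<bar> * (real k * (real q / real N)))) + (\<Sum>n\<in>{M * q..<N}. 1)"
    by (intro add_mono sum_norm_le step) (auto simp: norm_F)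
  also have "\<dots> = real (M * q) * (2 * pi * (\<bar>\<tau>\<bar> * (real k * (real q / real N)))) + real (N - M * q)"
    by simp
  also have "\<dots> \<le> real N * (2 * pi * (\<bar>\<tau>\<bar> * (real k * (real q / real N)))) + real q"
    using Mq NMq by (intro add_mono mult_right_mono) (auto simp only: of_nat_le_iff, auto)
  also have "\<dots> = (1 + 2 * pi * real k * \<bar>\<tau>\<bar>) * real q"
    using N1 by (simp add: field_simps)
  finally have main: "cmod ((\<Sum>n<N. F n) - (\<Sum>u<M. \<Sum>l<q. H u l)) \<le> (1 + 2 * pi * real k * \<bar>\<tau>\<bar>) * real q" .
  have "(\<Sum>u<M. \<Sum>l<q. H u l)
      = (of_nat M * wsum k M (\<tau> / real M ^ k) (real q * \<xi>)) * (of_nat q * wsum k q (of_int a / real q) \<xi>)"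
    using q d(1) by (simp add: H_def wsum_def sum_product)
  then have "wsum k N (of_int a / real q + \<tau> / real N ^ k) \<xi>
      - of_real (real q * real M / real N) * wsum k M (\<tau> / real M ^ k) (real q * \<xi>) * wsum k q (of_int a / real q) \<xi>
      = ((\<Sum>n<N. F n) - (\<Sum>u<M. \<Sum>l<q. H u l)) / of_nat N"
    by (simp add: wsum_def[of k N] F_def diff_divide_distrib mult_ac)
  then show ?thesis using main N1 by (simp add: norm_divide divide_right_mono)
qed

section \<open>The operators attached to an arc\<close>

text \<open>With first parameter 1 after \<open>k\<close> this belongs to a point \<open>t\<close>
  of the circle; with \<open>t = 0\<close> it is the plain average over a cube in the multiples of
  \<open>q\<close>.\<close>

definition weyl_op ::
    "nat \<Rightarrow> nat \<Rightarrow> nat \<Rightarrow> real \<Rightarrow> (int ^ 'd::finite \<Rightarrow> complex) \<Rightarrow> int ^ 'd \<Rightarrow> complex" where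
  "weyl_op k q N t = bconv q N (\<lambda>n. e (t * real n ^ k))"

lemma mult_op_weyl_op:
  "mult_op (weyl_op k q N t) (\<lambda>\<xi>. \<Prod>i\<in>UNIV. wsum k N t (real q * \<xi> i))"
proof -
  have "wsum k N t x = (\<Sum>n<N. e (t * real n ^ k) * e (real n * x)) / of_nat N" for x
    by (simp add: wsum_def e_add mult_ac)
  then show ?thesis using mult_op_bconv[of q N "\<lambda>n. e (t * real n ^ k)"]
    by (simp add: weyl_op_def)
qed

lemma l2_weyl_op:
  fixes f :: "int ^ 'd::finite \<Rightarrow> complex"
  assumes "\<And>\<xi>. cmod (wsum k N t \<xi>) \<le> A" "finsupp f"
  shows "l2 (weyl_op k q N t f) \<le> A ^ (2 * CARD('d)) * l2 f"
proof -
  have "l2 (weyl_op k q N t f) \<le> (A ^ CARD('d))\<^sup>2 * l2 f"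
  proof (rule l2_mult_op[OF mult_op_weyl_op _ assms(2)])
    fix \<xi> :: "'d \<Rightarrow> real"
    have "cmod (\<Prod>i\<in>UNIV. wsum k N t (real q * \<xi> i)) \<le> (\<Prod>i\<in>(UNIV::'d set). A)"
      unfolding prod_norm[symmetric] by (intro prod_mono) (use assms in auto)
    then show "cmod (\<Prod>i\<in>UNIV. wsum k N t (real q * \<xi> i)) \<le> A ^ CARD('d)" by simp
  qed
  then show ?thesis by (simp add: power_mult[symmetric] mult.commute)
qed

lemma sum_squared_le_card:
  fixes g :: "'a \<Rightarrow> real"
  shows "(\<Sum>i\<in>I. g i)\<^sup>2 \<le> real (card I) * (\<Sum>i\<in>I. (g i)\<^sup>2)"
  using Cauchy_Schwarz_ineq_sum[of "\<lambda>_. 1" g I] by simp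

lemma norm_weyl_op_le_bavg: "cmod (weyl_op k q N t f x) \<le> bavg q N (\<lambda>y. cmod (f y)) x"
proof -
  have "cmod (\<Sum>v\<in>nbox N. (\<Prod>i\<in>UNIV. e (t * real (v i) ^ k)) * f (x - emb q v)) \<le> (\<Sum>v\<in>nbox N. cmod (f (x - emb q v)))"
    by (intro sum_norm_le) (simp add: norm_mult flip: prod_norm)
  then show ?thesis
    by (simp add: weyl_op_def bconv_def bavg_def norm_divide norm_power divide_right_mono)
qed

text \<open>Jensen's inequality. It reduces a maximal function in l2 to cube averages of a squared
  modulus, to which the covering lemma applies.\<close>

lemma norm_weyl_op_square_le_bavg:
  fixes f :: "int ^ 'd::finite \<Rightarrow> complex"
  shows "(cmod (weyl_op k q N t f x))\<^sup>2 \<le> bavg q N (\<lambda>y. (cmod (f y))\<^sup>2) x"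
proof (cases "N = 0")
  case False
  let ?n = "real (N ^ CARD('d))"
  have n: "?n > 0" using False by simp
  have "(cmod (weyl_op k q N t f x))\<^sup>2 \<le> (bavg q N (\<lambda>y. cmod (f y)) x)\<^sup>2"
    by (intro power_mono norm_weyl_op_le_bavg) auto
  also have "\<dots> = (\<Sum>v\<in>nbox N. cmod (f (x - emb q v)))\<^sup>2 / ?n\<^sup>2"
    by (simp add: bavg_def power_divide)
  also have "\<dots> \<le> (?n * (\<Sum>v\<in>nbox N. (cmod (f (x - emb q v)))\<^sup>2)) / ?n\<^sup>2"
    using sum_squared_le_card[of "\<lambda>v. cmod (f (x - emb q v))" "nbox N :: ('d \<Rightarrow> nat) set"]
    by (intro divide_right_mono) auto
  also have "\<dots> = bavg q N (\<lambda>y. (cmod (f y))\<^sup>2) x"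
    using n by (simp add: bavg_def power2_eq_square)
  finally show ?thesis .
qed (simp add: weyl_op_def bconv_def bavg_def zero_power)

lemma power2_add_le:
  fixes a b :: real
  shows "(a + b)\<^sup>2 \<le> 2 * a\<^sup>2 + 2 * b\<^sup>2"
  using sum_squares_bound[of a b] by (simp add: power2_sum)

text \<open>Dividing all factors by \<open>A\<close> reduces this to factors in the unit disc;
  scaling back retains \<open>d - 1\<close> factors \<open>A\<close>.\<close>

lemma norm_prod_diff_scaled:
  fixes z w :: "'i::finite \<Rightarrow> complex"
  assumes A: "A > 0" and z: "\<And>i. cmod (z i) \<le> A" and w: "\<And>i. cmod (w i) \<le> A"
  shows "cmod ((\<Prod>i\<in>UNIV. z i) - (\<Prod>i\<in>UNIV. w i)) \<le> A ^ (CARD('i) - 1) * (\<Sum>i\<in>UNIV. cmod (z i - w i))"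
proof -
  have n: "cmod (u / of_real A) = cmod u / A" for u using A by (simp add: norm_divide)
  have "cmod ((\<Prod>i\<in>UNIV. z i / of_real A) - (\<Prod>i\<in>UNIV. w i / of_real A))
      \<le> (\<Sum>i\<in>UNIV. cmod (z i / of_real A - w i / of_real A))"
    using A z w by (intro norm_prod_diff) (auto simp: n divide_le_eq)
  then have "cmod ((\<Prod>i\<in>UNIV. z i) - (\<Prod>i\<in>UNIV. w i)) / A ^ CARD('i) \<le> (\<Sum>i\<in>UNIV. cmod (z i - w i)) / A"
    using A by (simp add: prod_dividef norm_divide norm_power sum_divide_distrib flip: diff_divide_distrib)
  moreover have "A ^ CARD('i) = A ^ (CARD('i) - 1) * A"
    by (metis One_nat_def Suc_pred mult.commute power_Suc zero_less_card_finite)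
  ultimately show ?thesis using A by (simp add: field_simps)
qed

definition gauss_op ::
    "nat \<Rightarrow> nat \<Rightarrow> int \<Rightarrow> (int ^ 'd::finite \<Rightarrow> complex) \<Rightarrow> int ^ 'd \<Rightarrow> complex" where
  "gauss_op k q a = weyl_op k 1 q (of_int a / real q)"

text \<open>The smooth multiplier is replaced by its value at frequency 0 times that of the plain
  average. The scale then enters only through a bounded scalar and the side of a cube, while the
  Gauss sum operator is fixed.\<close>

definition main_op ::
    "nat \<Rightarrow> nat \<Rightarrow> int \<Rightarrow> real \<Rightarrow> nat \<Rightarrow> (int ^ 'd::finite \<Rightarrow> complex) \<Rightarrow> int ^ 'd \<Rightarrow> complex" where
  "main_op k q a \<tau> N f x =
     (of_real (real q * real (N div q) / real N) * wsum k (N div q) (\<tau> / real (N div q) ^ k) 0) ^ CARD('d)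
       * weyl_op k q (N div q) 0 (gauss_op k q a f) x"

definition error_op ::
    "nat \<Rightarrow> nat \<Rightarrow> int \<Rightarrow> real \<Rightarrow> nat \<Rightarrow> (int ^ 'd::finite \<Rightarrow> complex) \<Rightarrow> int ^ 'd \<Rightarrow> complex" where
  "error_op k q a \<tau> N f x = weyl_op k 1 N (of_int a / real q + \<tau> / real N ^ k) f x - main_op k q a \<tau> N f x"

lemma main_op_bound:
  fixes f :: "int ^ 'd::finite \<Rightarrow> complex"
  assumes "q \<ge> 1" "q \<le> N" and A: "cmod (wsum k (N div q) (\<tau> / real (N div q) ^ k) 0) \<le> A"
  shows "(cmod (main_op k q a \<tau> N f x))\<^sup>2
    \<le> A ^ (2 * CARD('d)) * bavg q (N div q) (\<lambda>y. (cmod (gauss_op k q a f y))\<^sup>2) x"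
proof -
  have A0: "0 \<le> A" using A norm_ge_zero order_trans by blast
  have \<rho>: "real q * real (N div q) / real N \<le> 1"
    using div_bounds(2)[OF assms(1,2)] assms(1,2) by (simp add: field_simps)
  have "(cmod (main_op k q a \<tau> N f x))\<^sup>2
      = (cmod (of_real (real q * real (N div q) / real N) * wsum k (N div q) (\<tau> / real (N div q) ^ k) 0)) ^ (2 * CARD('d))
        * (cmod (weyl_op k q (N div q) 0 (gauss_op k q a f) x))\<^sup>2"
    by (simp add: main_op_def norm_mult norm_power power_mult_distrib mult.commute[of 2] flip: power_mult)
  also have "\<dots> \<le> A ^ (2 * CARD('d)) * bavg q (N div q) (\<lambda>y. (cmod (gauss_op k q a f y))\<^sup>2) x"
  proof (intro mult_mono power_mono norm_weyl_op_square_le_bavg)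
    have "cmod (of_real (real q * real (N div q) / real N) * wsum k (N div q) (\<tau> / real (N div q) ^ k) 0)
        = (real q * real (N div q) / real N) * cmod (wsum k (N div q) (\<tau> / real (N div q) ^ k) 0)"
      by (simp add: norm_mult norm_divide)
    also have "\<dots> \<le> 1 * A" using \<rho> A A0 by (intro mult_mono) auto
    finally show "cmod (of_real (real q * real (N div q) / real N) * wsum k (N div q) (\<tau> / real (N div q) ^ k) 0) \<le> A" by simp
  qed (use A0 in auto)
  finally show ?thesis .
qed

lemma finsupp_gauss_op: "finsupp f \<Longrightarrow> finsupp (gauss_op k q a f)"
  unfolding gauss_op_def by (rule mult_op_finsupp[OF mult_op_weyl_op])

definition error_mult :: "nat \<Rightarrow> nat \<Rightarrow> int \<Rightarrow> real \<Rightarrow> nat \<Rightarrow> ('d::finite \<Rightarrow> real) \<Rightarrow> complex" where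
  "error_mult k q a \<tau> N \<xi> = (\<Prod>i\<in>UNIV. wsum k N (of_int a / real q + \<tau> / real N ^ k) (\<xi> i))
    - (of_real (real q * real (N div q) / real N) * wsum k (N div q) (\<tau> / real (N div q) ^ k) 0) ^ CARD('d)
      * ((\<Prod>i\<in>UNIV. wsum k (N div q) 0 (real q * \<xi> i)) * (\<Prod>i\<in>UNIV. wsum k q (of_int a / real q) (\<xi> i)))"

lemma mult_op_error_op: "mult_op (error_op k q a \<tau> N) (error_mult k q a \<tau> N)"
proof -
  have 1: "mult_op (weyl_op k 1 N t) (\<lambda>\<xi>. \<Prod>i\<in>UNIV. wsum k N t (\<xi> i))" for N t
    using mult_op_weyl_op[of k 1 N t] by simp
  show ?thesis
    unfolding error_op_def main_op_def gauss_op_def error_mult_def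
    by (intro mult_op_diff mult_op_scale 1 mult_op_compose[OF mult_op_weyl_op])
qed

text \<open>Two replacements are made: each Weyl sum by its factorisation (\<open>E1\<close>), then
  each smooth factor by its value at 0 times the plain average (\<open>E2\<close>). The second keeps
  \<open>B ^ d\<close> from the Gauss sums and \<open>A ^ (d - 1)\<close> from the untouched smooth
  factors.\<close>

lemma error_multiplier_bound:
  fixes \<xi> :: "'d::finite \<Rightarrow> real"
  assumes q: "q \<ge> 1" "q \<le> N" and A: "\<And>x. cmod (wsum k (N div q) (\<tau> / real (N div q) ^ k) x) \<le> A" "A > 0"
    and B: "\<And>x. cmod (wsum k q (of_int a / real q) x) \<le> B"
  shows "(cmod (error_mult k q a \<tau> N \<xi>))\<^sup>2
    \<le> 2 * (real CARD('d))\<^sup>2 * ((1 + 2 * pi * real k * \<bar>\<tau>\<bar>) * real q / real N)\<^sup>2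
      + 2 * B ^ (2 * CARD('d)) * A ^ (2 * (CARD('d) - 1)) * real CARD('d)
        * (\<Sum>i\<in>UNIV. (cmod (osc k (N div q) \<tau> (real q * \<xi> i)))\<^sup>2)"
proof -
  define M where "M = N div q"
  define \<rho> where "\<rho> = real q * real M / real N"
  define \<epsilon> where "\<epsilon> = (1 + 2 * pi * real k * \<bar>\<tau>\<bar>) * real q / real N"
  define \<kappa> where "\<kappa> = (\<lambda>i. wsum k N (of_int a / real q + \<tau> / real N ^ k) (\<xi> i))"
  define \<phi> where "\<phi> = wsum k M (\<tau> / real M ^ k)"
  define D where "D = wsum k M 0"
  define g where "g = (\<lambda>i. wsum k q (of_int a / real q) (\<xi> i))"
  have \<rho>: "0 \<le> \<rho>" "\<rho> \<le> 1"
    using div_bounds(2)[OF q] q by (auto simp: \<rho>_def M_def field_simps)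
  have A': "cmod (\<phi> x) \<le> A" for x using A(1) by (simp add: \<phi>_def M_def)
  have \<phi>1: "cmod (\<phi> x) \<le> 1" for x unfolding \<phi>_def by (rule norm_wsum_le_1)
  have \<kappa>1: "cmod (\<kappa> i) \<le> 1" for i unfolding \<kappa>_def by (rule norm_wsum_le_1)
  have g1: "cmod (g i) \<le> 1" for i unfolding g_def by (rule norm_wsum_le_1)
  have D1: "cmod (D x) \<le> 1" for x unfolding D_def by (rule norm_wsum_le_1)
  have B0: "0 \<le> B" using B[of 0] norm_ge_zero order_trans by blast
  define E1 where "E1 = (\<Prod>i\<in>UNIV. \<kappa> i) - (\<Prod>i\<in>UNIV. of_real \<rho> * \<phi> (real q * \<xi> i) * g i)"
  define E2 where "E2 = (\<Prod>i\<in>UNIV. \<phi> (real q * \<xi> i)) - (\<Prod>i\<in>UNIV. \<phi> 0 * D (real q * \<xi> i))"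
  have eq: "(\<Prod>i\<in>UNIV. \<kappa> i) - (of_real \<rho> * \<phi> 0) ^ CARD('d) * ((\<Prod>i\<in>UNIV. D (real q * \<xi> i)) * (\<Prod>i\<in>UNIV. g i))
      = E1 + of_real \<rho> ^ CARD('d) * (\<Prod>i\<in>UNIV. g i) * E2"
    by (simp add: E1_def E2_def prod.distrib power_mult_distrib algebra_simps)
  have "cmod E1 \<le> (\<Sum>i\<in>UNIV. cmod (\<kappa> i - of_real \<rho> * \<phi> (real q * \<xi> i) * g i))"
    unfolding E1_def
  proof (rule norm_prod_diff)
    fix i
    have "cmod (of_real \<rho> * \<phi> (real q * \<xi> i) * g i) \<le> 1 * 1 * 1"
      unfolding norm_mult using \<rho> \<phi>1 g1 by (intro mult_mono) auto
    then show "cmod (of_real \<rho> * \<phi> (real q * \<xi> i) * g i) \<le> 1" by simp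
  qed (rule \<kappa>1)
  also have "\<dots> \<le> (\<Sum>i\<in>(UNIV::'d set). \<epsilon>)"
    unfolding \<kappa>_def \<phi>_def g_def \<rho>_def \<epsilon>_def M_def by (intro sum_mono wsum_factor q)
  finally have E1: "cmod E1 \<le> real CARD('d) * \<epsilon>" by simp
  have E2: "cmod E2 \<le> A ^ (CARD('d) - 1) * (\<Sum>i\<in>UNIV. cmod (osc k M \<tau> (real q * \<xi> i)))"
  proof -
    have "cmod (\<phi> 0 * D x) \<le> A * 1" for x
      unfolding norm_mult using A' D1 A(2) by (intro mult_mono) auto
    then show ?thesis
      unfolding E2_def osc_def using norm_prod_diff_scaled[OF A(2), of "\<lambda>i. \<phi> (real q * \<xi> i)" "\<lambda>i. \<phi> 0 * D (real q * \<xi> i)"] A'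
      by (simp add: \<phi>_def D_def)
  qed
  have "cmod (\<Prod>i\<in>UNIV. g i) \<le> (\<Prod>i\<in>(UNIV::'d set). B)"
    unfolding prod_norm[symmetric] by (intro prod_mono) (use B in \<open>auto simp: g_def\<close>)
  then have gB: "cmod (\<Prod>i\<in>UNIV. g i) \<le> B ^ CARD('d)" by simp
  have "cmod (of_real \<rho> ^ CARD('d) * (\<Prod>i\<in>UNIV. g i) * E2) \<le> 1 * B ^ CARD('d) * cmod E2"
    unfolding norm_mult using \<rho> gB B0
    by (intro mult_right_mono mult_mono) (auto simp: norm_power power_le_one)
  then have "cmod (E1 + of_real \<rho> ^ CARD('d) * (\<Prod>i\<in>UNIV. g i) * E2)
      \<le> real CARD('d) * \<epsilon> + B ^ CARD('d) * (A ^ (CARD('d) - 1) * (\<Sum>i\<in>UNIV. cmod (osc k M \<tau> (real q * \<xi> i))))"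
    using norm_triangle_ineq[of E1 "of_real \<rho> ^ CARD('d) * (\<Prod>i\<in>UNIV. g i) * E2"] E1
      mult_left_mono[OF E2, of "B ^ CARD('d)"] B0 by simp
  then have "(cmod (E1 + of_real \<rho> ^ CARD('d) * (\<Prod>i\<in>UNIV. g i) * E2))\<^sup>2
      \<le> (real CARD('d) * \<epsilon> + B ^ CARD('d) * (A ^ (CARD('d) - 1) * (\<Sum>i\<in>UNIV. cmod (osc k M \<tau> (real q * \<xi> i)))))\<^sup>2"
    by (intro power_mono) auto
  also have "\<dots> \<le> 2 * (real CARD('d) * \<epsilon>)\<^sup>2
      + 2 * (B ^ CARD('d) * (A ^ (CARD('d) - 1) * (\<Sum>i\<in>UNIV. cmod (osc k M \<tau> (real q * \<xi> i)))))\<^sup>2"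
    by (rule power2_add_le)
  also have "\<dots> = 2 * (real CARD('d))\<^sup>2 * \<epsilon>\<^sup>2
      + 2 * B ^ (2 * CARD('d)) * A ^ (2 * (CARD('d) - 1)) * (\<Sum>i\<in>UNIV. cmod (osc k M \<tau> (real q * \<xi> i)))\<^sup>2"
    by (simp add: power_mult_distrib mult_ac flip: power_mult)
  also have "\<dots> \<le> 2 * (real CARD('d))\<^sup>2 * \<epsilon>\<^sup>2
      + 2 * B ^ (2 * CARD('d)) * A ^ (2 * (CARD('d) - 1)) * (real CARD('d) * (\<Sum>i\<in>UNIV. (cmod (osc k M \<tau> (real q * \<xi> i)))\<^sup>2))"
    using sum_squared_le_card[of "\<lambda>i. cmod (osc k M \<tau> (real q * \<xi> i))" "UNIV :: 'd set"] B0 A(2)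
    by (intro add_left_mono mult_left_mono) auto
  finally show ?thesis
    unfolding eq[symmetric] unfolding error_mult_def \<kappa>_def \<rho>_def \<phi>_def D_def g_def \<epsilon>_def M_def by (simp add: mult.assoc)
qed

lemma sum_quarter_powers:
  assumes "finite J" "\<And>j. j \<in> J \<Longrightarrow> j0 \<le> j"
  shows "(\<Sum>j\<in>J. (1 / 4) ^ j) \<le> 2 * (1 / 4 :: real) ^ j0"
proof -
  obtain n where n: "J \<subseteq> {..<n}" using assms(1) finite_nat_iff_bounded by auto
  have "J \<subseteq> {j0..<j0 + n}" using n assms(2) by fastforce
  then have "(\<Sum>j\<in>J. (1 / 4 :: real) ^ j) \<le> (\<Sum>j\<in>{j0..<j0 + n}. (1 / 4) ^ j)"
    by (intro sum_mono2) auto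
  also have "\<dots> = (\<Sum>j<n. (1 / 4) ^ (j + j0))"
    using sum.shift_bounds_nat_ivl[of "\<lambda>j. (1 / 4 :: real) ^ j" 0 j0 n] by (simp add: atLeast0LessThan add.commute)
  also have "\<dots> = (1 / 4) ^ j0 * (\<Sum>j<n. (1 / 4) ^ j)"
    by (simp add: power_add sum_distrib_left mult.commute)
  also have "(\<Sum>j<n. (1 / 4 :: real) ^ j) \<le> 2"
  proof -
    have "(1 - x) / (1 - 1 / 4) \<le> 2" if "0 \<le> x" for x :: real using that by simp
    from this[of "(1 / 4) ^ n"] show ?thesis unfolding sum_gp_strict by simp
  qed
  finally show ?thesis by (simp add: mult_ac)
qed

text \<open>The factorisation errors decay like \<open>2 ^ (- j)\<close>, so their squares are
  dominated by the first scale \<open>j0\<close>; the \<open>osc\<close> parts sum coordinate by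
  coordinate. The bound does not depend on the number of scales.\<close>

theorem error_square_function:
  fixes f :: "int ^ 'd::finite \<Rightarrow> complex"
  assumes J: "finite J" "\<And>j. j \<in> J \<Longrightarrow> j0 \<le> j" and q: "q \<ge> 1" "q \<le> 2 ^ j0"
    and A: "\<And>j x. j \<in> J \<Longrightarrow> cmod (wsum k (2 ^ j div q) (\<tau> / real (2 ^ j div q) ^ k) x) \<le> A" "A > 0"
    and B: "\<And>x. cmod (wsum k q (of_int a / real q) x) \<le> B" and f: "finsupp f"
  shows "(\<Sum>j\<in>J. l2 (error_op k q a \<tau> (2 ^ j) f))
    \<le> (4 * (real CARD('d))\<^sup>2 * ((1 + 2 * pi * real k * \<bar>\<tau>\<bar>) * real q)\<^sup>2 * (1 / 4) ^ j0
      + 48 * (real CARD('d))\<^sup>2 * B ^ (2 * CARD('d)) * A ^ (2 * (CARD('d) - 1)) * (A * (4 + 2 * pi * \<bar>\<tau>\<bar>))) * l2 f"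
proof (rule l2_square_function[OF J(1) mult_op_error_op _ f])
  fix \<xi> :: "'d \<Rightarrow> real"
  define E where "E = (1 + 2 * pi * real k * \<bar>\<tau>\<bar>) * real q"
  define R where "R = B ^ (2 * CARD('d)) * A ^ (2 * (CARD('d) - 1)) * real CARD('d)"
  have B0: "0 \<le> B" using B[of 0] norm_ge_zero order_trans by blast
  have R0: "0 \<le> R" using B0 A(2) by (simp add: R_def)
  have qj: "q \<le> 2 ^ j" if "j \<in> J" for j
    using q(2) power_increasing[OF J(2)[OF that], of "2::nat"] by linarith
  let ?m = "\<lambda>j. error_mult k q a \<tau> (2 ^ j) \<xi>"
  have "(\<Sum>j\<in>J. (cmod (?m j))\<^sup>2)
      \<le> (\<Sum>j\<in>J. 2 * (real CARD('d))\<^sup>2 * (E / real (2 ^ j))\<^sup>2 + 2 * R * (\<Sum>i\<in>UNIV. (cmod (osc k (2 ^ j div q) \<tau> (real q * \<xi> i)))\<^sup>2))"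
  proof (rule sum_mono)
    fix j assume j: "j \<in> J"
    show "(cmod (?m j))\<^sup>2 \<le> 2 * (real CARD('d))\<^sup>2 * (E / real (2 ^ j))\<^sup>2 + 2 * R * (\<Sum>i\<in>UNIV. (cmod (osc k (2 ^ j div q) \<tau> (real q * \<xi> i)))\<^sup>2)"
      using error_multiplier_bound[OF q(1) qj[OF j] A(1)[OF j] A(2) B, of \<xi>]
      unfolding E_def R_def by (simp only: mult.assoc)
  qed
  also have "\<dots> = 2 * (real CARD('d))\<^sup>2 * E\<^sup>2 * (\<Sum>j\<in>J. (1 / 4) ^ j)
      + 2 * R * (\<Sum>i\<in>UNIV. \<Sum>j\<in>J. (cmod (osc k (2 ^ j div q) \<tau> (real q * \<xi> i)))\<^sup>2)"
  proof -
    have p4: "(E / real (2 ^ j))\<^sup>2 = E\<^sup>2 * (1 / 4) ^ j" for j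
    proof -
      have "((2::real) ^ j)\<^sup>2 = (2\<^sup>2) ^ j" by (metis power_mult mult.commute)
      then show ?thesis by (simp add: power_divide)
    qed
    show ?thesis
      unfolding p4 sum.distrib sum_distrib_left[symmetric] mult.assoc
      by (subst sum.swap[of _ UNIV J]) (rule refl)
  qed
  also have "\<dots> \<le> 2 * (real CARD('d))\<^sup>2 * E\<^sup>2 * (2 * (1 / 4) ^ j0)
      + 2 * R * (\<Sum>i\<in>(UNIV::'d set). 24 * A * (4 + 2 * pi * \<bar>\<tau>\<bar>))"
    using R0 A(2) by (intro add_mono mult_left_mono sum_quarter_powers J sum_mono osc_square_sum q(1) qj A(1)) auto
  also have "\<dots> = 4 * (real CARD('d))\<^sup>2 * E\<^sup>2 * (1 / 4) ^ j0
      + 48 * (real CARD('d))\<^sup>2 * B ^ (2 * CARD('d)) * A ^ (2 * (CARD('d) - 1)) * (A * (4 + 2 * pi * \<bar>\<tau>\<bar>))"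
    by (simp add: R_def power2_eq_square mult_ac)
  finally show "(\<Sum>j\<in>J. (cmod (?m j))\<^sup>2)
      \<le> 4 * (real CARD('d))\<^sup>2 * ((1 + 2 * pi * real k * \<bar>\<tau>\<bar>) * real q)\<^sup>2 * (1 / 4) ^ j0
      + 48 * (real CARD('d))\<^sup>2 * B ^ (2 * CARD('d)) * A ^ (2 * (CARD('d) - 1)) * (A * (4 + 2 * pi * \<bar>\<tau>\<bar>))"
    by (simp add: E_def)
qed

section \<open>Estimates at one level of arcs\<close>

lemma powr_4: "(4::real) powr x = 2 powr (2 * x)"
  using powr_powr[of 2 2 x] by simp

text \<open>The square of \<open>2 powr (- s \<theta> D)\<close>, the size of the multipliers on
  level \<open>s\<close>.\<close>

abbreviation decay :: "real \<Rightarrow> nat \<Rightarrow> nat \<Rightarrow> real" where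
  "decay \<theta> D s \<equiv> 4 powr (- (\<theta> * real D) * real s)"

lemma power_powr_eq: "(((2::real) ^ s) powr (- \<theta>)) ^ (2 * D) = decay \<theta> D s"
proof -
  have "(((2::real) ^ s) powr (- \<theta>)) ^ (2 * D) = 2 powr (real s * - \<theta> * real (2 * D))"
    by (simp add: powr_powr flip: powr_realpow)
  then show ?thesis by (simp add: powr_4 mult_ac)
qed

text \<open>Gauss sum decay in \<open>q\<close> and oscillatory decay in \<open>\<tau>\<close> have
  the same exponent, so only the product \<open>q * (1 + \<bar>\<tau>\<bar>)\<close>
  matters.\<close>

lemma powr_scaling_level:
  fixes C \<theta> \<tau> :: real
  assumes C: "C \<ge> 1" and \<theta>: "0 < \<theta>" and q: "q \<ge> 1" and s: "2 ^ s \<le> real q * (1 + \<bar>\<tau>\<bar>)"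
  shows "((8 * C * (1 + \<bar>\<tau>\<bar>) powr (- \<theta>)) * (3 * C * real q powr (- \<theta>))) ^ (2 * D)
    \<le> (24 * C\<^sup>2) ^ (2 * D) * decay \<theta> D s"
proof -
  have "(8 * C * (1 + \<bar>\<tau>\<bar>) powr (- \<theta>)) * (3 * C * real q powr (- \<theta>))
      = 24 * C\<^sup>2 * (real q * (1 + \<bar>\<tau>\<bar>)) powr (- \<theta>)"
    using q by (simp add: powr_mult power2_eq_square mult_ac)
  also have "\<dots> \<le> 24 * C\<^sup>2 * (2 ^ s) powr (- \<theta>)"
    using s \<theta> by (intro mult_left_mono powr_mono2') auto
  finally have "((8 * C * (1 + \<bar>\<tau>\<bar>) powr (- \<theta>)) * (3 * C * real q powr (- \<theta>))) ^ (2 * D)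
      \<le> (24 * C\<^sup>2 * (2 ^ s) powr (- \<theta>)) ^ (2 * D)"
    using C by (intro power_mono) auto
  also have "\<dots> = (24 * C\<^sup>2) ^ (2 * D) * ((2 ^ s) powr (- \<theta>)) ^ (2 * D)"
    by (simp only: power_mult_distrib)
  also have "(((2::real) ^ s) powr (- \<theta>)) ^ (2 * D) = decay \<theta> D s"
    by (rule power_powr_eq)
  finally show ?thesis .
qed

definition main_const :: "real \<Rightarrow> nat \<Rightarrow> real" where
  "main_const C D = (24 * C\<^sup>2) ^ (2 * D)"

definition error_const :: "nat \<Rightarrow> real \<Rightarrow> nat \<Rightarrow> real" where
  "error_const k C D = 4 * (real D)\<^sup>2 * (1 + 8 * real k)\<^sup>2 + 48 * (real D)\<^sup>2 * (main_const C D * 72)"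

lemma main_const_nonneg: "0 \<le> main_const C D"
  by (simp add: main_const_def)

lemma error_const_nonneg: "0 \<le> error_const k C D"
  by (simp add: error_const_def main_const_nonneg)

text \<open>The factorisation error is harmless because the scales start at
  \<open>2 ^ (c0 * Suc s)\<close>. In the other term one factor \<open>A\<close> is missing, which
  costs \<open>(1 + \<bar>\<tau>\<bar>) powr (1 + \<theta>)\<close>; this is the source of
  \<open>3 ^ s\<close>.\<close>

lemma error_numeric:
  fixes C \<theta> \<tau> :: real
  assumes C: "C \<ge> 1" and \<theta>: "0 < \<theta>" "\<theta> \<le> 1 / 2" and D: "D \<ge> 1"
    and q: "q \<ge> 1" "q \<le> 2 ^ Suc s" and \<tau>: "real q * \<bar>\<tau>\<bar> \<le> 2 ^ Suc s" and s: "2 ^ s \<le> real q * (1 + \<bar>\<tau>\<bar>)"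
    and c0: "\<theta> * real D + 1 \<le> real c0"
  defines "A \<equiv> 8 * C * (1 + \<bar>\<tau>\<bar>) powr (- \<theta>)" and "B \<equiv> 3 * C * real q powr (- \<theta>)"
  shows "4 * (real D)\<^sup>2 * ((1 + 2 * pi * real k * \<bar>\<tau>\<bar>) * real q)\<^sup>2 * (1 / 4) ^ (c0 * Suc s)
      + 48 * (real D)\<^sup>2 * B ^ (2 * D) * A ^ (2 * (D - 1)) * (A * (4 + 2 * pi * \<bar>\<tau>\<bar>))
    \<le> error_const k C D * 3 ^ s * decay \<theta> D s"
proof -
  define \<gamma> where "\<gamma> = \<theta> * real D"
  define P where "P = 4 powr (- \<gamma> * real s)"
  have \<gamma>0: "\<gamma> \<ge> 0" using \<theta> by (simp add: \<gamma>_def)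
  have P0: "P > 0" by (simp add: P_def)
  have A0: "A > 0" using C by (simp add: A_def add_pos_nonneg)
  have \<tau>s: "\<bar>\<tau>\<bar> \<le> 2 * 2 ^ s"
  proof -
    have "1 * \<bar>\<tau>\<bar> \<le> real q * \<bar>\<tau>\<bar>" using q by (intro mult_right_mono) auto
    then show ?thesis using \<tau> by simp
  qed
  have \<tau>1: "1 + \<bar>\<tau>\<bar> \<le> 3 * 2 ^ s"
  proof -
    have "(1::real) \<le> 2 ^ s" by simp
    then show ?thesis using \<tau>s by linarith
  qed
  have p3: "(1::real) \<le> 3 ^ s" by simp
  have part1: "4 * (real D)\<^sup>2 * ((1 + 2 * pi * real k * \<bar>\<tau>\<bar>) * real q)\<^sup>2 * (1 / 4) ^ (c0 * Suc s)
      \<le> 4 * (real D)\<^sup>2 * (1 + 8 * real k)\<^sup>2 * (3 ^ s * P)"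
  proof -
    have "2 * pi * real k * (real q * \<bar>\<tau>\<bar>) \<le> 8 * real k * 2 ^ Suc s"
      using pi_less_4 \<tau> by (intro mult_mono) auto
    moreover have "real q \<le> 2 ^ Suc s" using q(2) by (metis of_nat_le_iff of_nat_numeral of_nat_power)
    ultimately have "(1 + 2 * pi * real k * \<bar>\<tau>\<bar>) * real q \<le> (1 + 8 * real k) * 2 ^ Suc s"
      by (simp add: algebra_simps)
    then have "((1 + 2 * pi * real k * \<bar>\<tau>\<bar>) * real q)\<^sup>2 \<le> ((1 + 8 * real k) * 2 ^ Suc s)\<^sup>2"
      by (intro power_mono mult_nonneg_nonneg add_nonneg_nonneg) auto
    also have "\<dots> = (1 + 8 * real k)\<^sup>2 * 4 ^ Suc s"
    proof -
      have "((2::real) ^ Suc s)\<^sup>2 = (2\<^sup>2) ^ Suc s" by (metis power_mult mult.commute)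
      then show ?thesis by (simp add: power_mult_distrib)
    qed
    finally have a: "((1 + 2 * pi * real k * \<bar>\<tau>\<bar>) * real q)\<^sup>2 \<le> (1 + 8 * real k)\<^sup>2 * 4 ^ Suc s" .
    have p4: "(1 / 4 :: real) ^ n = 4 powr (- real n)" for n
      by (simp add: powr_minus_divide powr_realpow power_one_over)
    have "(1 / 4 :: real) ^ (c0 * Suc s) = 4 powr (- (real c0 * real (Suc s)))"
      by (simp only: p4 of_nat_mult)
    \<comment> \<open>Of the exponent \<open>\<gamma> + 1\<close>, the 1 cancels
      \<open>4 ^ Suc s\<close> in the preceding bound and \<open>\<gamma>\<close> provides the
      decay.\<close>
    also have "\<dots> \<le> 4 powr (- ((\<gamma> + 1) * real (Suc s)))"
      using c0 by (intro powr_mono) (auto simp: \<gamma>_def intro!: mult_right_mono simp del: of_nat_Suc)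
    also have "\<dots> = 4 powr (- \<gamma> * real (Suc s)) * 4 powr (- real (Suc s))"
      by (simp add: algebra_simps flip: powr_add)
    also have "\<dots> \<le> P * 4 powr (- real (Suc s))"
      unfolding P_def using \<gamma>0 by (intro mult_right_mono powr_mono) (auto simp: mult_left_mono)
    finally have b: "(1 / 4 :: real) ^ (c0 * Suc s) \<le> P * 4 powr (- real (Suc s))" .
    have "((1 + 2 * pi * real k * \<bar>\<tau>\<bar>) * real q)\<^sup>2 * (1 / 4) ^ (c0 * Suc s)
        \<le> ((1 + 8 * real k)\<^sup>2 * 4 ^ Suc s) * (P * 4 powr (- real (Suc s)))"
      by (intro mult_mono a b) auto
    also have "\<dots> = (1 + 8 * real k)\<^sup>2 * P * (4 ^ Suc s * 4 powr (- real (Suc s)))" by (simp only: mult_ac)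
    also have "(4::real) ^ Suc s * 4 powr (- real (Suc s)) = 1"
      unfolding p4[symmetric] by (simp add: power_one_over)
    also have "(1 + 8 * real k)\<^sup>2 * P * 1 \<le> (1 + 8 * real k)\<^sup>2 * P * 3 ^ s"
      using P0 p3 by (intro mult_left_mono) auto
    finally have "((1 + 2 * pi * real k * \<bar>\<tau>\<bar>) * real q)\<^sup>2 * (1 / 4) ^ (c0 * Suc s) \<le> (1 + 8 * real k)\<^sup>2 * P * 3 ^ s" .
    then have "4 * (real D)\<^sup>2 * (((1 + 2 * pi * real k * \<bar>\<tau>\<bar>) * real q)\<^sup>2 * (1 / 4) ^ (c0 * Suc s))
        \<le> 4 * (real D)\<^sup>2 * ((1 + 8 * real k)\<^sup>2 * P * 3 ^ s)" by (intro mult_left_mono) auto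
    then show ?thesis by (simp only: mult_ac)
  qed
  have part2: "48 * (real D)\<^sup>2 * B ^ (2 * D) * A ^ (2 * (D - 1)) * (A * (4 + 2 * pi * \<bar>\<tau>\<bar>))
      \<le> 48 * (real D)\<^sup>2 * (main_const C D * 72) * (3 ^ s * P)"
  proof -
    have AB: "(A * B) ^ (2 * D) \<le> main_const C D * P"
      unfolding A_def B_def main_const_def P_def \<gamma>_def by (rule powr_scaling_level[OF C \<theta>(1) q(1) s])
    have "2 * D = Suc (2 * (D - 1) + 1)" using D by simp
    then have "A ^ (2 * D) = A ^ (2 * (D - 1)) * A * A" by (simp only: power_Suc power_add) simp
    then have eq: "B ^ (2 * D) * A ^ (2 * (D - 1)) * (A * (4 + 2 * pi * \<bar>\<tau>\<bar>))
        = (A * B) ^ (2 * D) * ((4 + 2 * pi * \<bar>\<tau>\<bar>) / A)"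
      using A0 by (simp add: power_mult_distrib)
    have "(1 + \<bar>\<tau>\<bar>) powr \<theta> \<le> (3 * 2 ^ s) powr \<theta>"
      using \<tau>1 \<theta> by (intro powr_mono2) auto
    also have "\<dots> = 3 powr \<theta> * (2 powr \<theta>) ^ s"
      by (simp add: powr_mult powr_powr mult.commute flip: powr_realpow)
    also have "\<dots> \<le> 3 powr 1 * (3 / 2) ^ s"
    proof (intro mult_mono power_mono powr_mono)
      \<comment> \<open>With \<open>\<theta> \<le> 1 / 2\<close> the base is at most
        \<open>3 / 2\<close>, and together with \<open>\<bar>\<tau>\<bar> \<le> 2 * 2 ^ s\<close>
        this gives \<open>2 * (3 / 2) = 3\<close>.\<close>
      have "2 powr \<theta> \<le> 2 powr (1 / 2)" using \<theta> by (intro powr_mono) auto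
      also have "\<dots> = sqrt 2" by (simp add: powr_half_sqrt)
      also have "\<dots> \<le> 3 / 2" by (intro real_le_lsqrt) (auto simp: power2_eq_square)
      finally show "2 powr \<theta> \<le> (3 / 2 :: real)" .
    qed (use \<theta> in auto)
    finally have t\<theta>: "(1 + \<bar>\<tau>\<bar>) powr \<theta> \<le> 3 * (3 / 2) ^ s" by simp
    have "1 / A = (1 + \<bar>\<tau>\<bar>) powr \<theta> / (8 * C)"
      using C by (simp add: A_def powr_minus divide_simps)
    also have "\<dots> \<le> (1 + \<bar>\<tau>\<bar>) powr \<theta> / 1"
      using C by (intro divide_left_mono) auto
    finally have iA: "1 / A \<le> 3 * (3 / 2) ^ s" using t\<theta> by simp
    have "2 * pi * \<bar>\<tau>\<bar> \<le> 8 * \<bar>\<tau>\<bar>" using pi_less_4 by (intro mult_right_mono) auto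
    then have "4 + 2 * pi * \<bar>\<tau>\<bar> \<le> 8 * (3 * 2 ^ s)" using \<tau>1 by linarith
    then have "(4 + 2 * pi * \<bar>\<tau>\<bar>) * (1 / A) \<le> (8 * (3 * 2 ^ s)) * (3 * (3 / 2) ^ s)"
      using iA A0 by (intro mult_mono) auto
    also have "\<dots> = 72 * 3 ^ s" by (simp add: power_divide)
    finally have r: "(4 + 2 * pi * \<bar>\<tau>\<bar>) / A \<le> 72 * 3 ^ s" by simp
    have "(A * B) ^ (2 * D) * ((4 + 2 * pi * \<bar>\<tau>\<bar>) / A) \<le> (main_const C D * P) * (72 * 3 ^ s)"
      using AB r A0 P0 main_const_nonneg[of C D] by (intro mult_mono) (auto intro!: divide_nonneg_pos add_nonneg_nonneg)
    then have "48 * (real D)\<^sup>2 * (B ^ (2 * D) * A ^ (2 * (D - 1)) * (A * (4 + 2 * pi * \<bar>\<tau>\<bar>)))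
        \<le> 48 * (real D)\<^sup>2 * ((main_const C D * P) * (72 * 3 ^ s))"
      unfolding eq by (intro mult_left_mono) auto
    then show ?thesis by (simp only: mult_ac)
  qed
  show ?thesis
    using add_mono[OF part1 part2] unfolding error_const_def P_def \<gamma>_def
    by (simp only: distrib_right mult.assoc)
qed

lemma outer_indexD:
  assumes "(q, a, v) \<in> outer_index W s" "W \<ge> 1"
  defines "\<tau> \<equiv> real_of_int v / real W"
  shows "nat q \<ge> 1" "nat q \<le> 2 ^ Suc s" "int (nat q) = q" "0 \<le> a" "a \<le> int (nat q)" "coprime a (int (nat q))"
    "real (nat q) * \<bar>\<tau>\<bar> \<le> 2 ^ Suc s" "2 ^ s \<le> real (nat q) * (1 + \<bar>\<tau>\<bar>)"
proof -
  have *: "1 \<le> q" "q \<le> 2 ^ Suc s" "0 \<le> a" "a \<le> q" "\<bar>v\<bar> * q \<le> 2 ^ Suc s * int W" "coprime a q"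
      "\<not> (q \<le> 2 ^ s \<and> \<bar>v\<bar> * q \<le> 2 ^ s * int W)"
    using assms(1) by (auto simp: outer_index_def arc_index_def)
  show q: "nat q \<ge> 1" "int (nat q) = q" using * by auto
  then show "0 \<le> a" "a \<le> int (nat q)" "coprime a (int (nat q))" using * by auto
  have "int (nat q) \<le> int (2 ^ Suc s)" using * q by simp
  then show "nat q \<le> 2 ^ Suc s" by (simp only: of_nat_le_iff)
  have rq: "real (nat q) = real_of_int q" using q by simp
  have t: "real (nat q) * \<bar>\<tau>\<bar> = real_of_int (\<bar>v\<bar> * q) / real W"
    by (simp add: rq \<tau>_def abs_divide)
  have "real_of_int (\<bar>v\<bar> * q) \<le> real_of_int (2 ^ Suc s * int W)" using *(5) by (simp only: of_int_le_iff)
  then have "real_of_int (\<bar>v\<bar> * q) \<le> 2 ^ Suc s * real W" by simp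
  then show "real (nat q) * \<bar>\<tau>\<bar> \<le> 2 ^ Suc s"
    unfolding t using assms(2) by (simp add: divide_le_eq)
  show "2 ^ s \<le> real (nat q) * (1 + \<bar>\<tau>\<bar>)"
  proof (cases "q \<le> 2 ^ s")
    case True
    then have "2 ^ s * int W \<le> \<bar>v\<bar> * q" using *(7) by linarith
    then have "real_of_int (2 ^ s * int W) \<le> real_of_int (\<bar>v\<bar> * q)" by (simp only: of_int_le_iff)
    then have "2 ^ s * real W \<le> real_of_int (\<bar>v\<bar> * q)" by simp
    then have "2 ^ s \<le> real (nat q) * \<bar>\<tau>\<bar>"
      unfolding t using assms(2) by (simp add: le_divide_eq)
    then show ?thesis by (simp add: distrib_left)
  next
    case False
    then have "real_of_int (2 ^ s) \<le> real_of_int q" by (simp only: of_int_le_iff)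
    then have "2 ^ s \<le> real (nat q)" by (simp add: rq)
    moreover have "0 \<le> real (nat q) * \<bar>\<tau>\<bar>" by simp
    moreover have "real (nat q) * (1 + \<bar>\<tau>\<bar>) = real (nat q) + real (nat q) * \<bar>\<tau>\<bar>"
      by (simp add: distrib_left)
    ultimately show ?thesis by linarith
  qed
qed

lemma arc_point_eq:
  assumes "q dvd int W" "W \<ge> 1" "q \<ge> 1"
  shows "of_int (arc_point k W j (q, a, v)) / (real W * 2 ^ (j * k))
    = of_int a / real (nat q) + (of_int v / real W) / real (2 ^ j) ^ k"
proof -
  obtain c where c: "int W = q * c" using assms by (elim dvdE)
  then have "real_of_int (int W) = real_of_int (q * c)" by simp
  then have W: "real W = of_int q * of_int c" by simp
  have "real W \<noteq> 0" using assms by simp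
  then show ?thesis
    using assms c by (simp add: arc_point_def W divide_simps power_mult)
qed

lemma level_index_bounds:
  fixes f :: "int ^ 'd::finite \<Rightarrow> complex"
  assumes C: "weyl_bound k \<theta> C" and \<theta>: "0 < \<theta>" "\<theta> \<le> 1 / 2" and k: "k \<ge> 2"
    and c0: "\<theta> * real CARD('d) + 1 \<le> real c0" "c0 \<ge> 3" and f: "finsupp f"
    and q: "q \<ge> 1" "q \<le> 2 ^ Suc s" and a: "0 \<le> a" "a \<le> int q" "coprime a (int q)"
    and \<tau>: "real q * \<bar>\<tau>\<bar> \<le> 2 ^ Suc s" "2 ^ s \<le> real q * (1 + \<bar>\<tau>\<bar>)"
    and J: "finite J" "\<And>j. j \<in> J \<Longrightarrow> c0 * Suc s \<le> j"
  defines "A \<equiv> 8 * C * (1 + \<bar>\<tau>\<bar>) powr (- \<theta>)"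
  shows "(\<Sum>j\<in>J. l2 (error_op k q a \<tau> (2 ^ j) f))
      \<le> error_const k C CARD('d) * 3 ^ s * decay \<theta> CARD('d) s * l2 f" (is ?error)
    and "j \<in> J \<Longrightarrow> (cmod (main_op k q a \<tau> (2 ^ j) f x))\<^sup>2
      \<le> A ^ (2 * CARD('d)) * bavg q (2 ^ j div q) (\<lambda>y. (cmod (gauss_op k q a f y))\<^sup>2) x" (is "_ \<Longrightarrow> ?main")
    and "A ^ (2 * CARD('d)) * l2 (gauss_op k q a f)
      \<le> main_const C CARD('d) * decay \<theta> CARD('d) s * l2 f" (is ?gauss)
proof -
  define B where "B = 3 * C * real q powr (- \<theta>)"
  have C1: "C \<ge> 1" by (rule weyl_bound_ge_1[OF C])
  have \<theta>1: "\<theta> \<le> 1" using \<theta> by simp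
  have A0: "A > 0" using C1 by (simp add: A_def add_pos_nonneg)
  have c0s: "3 * Suc s \<le> c0 * Suc s" using c0(2) by (rule mult_right_mono) simp
  have q0: "q \<le> 2 ^ (c0 * Suc s)"
  proof -
    have "1 * Suc s \<le> c0 * Suc s" using c0(2) by (intro mult_right_mono) auto
    then have "Suc s \<le> c0 * Suc s" by (simp only: mult_1_left)
    then have "(2::nat) ^ Suc s \<le> 2 ^ (c0 * Suc s)" by (rule power_increasing) simp
    then show ?thesis using q(2) by (rule order_trans[rotated])
  qed
  have qj: "q \<le> 2 ^ j" if "j \<in> J" for j
    using q0 power_increasing[OF J(2)[OF that], of "2::nat"] by linarith
  have osc: "cmod (wsum k (2 ^ j div q) (\<tau> / real (2 ^ j div q) ^ k) x) \<le> A" if j: "j \<in> J" for j x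
  proof -
    note d = div_bounds[OF q(1) qj[OF j]]
    have "4 * 2 ^ Suc s \<le> (2::real) ^ j"
    proof -
      \<comment> \<open>Of the factor 4, one 2 is demanded by the oscillation bound and the other
        pays for rounding \<open>2 ^ j / q\<close> down.\<close>
      have "(2::real) ^ (Suc s + 2) \<le> 2 ^ j" using c0s J(2)[OF j] by (intro power_increasing) auto
      then show ?thesis by (simp add: power_add)
    qed
    then have "4 * (real q * \<bar>\<tau>\<bar>) \<le> 2 ^ j" using \<tau>(1) by linarith
    then have "2 * (2 * \<bar>\<tau>\<bar>) \<le> real (2 ^ j) / real q" using q by (simp add: field_simps)
    then have "2 * \<bar>\<tau>\<bar> \<le> real (2 ^ j div q)" using d(3) by linarith
    then show ?thesis unfolding A_def by (intro oscillation_bound[OF C \<theta>(1) \<theta>1 k d(1)])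
  qed
  have gauss: "cmod (wsum k q (of_int a / real q) x) \<le> B" for x
    unfolding B_def by (rule gauss_sum_bound[OF C \<theta>(1) \<theta>1 k q(1) a])
  have "(\<Sum>j\<in>J. l2 (error_op k q a \<tau> (2 ^ j) f))
    \<le> (4 * (real CARD('d))\<^sup>2 * ((1 + 2 * pi * real k * \<bar>\<tau>\<bar>) * real q)\<^sup>2 * (1 / 4) ^ (c0 * Suc s)
      + 48 * (real CARD('d))\<^sup>2 * B ^ (2 * CARD('d)) * A ^ (2 * (CARD('d) - 1)) * (A * (4 + 2 * pi * \<bar>\<tau>\<bar>))) * l2 f"
    by (rule error_square_function[OF J q(1) q0 osc A0 gauss f])
  also have "\<dots> \<le> error_const k C CARD('d) * 3 ^ s * decay \<theta> CARD('d) s * l2 f"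
    unfolding A_def B_def
    by (intro mult_right_mono error_numeric[OF C1 \<theta> _ q \<tau> c0(1)] l2_nonneg) (simp add: Suc_le_eq)
  finally show ?error .
  show ?main if "j \<in> J"
    by (rule main_op_bound[OF q(1) qj[OF that] osc[OF that]])
  have "A ^ (2 * CARD('d)) * l2 (gauss_op k q a f) \<le> A ^ (2 * CARD('d)) * (B ^ (2 * CARD('d)) * l2 f)"
    unfolding gauss_op_def using A0 by (intro mult_left_mono l2_weyl_op gauss f) auto
  also have "\<dots> = (A * B) ^ (2 * CARD('d)) * l2 f" by (simp add: power_mult_distrib)
  also have "\<dots> \<le> main_const C CARD('d) * decay \<theta> CARD('d) s * l2 f"
    unfolding main_const_def A_def B_def
    by (intro mult_right_mono powr_scaling_level[OF C1 \<theta>(1) q(1) \<tau>(2)] l2_nonneg)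
  finally show ?gauss .
qed

text \<open>Cauchy-Schwarz over \<open>I\<close> gives one factor \<open>card I\<close>, adding up
  the l2 bounds of the single operators another; the division by \<open>W ^ 2\<close> turns them
  into \<open>w ^ 2\<close>.\<close>

lemma level_single_scale:
  fixes f :: "int ^ 'd::finite \<Rightarrow> complex"
  assumes I: "finite I" "real (card I) \<le> w * real W" and W: "W \<ge> 1"
    and A: "\<And>i \<xi>. i \<in> I \<Longrightarrow> cmod (wsum k N (t i) \<xi>) \<le> A" and f: "finsupp f"
    and X: "finite X" "\<beta> > 0" "\<And>x. x \<in> X \<Longrightarrow> \<beta> \<le> (\<Sum>i\<in>I. cmod (weyl_op k 1 N (t i) f x)) / real W"
  shows "real (card X) \<le> w\<^sup>2 * A ^ (2 * CARD('d)) / \<beta>\<^sup>2 * l2 f"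
proof (cases "X = {}")
  case False
  let ?T = "\<lambda>i x. cmod (weyl_op k 1 N (t i) f x)"
  have w: "real (card I) / real W \<le> w" using I W by (simp add: divide_le_eq)
  have w0: "0 \<le> w" by (rule order_trans[OF _ w]) simp
  have "\<beta>\<^sup>2 \<le> real (card I) / (real W)\<^sup>2 * (\<Sum>i\<in>I. (?T i x)\<^sup>2)" if "x \<in> X" for x
  proof -
    have "\<beta>\<^sup>2 \<le> ((\<Sum>i\<in>I. ?T i x) / real W)\<^sup>2"
      using X that by (intro power_mono) auto
    also have "\<dots> \<le> real (card I) * (\<Sum>i\<in>I. (?T i x)\<^sup>2) / (real W)\<^sup>2"
      unfolding power_divide by (intro divide_right_mono sum_squared_le_card) auto
    finally show ?thesis by simp
  qed
  then have "real (card X) \<le> (\<Sum>x\<in>X. real (card I) / (real W)\<^sup>2 * (\<Sum>i\<in>I. (?T i x)\<^sup>2)) / \<beta>\<^sup>2"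
    using X by (intro card_le_sum_div) auto
  also have "(\<Sum>x\<in>X. real (card I) / (real W)\<^sup>2 * (\<Sum>i\<in>I. (?T i x)\<^sup>2))
      = real (card I) / (real W)\<^sup>2 * (\<Sum>i\<in>I. \<Sum>x\<in>X. (?T i x)\<^sup>2)"
    unfolding sum_distrib_left[symmetric] by (subst sum.swap) (rule refl)
  also have "\<dots> \<le> real (card I) / (real W)\<^sup>2 * (\<Sum>i\<in>I. A ^ (2 * CARD('d)) * l2 f)"
  proof (intro mult_left_mono sum_mono)
    fix i assume i: "i \<in> I"
    have "(\<Sum>x\<in>X. (?T i x)\<^sup>2) \<le> l2 (weyl_op k 1 N (t i) f)"
      by (intro sum_le_l2 X mult_op_finsupp[OF mult_op_weyl_op f])
    also have "\<dots> \<le> A ^ (2 * CARD('d)) * l2 f" by (intro l2_weyl_op A i f)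
    finally show "(\<Sum>x\<in>X. (?T i x)\<^sup>2) \<le> A ^ (2 * CARD('d)) * l2 f" .
  qed auto
  also have "\<dots> = (real (card I) / real W)\<^sup>2 * (A ^ (2 * CARD('d)) * l2 f)"
    by (simp add: power2_eq_square)
  also have "\<dots> \<le> w\<^sup>2 * (A ^ (2 * CARD('d)) * l2 f)"
    using w by (intro mult_right_mono power_mono) (auto simp: l2_nonneg power_mult)
  finally show ?thesis using X(2) by (simp add: divide_right_mono mult_ac)
qed (auto simp: l2_nonneg power_mult)

lemma bavg_sum:
  "bavg q M (\<lambda>y. \<Sum>i\<in>I. c i * g i y) x = (\<Sum>i\<in>I. c i * bavg q M (g i) x)"
proof -
  have "(\<Sum>v\<in>nbox M. \<Sum>i\<in>I. c i * g i (x - emb q v)) = (\<Sum>i\<in>I. c i * (\<Sum>v\<in>nbox M. g i (x - emb q v)))"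
    by (subst sum.swap) (simp add: sum_distrib_left)
  then show ?thesis unfolding bavg_def by (simp only: sum_divide_distrib[of _ I] times_divide_eq_right)
qed

text \<open>\<open>2304 = 4 * 24 ^ 2\<close>, with 24 from the size of \<open>outer_index\<close>
  and 4 from splitting into main part and error. The power of 2 combines the covering constant with
  the number of denominators.\<close>

definition orth_const :: "nat \<Rightarrow> real \<Rightarrow> nat \<Rightarrow> real" where
  "orth_const k C D = 2304 * (error_const k C D + 2 ^ Suc D * main_const C D)"

lemma sum_fibres:
  fixes g :: "'a \<Rightarrow> real"
  assumes "finite I" "finite Q" "\<And>\<iota>. \<iota> \<in> I \<Longrightarrow> h \<iota> \<in> Q"
  shows "(\<Sum>q\<in>Q. \<Sum>\<iota> | \<iota> \<in> I \<and> h \<iota> = q. g \<iota>) = (\<Sum>\<iota>\<in>I. g \<iota>)"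
  using assms by (intro sum.group) auto

text \<open>The error is controlled by the square function over all scales. For the main part the
  cubes depend on \<open>t\<close> only through the denominator \<open>q\<close>, so for each
  \<open>q\<close> the covering lemma applies once, to a weighted sum of squared Gauss sum
  operators. Treating the denominators separately loses \<open>2 ^ Suc s\<close>, which
  \<open>3 ^ s\<close> dominates.\<close>

theorem level_all_scales:
  fixes f :: "int ^ 'd::finite \<Rightarrow> complex" and j :: "int ^ 'd \<Rightarrow> nat"
  assumes C: "weyl_bound k \<theta> C" and \<theta>: "0 < \<theta>" "\<theta> \<le> 1 / 2" and k: "k \<ge> 2"
    and c0: "\<theta> * real CARD('d) + 1 \<le> real c0" "c0 \<ge> 3" and f: "finsupp f"
    and W: "W \<ge> 1" "\<And>q. 1 \<le> q \<Longrightarrow> q \<le> 2 ^ Suc s \<Longrightarrow> q dvd int W"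
    and X: "finite X" "\<beta> > 0" "\<And>x. x \<in> X \<Longrightarrow> c0 * Suc s \<le> j x"
      "\<And>x. x \<in> X \<Longrightarrow> \<beta> \<le> (\<Sum>t\<in>outer_index W s.
        cmod (weyl_op k 1 (2 ^ j x) (of_int (arc_point k W (j x) t) / (real W * 2 ^ (j x * k))) f x)) / real W"
  shows "real (card X) \<le> orth_const k C CARD('d) * 48 ^ s * decay \<theta> CARD('d) s / \<beta>\<^sup>2 * l2 f"
proof -
  define I where "I = outer_index W s"
  define w where "w = 24 * (4::real) ^ s"
  define P where "P = decay \<theta> CARD('d) s * l2 f"
  define E where "E = error_const k C CARD('d)"
  define G where "G = main_const C CARD('d)"
  define qq where "qq = (\<lambda>t::int \<times> int \<times> int. nat (fst t))"
  define aa where "aa = (\<lambda>t::int \<times> int \<times> int. fst (snd t))"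
  define \<tau> where "\<tau> = (\<lambda>t::int \<times> int \<times> int. real_of_int (snd (snd t)) / real W)"
  define A where "A = (\<lambda>t. (8 * C * (1 + \<bar>\<tau> t\<bar>) powr (- \<theta>)) ^ (2 * CARD('d)))"
  define err where "err = (\<lambda>t j. error_op k (qq t) (aa t) (\<tau> t) (2 ^ j) f)"
  define main where "main = (\<lambda>t j. main_op k (qq t) (aa t) (\<tau> t) (2 ^ j) f)"
  define gs where "gs = (\<lambda>t. gauss_op k (qq t) (aa t) f)"
  define J where "J = j ` X"
  have J: "finite J" "\<And>i. i \<in> J \<Longrightarrow> c0 * Suc s \<le> i" using X by (auto simp: J_def)
  have P0: "0 \<le> P" by (simp add: P_def l2_nonneg)
  have w0: "w > 0" by (simp add: w_def)
  have E0: "0 \<le> E" and G0: "0 \<le> G" by (simp_all add: E_def G_def error_const_nonneg main_const_nonneg)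
  have W0: "real W > 0" using W by simp
  have I: "finite I" "real (card I) \<le> w * real W"
    using outer_index_bound[OF W(1), of s] by (auto simp: I_def w_def)
  have idx: "qq t \<ge> 1" "qq t \<le> 2 ^ Suc s" "0 \<le> aa t" "aa t \<le> int (qq t)" "coprime (aa t) (int (qq t))"
    "real (qq t) * \<bar>\<tau> t\<bar> \<le> 2 ^ Suc s" "2 ^ s \<le> real (qq t) * (1 + \<bar>\<tau> t\<bar>)" if "t \<in> I" for t
  proof -
    obtain q a v where t: "t = (q, a, v)" by (cases t) auto
    have "(q, a, v) \<in> outer_index W s" using that by (simp add: I_def t)
    from outer_indexD[OF this W(1)]
    show "qq t \<ge> 1" "qq t \<le> 2 ^ Suc s" "0 \<le> aa t" "aa t \<le> int (qq t)" "coprime (aa t) (int (qq t))"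
      "real (qq t) * \<bar>\<tau> t\<bar> \<le> 2 ^ Suc s" "2 ^ s \<le> real (qq t) * (1 + \<bar>\<tau> t\<bar>)"
      by (simp_all add: t qq_def aa_def \<tau>_def)
  qed
  note lib = level_index_bounds[OF C \<theta> k c0 f idx J]
  have err_sum: "(\<Sum>i\<in>J. l2 (err t i)) \<le> E * 3 ^ s * P" if "t \<in> I" for t
    using lib(1)[OF that that that that that that that] by (simp add: err_def E_def P_def mult.assoc)
  have main_le: "(cmod (main t (j x) x))\<^sup>2 \<le> A t * bavg (qq t) (2 ^ j x div qq t) (\<lambda>y. (cmod (gs t y))\<^sup>2) x"
    if "t \<in> I" "x \<in> X" for t x
    using lib(2)[OF that(1) that(1) that(1) that(1) that(1) that(1) that(1), of "j x" x] that(2)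
    by (simp add: main_def A_def gs_def J_def)
  have gs_l2: "A t * l2 (gs t) \<le> G * P" if "t \<in> I" for t
    using lib(3)[OF that that that that that that that] by (simp add: A_def gs_def G_def P_def mult.assoc)
  have A0: "0 \<le> A t" for t by (simp add: A_def power_mult)
  have gs_fin: "finsupp (gs t)" for t unfolding gs_def by (rule finsupp_gauss_op[OF f])
  have err_fin: "finsupp (err t i)" for t i
    unfolding err_def by (rule mult_op_finsupp[OF mult_op_error_op f])
  \<comment> \<open>Chosen such that Cauchy-Schwarz leaves \<open>2 * \<eta>\<close> for main part
    and error together.\<close>
  define \<eta> where "\<eta> = \<beta>\<^sup>2 * real W / (4 * w)"
  have \<eta>0: "\<eta> > 0" using X W0 w0 by (simp add: \<eta>_def)
  define X1 where "X1 = {x \<in> X. \<eta> \<le> (\<Sum>t\<in>I. (cmod (err t (j x) x))\<^sup>2)}"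
  define X2 where "X2 = (\<lambda>q. {x \<in> X. \<eta> / 2 ^ Suc s \<le> (\<Sum>t | t \<in> I \<and> qq t = q. (cmod (main t (j x) x))\<^sup>2)})"
  have split: "X \<subseteq> X1 \<union> (\<Union>q\<in>{1..2 ^ Suc s}. X2 q)"
  proof
    fix x assume x: "x \<in> X"
    have T: "weyl_op k 1 (2 ^ j x) (of_int (arc_point k W (j x) t) / (real W * 2 ^ (j x * k))) f x
        = main t (j x) x + err t (j x) x" if "t \<in> I" for t
    proof -
      obtain q a v where t: "t = (q, a, v)" by (cases t) auto
      have q: "1 \<le> q" "q \<le> 2 ^ Suc s" using that by (auto simp: I_def t outer_index_def arc_index_def)
      show ?thesis
        using arc_point_eq[OF W(2)[OF q] W(1) q(1), of k "j x" a v]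
        by (simp add: t main_def err_def error_op_def qq_def aa_def \<tau>_def)
    qed
    have "\<beta> * real W \<le> (\<Sum>t\<in>I. cmod (main t (j x) x + err t (j x) x))"
      using X(4)[OF x] W0 T by (simp add: le_divide_eq I_def[symmetric])
    then have "(\<beta> * real W)\<^sup>2 \<le> (\<Sum>t\<in>I. cmod (main t (j x) x + err t (j x) x))\<^sup>2"
      using X W0 by (intro power_mono) auto
    also have "\<dots> \<le> real (card I) * (\<Sum>t\<in>I. (cmod (main t (j x) x + err t (j x) x))\<^sup>2)"
      by (rule sum_squared_le_card)
    also have "\<dots> \<le> (w * real W) * (\<Sum>t\<in>I. 2 * (cmod (main t (j x) x))\<^sup>2 + 2 * (cmod (err t (j x) x))\<^sup>2)"
    proof (intro mult_mono I(2) sum_mono)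
      fix t
      have "(cmod (main t (j x) x + err t (j x) x))\<^sup>2 \<le> (cmod (main t (j x) x) + cmod (err t (j x) x))\<^sup>2"
        by (intro power_mono norm_triangle_ineq) auto
      also have "\<dots> \<le> 2 * (cmod (main t (j x) x))\<^sup>2 + 2 * (cmod (err t (j x) x))\<^sup>2" by (rule power2_add_le)
      finally show "(cmod (main t (j x) x + err t (j x) x))\<^sup>2 \<le> \<dots>" .
    qed (use w0 W0 in \<open>auto intro!: sum_nonneg\<close>)
    also have "(\<Sum>t\<in>I. 2 * (cmod (main t (j x) x))\<^sup>2 + 2 * (cmod (err t (j x) x))\<^sup>2)
        = 2 * ((\<Sum>t\<in>I. (cmod (main t (j x) x))\<^sup>2) + (\<Sum>t\<in>I. (cmod (err t (j x) x))\<^sup>2))"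
      by (simp add: sum.distrib sum_distrib_left)
    also have "(\<beta> * real W)\<^sup>2 = (w * real W) * (2 * (2 * \<eta>))"
      using w0 by (simp add: \<eta>_def power2_eq_square)
    finally have "2 * \<eta> \<le> (\<Sum>t\<in>I. (cmod (main t (j x) x))\<^sup>2) + (\<Sum>t\<in>I. (cmod (err t (j x) x))\<^sup>2)"
      using mult_pos_pos[OF w0 W0] by (simp only: mult_le_cancel_left_pos zero_less_numeral)
    then consider "\<eta> \<le> (\<Sum>t\<in>I. (cmod (err t (j x) x))\<^sup>2)" | "\<eta> \<le> (\<Sum>t\<in>I. (cmod (main t (j x) x))\<^sup>2)"
      by linarith
    then show "x \<in> X1 \<union> (\<Union>q\<in>{1..2 ^ Suc s}. X2 q)"
    proof cases
      case 1
      then show ?thesis using x by (simp add: X1_def)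
    next
      case 2
      \<comment> \<open>Pigeonhole over the \<open>2 ^ Suc s\<close> possible denominators.\<close>
      have "\<exists>q\<in>{1..2 ^ Suc s}. \<eta> / 2 ^ Suc s \<le> (\<Sum>t | t \<in> I \<and> qq t = q. (cmod (main t (j x) x))\<^sup>2)"
      proof (rule ccontr)
        assume "\<not> ?thesis"
        then have "(\<Sum>q\<in>{1..2 ^ Suc s}. \<Sum>t | t \<in> I \<and> qq t = q. (cmod (main t (j x) x))\<^sup>2)
            < (\<Sum>q\<in>{1..2 ^ Suc s :: nat}. \<eta> / 2 ^ Suc s)"
          by (intro sum_strict_mono) (auto simp: not_le)
        also have "\<dots> = \<eta>" by simp
        finally have "(\<Sum>t\<in>I. (cmod (main t (j x) x))\<^sup>2) < \<eta>"
          by (subst (asm) sum_fibres) (use I idx in auto)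
        then show False using 2 by simp
      qed
      then show ?thesis using x by (auto simp: X2_def)
    qed
  qed
  have X1: "real (card X1) \<le> card I * (E * 3 ^ s * P) / \<eta>"
  proof -
    have X1X: "X1 \<subseteq> X" by (auto simp: X1_def)
    have "real (card X1) \<le> (\<Sum>x\<in>X1. \<Sum>t\<in>I. (cmod (err t (j x) x))\<^sup>2) / \<eta>"
      using X \<eta>0 by (intro card_le_sum_div) (auto simp: X1_def)
    \<comment> \<open>The scale of \<open>x\<close> is one of those in \<open>J\<close>; replacing
      it by the sum over \<open>J\<close> removes the dependence on \<open>x\<close>.\<close>
    also have "\<dots> \<le> (\<Sum>x\<in>X1. \<Sum>t\<in>I. \<Sum>i\<in>J. (cmod (err t i x))\<^sup>2) / \<eta>"
      using \<eta>0 J X1X by (intro divide_right_mono sum_mono member_le_sum) (auto simp: J_def)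
    also have "(\<Sum>x\<in>X1. \<Sum>t\<in>I. \<Sum>i\<in>J. (cmod (err t i x))\<^sup>2) = (\<Sum>t\<in>I. \<Sum>i\<in>J. \<Sum>x\<in>X1. (cmod (err t i x))\<^sup>2)"
      by (subst sum.swap, intro sum.cong refl, subst sum.swap, rule refl)
    also have "\<dots> \<le> (\<Sum>t\<in>I. \<Sum>i\<in>J. l2 (err t i))"
      using X finite_subset[OF X1X] by (intro sum_mono sum_le_l2 err_fin) auto
    also have "\<dots> \<le> (\<Sum>t\<in>I. E * 3 ^ s * P)" by (intro sum_mono err_sum)
    finally show ?thesis using \<eta>0 by (simp add: divide_right_mono)
  qed
  have X2: "real (card (X2 q)) \<le> 2 ^ CARD('d) * (card {t \<in> I. qq t = q} * (G * P)) / (\<eta> / 2 ^ Suc s)"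
    if q: "q \<in> {1..2 ^ Suc s}" for q
  proof -
    define Iq where "Iq = {t \<in> I. qq t = q}"
    define h where "h = (\<lambda>y. \<Sum>t\<in>Iq. A t * (cmod (gs t y))\<^sup>2)"
    define Y where "Y = (\<Union>t\<in>Iq. {y. gs t y \<noteq> 0})"
    have Iq: "finite Iq" "Iq \<subseteq> I" using I by (auto simp: Iq_def)
    have Y: "finite Y" using Iq gs_fin by (simp add: Y_def)
    have "real (card (X2 q)) \<le> 2 ^ CARD('d) * (\<Sum>y\<in>Y. h y) / (\<eta> / 2 ^ Suc s)"
    proof (rule weak_type_cubes[where M = "\<lambda>x. 2 ^ j x div q" and q = q])
      show "0 \<le> h y" for y unfolding h_def using A0 by (intro sum_nonneg) auto
      show "{y. h y \<noteq> 0} \<subseteq> Y"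
        by (auto simp: h_def Y_def intro: ccontr sum.neutral)
      fix x assume x: "x \<in> X2 q"
      then have xX: "x \<in> X" by (simp add: X2_def)
      have "1 * Suc s \<le> c0 * Suc s" using c0(2) by (intro mult_right_mono) auto
      then have "(2::nat) ^ Suc s \<le> 2 ^ j x" using X(3)[OF xX] by (intro power_increasing) auto
      then have "q \<le> 2 ^ j x" using q by simp
      moreover have "q \<ge> 1" using q by simp
      ultimately have M1: "1 \<le> 2 ^ j x div q" by (intro div_bounds)
      have "\<eta> / 2 ^ Suc s \<le> (\<Sum>t\<in>Iq. (cmod (main t (j x) x))\<^sup>2)" using x by (simp add: X2_def Iq_def)
      also have "\<dots> \<le> (\<Sum>t\<in>Iq. A t * bavg q (2 ^ j x div q) (\<lambda>y. (cmod (gs t y))\<^sup>2) x)"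
        using main_le xX by (intro sum_mono) (auto simp: Iq_def)
      also have "\<dots> = bavg q (2 ^ j x div q) h x" unfolding h_def by (rule bavg_sum[symmetric])
      finally show "1 \<le> 2 ^ j x div q \<and> \<eta> / 2 ^ Suc s \<le> bavg q (2 ^ j x div q) h x" using M1 by blast
    qed (use X q \<eta>0 Y in \<open>auto simp: X2_def\<close>)
    also have "(\<Sum>y\<in>Y. h y) = (\<Sum>t\<in>Iq. A t * (\<Sum>y\<in>Y. (cmod (gs t y))\<^sup>2))"
      unfolding h_def by (subst sum.swap) (simp add: sum_distrib_left)
    also have "\<dots> \<le> (\<Sum>t\<in>Iq. A t * l2 (gs t))"
      using A0 Y by (intro sum_mono mult_left_mono sum_le_l2 gs_fin) auto
    also have "\<dots> \<le> (\<Sum>t\<in>Iq. G * P)" using Iq by (intro sum_mono gs_l2) auto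
    finally show ?thesis using \<eta>0 by (simp add: Iq_def divide_right_mono mult_left_mono)
  qed
  have "card X \<le> card (X1 \<union> (\<Union>q\<in>{1..2 ^ Suc s}. X2 q))"
    using X by (intro card_mono split finite_UnI finite_UN_I) (auto simp: X1_def X2_def)
  also have "\<dots> \<le> card X1 + (\<Sum>q\<in>{1..2 ^ Suc s}. card (X2 q))"
    by (rule order_trans[OF card_Un_le add_left_mono[OF card_UN_le]]) simp
  finally have "real (card X) \<le> real (card X1) + (\<Sum>q\<in>{1..2 ^ Suc s}. real (card (X2 q)))"
    by (metis of_nat_add of_nat_le_iff of_nat_sum)
  also have "(\<Sum>q\<in>{1..2 ^ Suc s}. real (card (X2 q)))
      \<le> (\<Sum>q\<in>{1..2 ^ Suc s}. 2 ^ CARD('d) * (card {t \<in> I. qq t = q} * (G * P)) / (\<eta> / 2 ^ Suc s))"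
    by (intro sum_mono X2)
  also have "\<dots> = 2 ^ CARD('d) * (real (\<Sum>q\<in>{1..2 ^ Suc s}. card {t \<in> I. qq t = q}) * (G * P)) / (\<eta> / 2 ^ Suc s)"
    by (simp add: sum_distrib_left sum_distrib_right sum_divide_distrib)
  \<comment> \<open>The fibres over \<open>q\<close> partition \<open>I\<close>, so summing over the
    denominators costs nothing beyond the lowered threshold.\<close>
  also have "(\<Sum>q\<in>{1..2 ^ Suc s}. card {t \<in> I. qq t = q}) = card I"
  proof -
    have sub: "qq ` I \<subseteq> {1..2 ^ Suc s}"
    proof (rule image_subsetI)
      fix t assume "t \<in> I"
      from idx(1,2)[OF this] show "qq t \<in> {1..2 ^ Suc s}" by (simp only: atLeastAtMost_iff simp_thms)
    qed
    then show ?thesis using sum.group[OF I(1) _ sub, of "\<lambda>_. 1::nat"] by simp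
  qed
  finally have "real (card X) \<le> real (card I) * (E * 3 ^ s * P) / \<eta> + 2 ^ CARD('d) * (real (card I) * (G * P)) / (\<eta> / 2 ^ Suc s)"
    using X1 by linarith
  also have "\<dots> = real (card I) * (P / \<eta> * (E * 3 ^ s + 2 ^ CARD('d) * G * 2 ^ Suc s))"
    using \<eta>0 by (simp add: field_simps)
  also have "\<dots> \<le> (w * real W) * (P / \<eta> * (E * 3 ^ s + 2 ^ CARD('d) * G * 2 ^ Suc s))"
    using I(2) P0 \<eta>0 E0 G0 by (intro mult_right_mono mult_nonneg_nonneg add_nonneg_nonneg) auto
  also have "\<dots> = 4 * w\<^sup>2 / \<beta>\<^sup>2 * P * (E * 3 ^ s + 2 ^ CARD('d) * G * 2 ^ Suc s)"
    using W0 w0 X(2) by (simp add: \<eta>_def divide_simps power2_eq_square)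
  also have "\<dots> \<le> 4 * w\<^sup>2 / \<beta>\<^sup>2 * P * ((E + 2 ^ Suc CARD('d) * G) * 3 ^ s)"
  proof -
    have "(2::real) ^ s \<le> 3 ^ s" by (intro power_mono) auto
    then have "2 ^ CARD('d) * G * (2 * 2 ^ s) \<le> 2 ^ CARD('d) * G * (2 * 3 ^ s)"
      using G0 by (intro mult_left_mono) auto
    then have "E * 3 ^ s + 2 ^ CARD('d) * G * 2 ^ Suc s \<le> (E + 2 ^ Suc CARD('d) * G) * 3 ^ s"
      by (simp add: algebra_simps)
    then show ?thesis using P0 by (intro mult_left_mono) auto
  qed
  also have "\<dots> = orth_const k C CARD('d) * 48 ^ s * decay \<theta> CARD('d) s / \<beta>\<^sup>2 * l2 f"
  proof -
    define L where "L = E + 2 ^ Suc CARD('d) * G"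
    have "(16::real) ^ s * 3 ^ s = 48 ^ s" by (simp flip: power_mult_distrib)
    moreover have "w\<^sup>2 = 576 * 16 ^ s"
      unfolding w_def power_mult_distrib power2_eq_square by (simp flip: power_mult_distrib)
    then have "4 * w\<^sup>2 / \<beta>\<^sup>2 * P * (L * 3 ^ s) = 2304 * L * (16 ^ s * 3 ^ s) * P / \<beta>\<^sup>2" by simp
    moreover have "orth_const k C CARD('d) = 2304 * L" by (simp add: orth_const_def L_def E_def G_def)
    ultimately show ?thesis unfolding L_def[symmetric] by (simp add: P_def)
  qed
  finally show ?thesis .
qed

text \<open>The grid detects the equation \<open>\<Sum>i. v i ^ k = n\<close> as a congruence modulo
  \<open>P = W * N ^ k\<close>. Since \<open>W\<close> is at least the dimension, both sides lie
  below \<open>P\<close>, so the congruence is an equality.\<close>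

lemma circle_method:
  fixes x :: "int ^ 'd::finite" and F :: "(int ^ 'd) set"
  assumes W: "W \<ge> CARD('d)" and n: "n < W * N ^ k" and N: "N \<ge> 1" and k: "k \<ge> 1"
  shows "real N ^ k / real (N ^ CARD('d)) * real (card {v \<in> nbox N. (\<Sum>i\<in>UNIV. v i ^ k) = n \<and> x - emb 1 v \<in> F})
    \<le> (\<Sum>i<W * N ^ k. cmod (weyl_op k 1 N (real i / (real W * real N ^ k)) (indicator F) x)) / real W"
proof -
  define P where "P = W * N ^ k"
  have W1: "W \<ge> 1" using W by (metis One_nat_def Suc_leI order_trans zero_less_card_finite)
  have P0: "P > 0" using W1 N by (simp add: P_def)
  have PR: "real P = real W * real N ^ k" by (simp add: P_def)
  have detect: "(\<Sum>i<P. e (real_of_int (int m - int n) * real i / real P)) = (if m = n then of_nat P else 0)"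
    if "m < P" for m
  proof -
    have "int P dvd int m - int n \<longleftrightarrow> m = n"
    proof
      assume d: "int P dvd int m - int n"
      show "m = n"
      proof (rule ccontr)
        assume "m \<noteq> n"
        then have "int P \<le> \<bar>int m - int n\<bar>" using d zdvd_imp_le[of "int P" "\<bar>int m - int n\<bar>"] by simp
        then show False using that n unfolding P_def[symmetric] by linarith
      qed
    qed simp
    then show ?thesis using sum_e_roots[OF P0, of "int m - int n"] by simp
  qed
  have small: "(\<Sum>i\<in>UNIV. v i ^ k) < P" if "v \<in> nbox N" for v :: "'d \<Rightarrow> nat"
  proof -
    have "(\<Sum>i\<in>UNIV. v i ^ k) < (\<Sum>i\<in>(UNIV :: 'd set). N ^ k)"
      using that k by (intro sum_strict_mono power_strict_mono) (auto simp: nbox_def)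
    also have "\<dots> \<le> P" using W by (simp add: P_def)
    finally show ?thesis .
  qed
  let ?S = "\<lambda>v :: 'd \<Rightarrow> nat. \<Sum>i\<in>UNIV. v i ^ k"
  have T: "weyl_op k 1 N (real i / real P) (indicator F) x
      = (\<Sum>v\<in>nbox N. e (real i / real P * real (?S v)) * indicator F (x - emb 1 v)) / of_nat (N ^ CARD('d))" for i
    by (simp add: weyl_op_def bconv_def sum_distrib_left flip: e_sum)
  have "(\<Sum>i<P. e (- (real n * real i / real P)) * weyl_op k 1 N (real i / real P) (indicator F) x)
      = (\<Sum>i<P. \<Sum>v\<in>nbox N. e (real_of_int (int (?S v) - int n) * real i / real P) * indicator F (x - emb 1 v)) / of_nat (N ^ CARD('d))"
  proof -
    have "e (- (real n * real i / real P)) * e (real i / real P * real m) = e (real_of_int (int m - int n) * real i / real P)" for i m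
      unfolding e_add[symmetric] by (simp add: field_simps diff_divide_distrib)
    then show ?thesis
      unfolding T times_divide_eq_right sum_divide_distrib[symmetric] sum_distrib_left mult.assoc[symmetric]
      by (simp only:)
  qed
  also have "\<dots> = (\<Sum>v\<in>nbox N. (\<Sum>i<P. e (real_of_int (int (?S v) - int n) * real i / real P)) * indicator F (x - emb 1 v)) / of_nat (N ^ CARD('d))"
    by (subst sum.swap) (simp add: sum_distrib_right)
  also have "\<dots> = (\<Sum>v\<in>nbox N. (if ?S v = n then of_nat P else 0) * indicator F (x - emb 1 v)) / of_nat (N ^ CARD('d))"
    using detect[OF small] by simp
  also have "(\<Sum>v\<in>nbox N. (if ?S v = n then of_nat P else 0) * indicator F (x - emb 1 v))
      = (\<Sum>v\<in>{v \<in> nbox N. ?S v = n \<and> x - emb 1 v \<in> F}. complex_of_nat P)"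
    by (intro sum.mono_neutral_cong_right) (auto simp: indicator_def)
  finally have eq: "(\<Sum>i<P. e (- (real n * real i / real P)) * weyl_op k 1 N (real i / real P) (indicator F) x)
      = of_nat (card {v \<in> nbox N. ?S v = n \<and> x - emb 1 v \<in> F}) * of_nat P / of_nat (N ^ CARD('d))"
    by simp
  have "real (card {v \<in> nbox N. ?S v = n \<and> x - emb 1 v \<in> F}) * real P / real (N ^ CARD('d))
      = cmod (\<Sum>i<P. e (- (real n * real i / real P)) * weyl_op k 1 N (real i / real P) (indicator F) x)"
    unfolding eq by (simp add: norm_divide norm_mult norm_power)
  also have "\<dots> \<le> (\<Sum>i<P. cmod (weyl_op k 1 N (real i / real P) (indicator F) x))"
    by (intro sum_norm_le) (simp add: norm_mult)
  finally show ?thesis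
    using W1 unfolding P_def[symmetric] PR[symmetric] by (simp add: le_divide_eq PR mult_ac)
qed

section \<open>Summation over the levels\<close>

text \<open>The arcs are nested, so the levels telescope. In the application \<open>m = j\<close>:
  at scale \<open>N = 2 ^ j\<close> the term \<open>1 / N\<close> of the Weyl bound allows no gain
  beyond level \<open>j\<close>.\<close>

lemma sum_arcs_levels:
  fixes h :: "nat \<Rightarrow> real"
  assumes "\<sigma> \<le> j"
  shows "(\<Sum>i<W * 2 ^ (m * k). h i) = (\<Sum>i\<in>arcs k W m \<sigma>. h i)
    + (\<Sum>s\<in>{\<sigma>..<j}. \<Sum>i\<in>arcs k W m (Suc s) - arcs k W m s. h i) + (\<Sum>i\<in>{..<W * 2 ^ (m * k)} - arcs k W m j. h i)"
proof -
  have "(\<Sum>i\<in>arcs k W m j. h i) = (\<Sum>i\<in>arcs k W m \<sigma>. h i)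
    + (\<Sum>s\<in>{\<sigma>..<j}. \<Sum>i\<in>arcs k W m (Suc s) - arcs k W m s. h i)"
    using assms
  proof (induction rule: dec_induct)
    case (step n)
    have "(\<Sum>i\<in>arcs k W m (Suc n). h i) = (\<Sum>i\<in>arcs k W m (Suc n) - arcs k W m n. h i) + (\<Sum>i\<in>arcs k W m n. h i)"
      by (intro sum.subset_diff arcs_mono) auto
    then show ?case using step by (simp add: add_ac)
  qed simp
  moreover have "(\<Sum>i<W * 2 ^ (m * k). h i) = (\<Sum>i\<in>{..<W * 2 ^ (m * k)} - arcs k W m j. h i) + (\<Sum>i\<in>arcs k W m j. h i)"
    by (intro sum.subset_diff) (auto simp: arcs_def)
  ultimately show ?thesis by simp
qed

lemma sum_geometric_tail:
  fixes \<rho> :: real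
  assumes "finite S" "\<And>s. s \<in> S \<Longrightarrow> \<sigma> \<le> s" "0 \<le> \<rho>" "\<rho> < 1"
  shows "(\<Sum>s\<in>S. \<rho> ^ s) \<le> \<rho> ^ \<sigma> / (1 - \<rho>)"
proof -
  obtain n where n: "S \<subseteq> {..<n}" using assms(1) finite_nat_iff_bounded by auto
  have "S \<subseteq> {\<sigma>..<\<sigma> + n}" using n assms(2) by fastforce
  then have "(\<Sum>s\<in>S. \<rho> ^ s) \<le> (\<Sum>s\<in>{\<sigma>..<\<sigma> + n}. \<rho> ^ s)"
    using assms by (intro sum_mono2) auto
  also have "\<dots> = (\<Sum>s<n. \<rho> ^ (s + \<sigma>))"
    using sum.shift_bounds_nat_ivl[of "\<lambda>s. \<rho> ^ s" 0 \<sigma> n] by (simp add: atLeast0LessThan add.commute)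
  also have "\<dots> = \<rho> ^ \<sigma> * (\<Sum>s<n. \<rho> ^ s)"
    by (simp add: power_add sum_distrib_left mult.commute)
  also have "(\<Sum>s<n. \<rho> ^ s) = (1 - \<rho> ^ n) / (1 - \<rho>)"
    using assms by (simp add: sum_gp_strict)
  also have "\<rho> ^ \<sigma> * ((1 - \<rho> ^ n) / (1 - \<rho>)) \<le> \<rho> ^ \<sigma> * (1 / (1 - \<rho>))"
    using assms by (intro mult_left_mono divide_right_mono) auto
  finally show ?thesis by simp
qed

text \<open>Up to normalisation, the spherical average of the indicator of \<open>F\<close>
  restricted to the points of one orthant.\<close>

definition rep_count :: "nat \<Rightarrow> nat \<Rightarrow> nat \<Rightarrow> (int ^ 'd::finite) set \<Rightarrow> int ^ 'd \<Rightarrow> nat" where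
  "rep_count k N n F x = card {v \<in> nbox N. (\<Sum>i\<in>UNIV. v i ^ k) = n \<and> x - emb 1 v \<in> F}"

definition small_const :: "real \<Rightarrow> nat \<Rightarrow> real" where
  "small_const C D = (3 * C) ^ (2 * D)"

lemma small_powr:
  fixes \<theta> :: real
  shows "(3 * C * (2 ^ s) powr (- \<theta>)) ^ (2 * D) = small_const C D * decay \<theta> D s"
  unfolding power_mult_distrib small_const_def power_powr_eq by simp

text \<open>The dimension is a number \<open>D\<close> here, so that the constants do not mention a
  type. The exponent \<open>c0\<close> separates the scales treated one by one from those treated
  together.\<close>

locale weyl_setting =
  fixes k :: nat and \<theta> C :: real and D c0 :: nat
  assumes C: "weyl_bound k \<theta> C" and \<theta>: "0 < \<theta>" "\<theta> \<le> 1 / 2" and k: "k \<ge> 3"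
    and D: "real k < \<theta> * real D" and c0: "\<theta> * real D + 1 \<le> real c0" "c0 \<ge> 3"
begin

text \<open>\<open>\<rho> ^ m\<close> is the squared size \<open>4 ^ (k * m)\<close> of the whole
  circle at scale \<open>2 ^ m\<close>, times the decay on level \<open>m\<close>.\<close>

definition "\<rho> = 4 powr (real k - \<theta> * real D)"

lemma \<rho>: "0 < \<rho>" "\<rho> < 1"
  using D by (auto simp: \<rho>_def powr_less_one)

lemma \<rho>_power: "\<rho> ^ s = 4 powr ((real k - \<theta> * real D) * real s)"
  by (simp add: \<rho>_def powr_power mult.commute)

text \<open>The place where \<open>k \<ge> 3\<close> is decisive: \<open>64 = 4 ^ 3\<close> is the
  total loss per level.\<close>

lemma level_power: "64 ^ s * decay \<theta> D s \<le> \<rho> ^ s"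
proof -
  have "(64::real) ^ s = 4 powr (3 * real s)"
  proof -
    have "(64::real) ^ s = (4 ^ 3) ^ s" by simp
    also have "\<dots> = 4 ^ (3 * s)" by (simp only: power_mult)
    also have "\<dots> = 4 powr (real (3 * s))" by (simp only: powr_realpow zero_less_numeral)
    finally show ?thesis by simp
  qed
  then have "64 ^ s * decay \<theta> D s = 4 powr ((3 - \<theta> * real D) * real s)"
    by (simp add: algebra_simps flip: powr_add)
  also have "\<dots> \<le> \<rho> ^ s"
    unfolding \<rho>_power using k by (intro powr_mono mult_right_mono) auto
  finally show ?thesis .
qed

definition "level_const = real c0 * 576 * small_const C D + orth_const k C D"

text \<open>\<open>19 = 1 + 18\<close> collects the small scales and the arcs up to level
  \<open>\<sigma>\<close>; the quotient by \<open>1 - \<rho>\<close> comes from geometric series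
  over scales and levels.\<close>

definition "scale_const = 19 * 2 ^ D + (9 * small_const C D + 900 * level_const) / (1 - \<rho>)"

lemma small_const_nonneg: "0 \<le> small_const C D"
  by (simp add: small_const_def power_mult)

lemma level_const_nonneg: "0 \<le> level_const"
  by (auto simp: level_const_def orth_const_def small_const_nonneg error_const_nonneg main_const_nonneg)

lemma scale_const_nonneg: "0 \<le> scale_const"
  using small_const_nonneg level_const_nonneg \<rho> unfolding scale_const_def
  by (intro add_nonneg_nonneg divide_nonneg_nonneg) auto

text \<open>The share of the height given to level \<open>s\<close> may decay slowly: the square of
  \<open>10 / 9\<close> is at most \<open>4 / 3\<close>, and \<open>48 * (4 / 3) = 64\<close> is
  still admissible.\<close>

lemma level_beta:
  fixes \<alpha> :: real
  assumes "\<sigma> \<le> s" "\<alpha> > 0"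
  defines "\<beta> \<equiv> \<alpha> / 30 * (9 / 10) ^ (s - \<sigma>)"
  shows "level_const * 48 ^ s * decay \<theta> D s / \<beta>\<^sup>2 \<le> 900 * level_const / \<alpha>\<^sup>2 * \<rho> ^ s"
proof -
  have "1 / \<beta>\<^sup>2 = 900 / \<alpha>\<^sup>2 * (100 / 81) ^ (s - \<sigma>)"
  proof -
    have *: "((9 / 10 :: real) ^ (s - \<sigma>))\<^sup>2 = (81 / 100) ^ (s - \<sigma>)"
      unfolding power2_eq_square power_mult_distrib[symmetric] by simp
    have "\<beta>\<^sup>2 = \<alpha>\<^sup>2 / 900 * (81 / 100) ^ (s - \<sigma>)"
      unfolding \<beta>_def power_mult_distrib * by (simp add: power2_eq_square)
    then show ?thesis using assms by (simp add: power_divide)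
  qed
  also have "\<dots> \<le> 900 / \<alpha>\<^sup>2 * (4 / 3) ^ s"
  proof (intro mult_left_mono)
    have "(100 / 81 :: real) ^ (s - \<sigma>) \<le> (4 / 3) ^ (s - \<sigma>)" by (intro power_mono) auto
    also have "\<dots> \<le> (4 / 3) ^ s" by (intro power_increasing) auto
    finally show "(100 / 81 :: real) ^ (s - \<sigma>) \<le> (4 / 3) ^ s" .
  qed auto
  finally have *: "1 / \<beta>\<^sup>2 \<le> 900 / \<alpha>\<^sup>2 * (4 / 3) ^ s" .
  have "level_const * 48 ^ s * decay \<theta> D s * (1 / \<beta>\<^sup>2)
      \<le> level_const * 48 ^ s * decay \<theta> D s * (900 / \<alpha>\<^sup>2 * (4 / 3) ^ s)"
    using * level_const_nonneg by (intro mult_left_mono) auto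
  also have "\<dots> = 900 * level_const / \<alpha>\<^sup>2 * ((48 ^ s * (4 / 3) ^ s) * decay \<theta> D s)"
    by simp
  also have "(48::real) ^ s * (4 / 3) ^ s = 64 ^ s"
    by (simp flip: power_mult_distrib)
  also have "900 * level_const / \<alpha>\<^sup>2 * (64 ^ s * decay \<theta> D s) \<le> 900 * level_const / \<alpha>\<^sup>2 * \<rho> ^ s"
    using level_const_nonneg by (intro mult_left_mono level_power) auto
  finally show ?thesis by simp
qed

text \<open>Each point falls into one of five sets: \<open>X1\<close> for small scales,
  \<open>X2\<close> for the arcs up to level \<open>\<sigma>\<close>, \<open>X3\<close> for the
  minor arcs of its own scale, and \<open>X4\<close> or \<open>X5\<close> for a level
  \<open>s\<close> seen at a scale below \<open>c0 * Suc s\<close> or not. The first two give the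
  term in \<open>1 / \<alpha>\<close>, the others that in \<open>1 / \<alpha> ^ 2\<close>.\<close>

theorem scale_estimate:
  fixes F :: "(int ^ 'd::finite) set" and X :: "(int ^ 'd) set" and j n :: "int ^ 'd \<Rightarrow> nat"
  assumes DD: "CARD('d) = D" and F: "finite F" and \<alpha>: "\<alpha> > 0" and X: "finite X"
    and j: "\<And>x. x \<in> X \<Longrightarrow> j x \<ge> 1" and n: "\<And>x. x \<in> X \<Longrightarrow> n x < 2 ^ (j x * k)"
    and big: "\<And>x. x \<in> X \<Longrightarrow> \<alpha> \<le> (2 ^ j x) ^ k / (2 ^ j x) ^ D * real (rep_count k (2 ^ j x) (n x) F x)"
  shows "real (card X) \<le> scale_const * (2 ^ (\<sigma> * k) / \<alpha> + \<rho> ^ \<sigma> / \<alpha>\<^sup>2) * real (card F)"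
proof -
  define f :: "int ^ 'd \<Rightarrow> complex" where "f = indicator F"
  define J where "J = (\<Sum>x\<in>X. j x)"
  have jJ: "j x \<le> J" if "x \<in> X" for x unfolding J_def using X that by (intro member_le_sum) auto
  \<comment> \<open>The first factor serves \<open>circle_method\<close>; the factorial is divisible
    by every denominator up to \<open>2 ^ J\<close>, hence by all that occur at the scales present
    in \<open>X\<close>.\<close>
  define W where "W = CARD('d) * fact (2 ^ J)"
  have WD: "CARD('d) \<le> W" by (simp add: W_def)
  have W1: "W \<ge> 1" by (simp add: W_def Suc_le_eq)
  have dvdW: "q dvd int W" if "1 \<le> q" "q \<le> 2 ^ J" for q :: int
  proof -
    have "nat q \<le> 2 ^ J" using that(2) by (simp add: nat_le_iff)
    then have "nat q dvd fact (2 ^ J)" using that by (intro dvd_fact) auto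
    then have "int (nat q) dvd int (fact (2 ^ J))" by (simp only: int_dvd_int_iff)
    then show ?thesis using that by (simp add: W_def)
  qed
  have supp: "{x. f x \<noteq> 0} = F" by (auto simp: f_def indicator_def)
  have f: "finsupp f" using F supp by simp
  have l2f: "l2 f = real (card F)"
    unfolding l2_def supp by (simp add: f_def)
  have norm_f: "cmod (f y) = indicator F y" for y by (simp add: f_def indicator_def)
  have sum_f: "(\<Sum>y\<in>F. cmod (f y)) = real (card F)" by (simp add: norm_f)
  define h where "h = (\<lambda>x (z::int). cmod (weyl_op k 1 (2 ^ j x) (of_int z / (real W * 2 ^ (j x * k))) f x))"
  have h0: "0 \<le> h x z" for x z by (simp add: h_def)
  define \<beta> where "\<beta> = (\<lambda>s. \<alpha> / 30 * (9 / 10) ^ (s - \<sigma>))"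
  have \<beta>0: "\<beta> s > 0" for s using \<alpha> by (simp add: \<beta>_def)
  define S1 where "S1 = (\<lambda>x. (\<Sum>i\<in>arcs k W (j x) \<sigma>. h x (int i)) / real W)"
  define S where "S = (\<lambda>x s. (\<Sum>i\<in>arcs k W (j x) (Suc s) - arcs k W (j x) s. h x (int i)) / real W)"
  define S2 where "S2 = (\<lambda>x. (\<Sum>i\<in>{..<W * 2 ^ (j x * k)} - arcs k W (j x) (j x). h x (int i)) / real W)"
  define X1 where "X1 = {x \<in> X. j x \<le> \<sigma>}"
  define X2 where "X2 = {x \<in> X. \<sigma> < j x \<and> \<alpha> / 3 \<le> S1 x}"
  define X3 where "X3 = (\<lambda>m. {x \<in> X. j x = m \<and> \<alpha> / 3 \<le> S2 x})"
  define X4 where "X4 = (\<lambda>s m. {x \<in> X. s < m \<and> j x = m \<and> \<beta> s \<le> S x s})"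
  define X5 where "X5 = (\<lambda>s. {x \<in> X. s < j x \<and> c0 * Suc s \<le> j x \<and> \<beta> s \<le> S x s})"
  have cover: "X \<subseteq> X1 \<union> X2 \<union> (\<Union>m\<in>{\<sigma>..J}. X3 m) \<union> (\<Union>s\<in>{\<sigma>..<J}. (\<Union>m\<in>{..<c0 * Suc s}. X4 s m) \<union> X5 s)"
  proof
    fix x assume x: "x \<in> X"
    have jk: "(2 ^ j x) ^ k = (2::nat) ^ (j x * k)" "(2 ^ j x) ^ k = (2::real) ^ (j x * k)"
      by (simp_all add: power_mult)
    have nW: "n x < W * 2 ^ (j x * k)"
    proof -
      have "2 ^ (j x * k) \<le> W * 2 ^ (j x * k)"
        using mult_right_mono[OF W1, of "2 ^ (j x * k)"] by (simp only: mult_1_left)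
      with n[OF x] show ?thesis by (rule order.strict_trans2)
    qed
    show "x \<in> X1 \<union> X2 \<union> (\<Union>m\<in>{\<sigma>..J}. X3 m) \<union> (\<Union>s\<in>{\<sigma>..<J}. (\<Union>m\<in>{..<c0 * Suc s}. X4 s m) \<union> X5 s)"
    proof (cases "j x \<le> \<sigma>")
      case True
      then show ?thesis using x by (simp add: X1_def)
    next
      case False
      have "\<alpha> \<le> (\<Sum>i<W * 2 ^ (j x * k). h x (int i)) / real W"
      proof -
        have "\<alpha> \<le> real (2 ^ j x) ^ k / real ((2 ^ j x) ^ CARD('d)) * real (rep_count k (2 ^ j x) (n x) F x)"
          using big[OF x] DD by simp
        also have "\<dots> \<le> (\<Sum>i<W * (2 ^ j x) ^ k. cmod (weyl_op k 1 (2 ^ j x) (real i / (real W * real (2 ^ j x) ^ k)) (indicator F) x)) / real W"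
          unfolding rep_count_def using WD nW k by (intro circle_method) (auto simp: jk)
        finally show ?thesis by (simp add: h_def f_def jk)
      qed
      also have "\<dots> = S1 x + (\<Sum>s\<in>{\<sigma>..<j x}. S x s) + S2 x"
        using False by (subst sum_arcs_levels[of \<sigma> "j x"])
          (auto simp: S1_def S_def S2_def add_divide_distrib sum_divide_distrib)
      finally have tot: "\<alpha> \<le> S1 x + (\<Sum>s\<in>{\<sigma>..<j x}. S x s) + S2 x" .
      \<comment> \<open>The heights \<open>\<beta> s\<close> add up to at most
        \<open>10 * \<alpha> / 30\<close>, the remaining third.\<close>
      consider "\<alpha> / 3 \<le> S1 x" | "\<alpha> / 3 \<le> S2 x" | s where "\<sigma> \<le> s" "s < j x" "\<beta> s \<le> S x s"
      proof (rule ccontr)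
        assume not: "\<not> thesis"
        then have 1: "S1 x < \<alpha> / 3" and 2: "S2 x < \<alpha> / 3" and 3: "\<And>s. \<sigma> \<le> s \<Longrightarrow> s < j x \<Longrightarrow> S x s < \<beta> s"
          using that by (meson not_le)+
        have "(\<Sum>s\<in>{\<sigma>..<j x}. S x s) \<le> (\<Sum>s\<in>{\<sigma>..<j x}. \<beta> s)"
          using 3 by (intro sum_mono) (auto simp: less_imp_le)
        also have "\<dots> = \<alpha> / 30 * (\<Sum>s\<in>{\<sigma>..<j x}. (9 / 10) ^ (s - \<sigma>))"
          by (simp add: \<beta>_def sum_distrib_left)
        also have "(\<Sum>s\<in>{\<sigma>..<j x}. (9 / 10 :: real) ^ (s - \<sigma>)) = (\<Sum>s<j x - \<sigma>. (9 / 10) ^ s)"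
          using sum.shift_bounds_nat_ivl[of "\<lambda>s. (9 / 10 :: real) ^ (s - \<sigma>)" 0 \<sigma> "j x - \<sigma>"] False
          by (simp add: atLeast0LessThan)
        also have "\<dots> \<le> 10"
          using sum_geometric_tail[of "{..<j x - \<sigma>}" 0 "9 / 10"] by simp
        finally have "(\<Sum>s\<in>{\<sigma>..<j x}. S x s) \<le> \<alpha> / 3" using \<alpha> by simp
        then show False using tot 1 2 by linarith
      qed
      then show ?thesis
      proof cases
        case 1
        then show ?thesis using False x by (simp add: X2_def)
      next
        case 2
        then show ?thesis using False x jJ[OF x] by (auto simp: X3_def)
      next
        case (3 s)
        then show ?thesis using x jJ[OF x] by (cases "j x < c0 * Suc s") (auto simp: X4_def X5_def)
      qed
    qed
  qed
  \<comment> \<open>Dropping the equation from the count leaves \<open>2 ^ (j x * k)\<close> times a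
    cube average.\<close>
  have b1: "real (card X1) \<le> 2 ^ D * real (card F) * (2 ^ (\<sigma> * k) / \<alpha>)"
  proof -
    have "real (card X1) \<le> 2 ^ CARD('d) * (\<Sum>y\<in>F. cmod (f y)) / (\<alpha> / 2 ^ (\<sigma> * k))"
    proof (rule weak_type_cubes[where M = "\<lambda>x. 2 ^ j x" and q = 1])
      fix x assume "x \<in> X1"
      then have x: "x \<in> X" "j x \<le> \<sigma>" by (auto simp: X1_def)
      have "real (rep_count k (2 ^ j x) (n x) F x) \<le> (\<Sum>v\<in>nbox (2 ^ j x). cmod (f (x - emb 1 v)))"
      proof -
        have "rep_count k (2 ^ j x) (n x) F x \<le> card {v \<in> nbox (2 ^ j x). x - emb 1 v \<in> F}"
          unfolding rep_count_def by (intro card_mono) auto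
        moreover have "(\<Sum>v\<in>nbox (2 ^ j x). cmod (f (x - emb 1 v))) = (\<Sum>v\<in>{v \<in> nbox (2 ^ j x). x - emb 1 v \<in> F}. 1)"
          by (intro sum.mono_neutral_cong_right) (auto simp: norm_f indicator_def)
        ultimately show ?thesis by simp
      qed
      then have "(2 ^ j x) ^ k / (2 ^ j x) ^ D * real (rep_count k (2 ^ j x) (n x) F x)
          \<le> (2 ^ j x) ^ k / (2 ^ j x) ^ D * (\<Sum>v\<in>nbox (2 ^ j x). cmod (f (x - emb 1 v)))"
        by (intro mult_left_mono) auto
      also have "\<dots> = 2 ^ (j x * k) * bavg 1 (2 ^ j x) (\<lambda>y. cmod (f y)) x"
        by (simp add: bavg_def DD power_mult)
      also have "\<dots> \<le> 2 ^ (\<sigma> * k) * bavg 1 (2 ^ j x) (\<lambda>y. cmod (f y)) x"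
        using x(2) by (intro mult_right_mono power_increasing bavg_nonneg) auto
      finally have "\<alpha> \<le> 2 ^ (\<sigma> * k) * bavg 1 (2 ^ j x) (\<lambda>y. cmod (f y)) x"
        by (rule order_trans[OF big[OF x(1)]])
      then have "\<alpha> / 2 ^ (\<sigma> * k) \<le> bavg 1 (2 ^ j x) (\<lambda>y. cmod (f y)) x"
        by (simp add: divide_le_eq mult.commute)
      then show "1 \<le> (2::nat) ^ j x \<and> \<alpha> / 2 ^ (\<sigma> * k) \<le> bavg 1 (2 ^ j x) (\<lambda>y. cmod (f y)) x" by simp
    qed (use X F \<alpha> supp in \<open>auto simp: X1_def\<close>)
    then show ?thesis by (simp add: sum_f DD)
  qed
  have sj: "s < j x * k" if "s \<le> j x" "x \<in> X" for s x
  proof -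
    have "j x * 2 \<le> j x * k" using k by (intro mult_left_mono) auto
    then show ?thesis using that j[OF that(2)] by linarith
  qed
  have dvdj: "q dvd int W" if "1 \<le> q" "q \<le> 2 ^ s" "s \<le> j x" "x \<in> X" for q s x
  proof -
    have "(2::int) ^ s \<le> 2 ^ J" using that(3) jJ[OF that(4)] by (intro power_increasing) auto
    then show ?thesis by (intro dvdW that(1) order_trans[OF that(2)])
  qed
  \<comment> \<open>Every operator is bounded by the same cube average, so only the number of grid
    points on the arcs matters; \<open>18 = 3 * 6\<close>.\<close>
  have b2: "real (card X2) \<le> 18 * 2 ^ D * real (card F) * (2 ^ (\<sigma> * k) / \<alpha>)"
  proof -
    have "real (card X2) \<le> 2 ^ CARD('d) * (\<Sum>y\<in>F. cmod (f y)) / (\<alpha> / (18 * 4 ^ \<sigma>))"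
    proof (rule weak_type_cubes[where M = "\<lambda>x. 2 ^ j x" and q = 1])
      fix x assume "x \<in> X2"
      then have x: "x \<in> X" "\<sigma> < j x" "\<alpha> / 3 \<le> S1 x" by (auto simp: X2_def)
      let ?b = "bavg 1 (2 ^ j x) (\<lambda>y. cmod (f y)) x"
      have b0: "0 \<le> ?b" by (intro bavg_nonneg) auto
      have "(\<Sum>i\<in>arcs k W (j x) \<sigma>. h x (int i)) \<le> (\<Sum>i\<in>arcs k W (j x) \<sigma>. ?b)"
        unfolding h_def by (intro sum_mono norm_weyl_op_le_bavg)
      also have "\<dots> = real (card (arcs k W (j x) \<sigma>)) * ?b" by simp
      also have "\<dots> \<le> (6 * 4 ^ \<sigma> * real W) * ?b"
        using x by (intro mult_right_mono card_arcs W1 sj b0) (auto intro: dvdj[of _ \<sigma> x])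
      finally have "S1 x \<le> 6 * 4 ^ \<sigma> * ?b"
        using W1 by (simp add: S1_def divide_le_eq mult_ac)
      then have "\<alpha> / (18 * 4 ^ \<sigma>) \<le> ?b" using x(3) by (simp add: divide_le_eq mult_ac)
      then show "1 \<le> (2::nat) ^ j x \<and> \<alpha> / (18 * 4 ^ \<sigma>) \<le> ?b" by simp
    qed (use X F \<alpha> supp in \<open>auto simp: X2_def\<close>)
    also have "\<dots> = 18 * 2 ^ D * real (card F) * (4 ^ \<sigma> / \<alpha>)" by (simp add: sum_f DD)
    also have "\<dots> \<le> 18 * 2 ^ D * real (card F) * (2 ^ (\<sigma> * k) / \<alpha>)"
    proof -
      have "(4::real) ^ \<sigma> = 2 ^ (2 * \<sigma>)" by (simp add: power_mult)
      also have "\<dots> \<le> 2 ^ (\<sigma> * k)" using k by (intro power_increasing) auto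
      finally show ?thesis using \<alpha> by (intro mult_left_mono divide_right_mono) auto
    qed
    finally show ?thesis .
  qed
  \<comment> \<open>The minor arcs are bounded by the full circle of \<open>W * 2 ^ (m * k)\<close>
    grid points, hence \<open>w = 2 ^ (m * k)\<close>.\<close>
  have b3: "real (card (X3 m)) \<le> 9 * small_const C D / \<alpha>\<^sup>2 * real (card F) * \<rho> ^ m" for m
  proof -
    have "real (card (X3 m)) \<le> (2 ^ (m * k))\<^sup>2 * (3 * C * (2 ^ m) powr (- \<theta>)) ^ (2 * CARD('d)) / (\<alpha> / 3)\<^sup>2 * l2 f"
    proof (rule level_single_scale[where I = "{..<W * 2 ^ (m * k)} - arcs k W m m"
          and t = "\<lambda>i. real i / (real W * 2 ^ (m * k))" and N = "2 ^ m" and W = W and k = k])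
      have "card ({..<W * 2 ^ (m * k)} - arcs k W m m) \<le> card {..<W * 2 ^ (m * k)}"
        by (intro card_mono) auto
      then have "real (card ({..<W * 2 ^ (m * k)} - arcs k W m m)) \<le> real (W * 2 ^ (m * k))"
        by (simp only: of_nat_le_iff card_lessThan)
      then show "real (card ({..<W * 2 ^ (m * k)} - arcs k W m m)) \<le> 2 ^ (m * k) * real W" by (simp add: mult.commute)
      show "cmod (wsum k (2 ^ m) (real i / (real W * 2 ^ (m * k))) \<xi>) \<le> 3 * C * (2 ^ m) powr (- \<theta>)"
        if "i \<in> {..<W * 2 ^ (m * k)} - arcs k W m m" for i \<xi>
        using that \<theta> k by (intro minor_arc_bound[OF C _ _ _ W1]) auto
      show "\<alpha> / 3 \<le> (\<Sum>i\<in>{..<W * 2 ^ (m * k)} - arcs k W m m. cmod (weyl_op k 1 (2 ^ m) (real i / (real W * 2 ^ (m * k))) f x)) / real W"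
        if "x \<in> X3 m" for x
        using that by (auto simp: X3_def S2_def h_def)
    qed (use X \<alpha> f W1 in \<open>auto simp: X3_def\<close>)
    also have "\<dots> = 9 * small_const C D / \<alpha>\<^sup>2 * real (card F) * ((2 ^ (m * k))\<^sup>2 * decay \<theta> D m)"
      by (simp add: DD small_powr l2f power_divide)
    also have "((2::real) ^ (m * k))\<^sup>2 * decay \<theta> D m = \<rho> ^ m"
    proof -
      have "((2::real) ^ (m * k))\<^sup>2 = (2\<^sup>2) ^ (m * k)" by (metis power_mult mult.commute)
      also have "\<dots> = 4 powr (real (m * k))" by (simp add: powr_realpow del: of_nat_mult)
      finally show ?thesis unfolding \<rho>_power by (simp add: algebra_simps flip: powr_add)
    qed
    finally show ?thesis .
  qed
  have b4: "real (card (X4 s m)) \<le> 576 * small_const C D * 16 ^ s * decay \<theta> D s / (\<beta> s)\<^sup>2 * real (card F)"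
    for s m
  \<comment> \<open>A point of \<open>X4 s m\<close> provides \<open>s < m \<le> J\<close>, which
    the divisibility of \<open>W\<close> and the arc count require.\<close>
  proof (cases "X4 s m = {}")
    case False
    then obtain x0 where x0: "x0 \<in> X" "j x0 = m" "s < m" by (auto simp: X4_def)
    have "real (card (X4 s m)) \<le> (24 * 4 ^ s)\<^sup>2 * (3 * C * (2 ^ s) powr (- \<theta>)) ^ (2 * CARD('d)) / (\<beta> s)\<^sup>2 * l2 f"
    proof (rule level_single_scale[where I = "arcs k W m (Suc s) - arcs k W m s"
          and t = "\<lambda>i. real i / (real W * 2 ^ (m * k))" and N = "2 ^ m" and W = W and k = k])
      have "real (card (arcs k W m (Suc s))) \<le> 6 * 4 ^ Suc s * real W"
        using x0 sj[of "Suc s" x0] by (intro card_arcs W1) (auto intro: dvdj[of _ "Suc s" x0])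
      moreover have "card (arcs k W m (Suc s) - arcs k W m s) \<le> card (arcs k W m (Suc s))"
        by (intro card_mono) auto
      ultimately show "real (card (arcs k W m (Suc s) - arcs k W m s)) \<le> 24 * 4 ^ s * real W" by simp
      show "cmod (wsum k (2 ^ m) (real i / (real W * 2 ^ (m * k))) \<xi>) \<le> 3 * C * (2 ^ s) powr (- \<theta>)"
        if "i \<in> arcs k W m (Suc s) - arcs k W m s" for i \<xi>
        using that \<theta> k x0 by (intro minor_arc_bound[OF C _ _ _ W1]) (auto simp: arcs_def)
      show "\<beta> s \<le> (\<Sum>i\<in>arcs k W m (Suc s) - arcs k W m s. cmod (weyl_op k 1 (2 ^ m) (real i / (real W * 2 ^ (m * k))) f x)) / real W"
        if "x \<in> X4 s m" for x
        using that by (auto simp: X4_def S_def h_def)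
    qed (use X \<beta>0 f W1 in \<open>auto simp: X4_def\<close>)
    also have "\<dots> = 576 * small_const C D * 16 ^ s * decay \<theta> D s / (\<beta> s)\<^sup>2 * real (card F)"
      by (simp add: DD small_powr l2f power_mult_distrib power2_eq_square flip: power_mult_distrib)
    finally show ?thesis .
  qed (simp add: small_const_nonneg)
  have b5: "real (card (X5 s)) \<le> orth_const k C D * 48 ^ s * decay \<theta> D s / (\<beta> s)\<^sup>2 * real (card F)" for s
  proof (cases "X5 s = {}")
    case False
    then obtain x0 where x0: "x0 \<in> X" "s < j x0" by (auto simp: X5_def)
    have "real (card (X5 s)) \<le> orth_const k C CARD('d) * 48 ^ s * decay \<theta> CARD('d) s / (\<beta> s)\<^sup>2 * l2 f"
    proof (rule level_all_scales[where W = W and j = j, OF C \<theta> _ c0[folded DD] f])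
      show "q dvd int W" if "1 \<le> q" "q \<le> 2 ^ Suc s" for q
        using x0 by (intro dvdj[OF that, of x0]) auto
      fix x assume x: "x \<in> X5 s"
      then have xX: "x \<in> X" and s: "Suc s \<le> j x" and b: "\<beta> s \<le> S x s" by (auto simp: X5_def)
      show "c0 * Suc s \<le> j x" using x by (auto simp: X5_def)
      let ?A = "arcs k W (j x) (Suc s) - arcs k W (j x) s"
      have sub: "int ` ?A \<subseteq> arc_point k W (j x) ` outer_index W s"
        using sj[OF s xX] s xX by (intro outer_arcs_subset_image W1) (auto intro: dvdj[of _ "Suc s" x])
      note fin = outer_index_bound(1)[OF W1, of s]
      have "(\<Sum>i\<in>?A. h x (int i)) = (\<Sum>z\<in>int ` ?A. h x z)"
        by (subst sum.reindex) auto
      also have "\<dots> \<le> (\<Sum>z\<in>arc_point k W (j x) ` outer_index W s. h x z)"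
        using sub fin h0 by (intro sum_mono2) auto
      \<comment> \<open>Several triples may encode the same grid point; as the summands are
        nonnegative, counting it repeatedly does no harm.\<close>
      also have "\<dots> \<le> (\<Sum>\<iota>\<in>outer_index W s. h x (arc_point k W (j x) \<iota>))"
        using sum_image_le[OF fin, of "h x" "arc_point k W (j x)"] h0 by (simp add: o_def)
      finally have "S x s \<le> (\<Sum>\<iota>\<in>outer_index W s. h x (arc_point k W (j x) \<iota>)) / real W"
        unfolding S_def by (intro divide_right_mono) auto
      then show "\<beta> s \<le> (\<Sum>\<iota>\<in>outer_index W s.
          cmod (weyl_op k 1 (2 ^ j x) (of_int (arc_point k W (j x) \<iota>) / (real W * 2 ^ (j x * k))) f x)) / real W"
        using b by (simp add: h_def)
    qed (use X \<beta>0 W1 k in \<open>auto simp: X5_def\<close>)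
    then show ?thesis by (simp add: DD l2f)
  qed (simp add: orth_const_def error_const_nonneg main_const_nonneg)
  have b45: "real (card ((\<Union>m\<in>{..<c0 * Suc s}. X4 s m) \<union> X5 s)) \<le> 900 * level_const / \<alpha>\<^sup>2 * \<rho> ^ s * real (card F)"
    if s: "\<sigma> \<le> s" for s
  proof -
    define P where "P = decay \<theta> D s / (\<beta> s)\<^sup>2 * real (card F)"
    have P0: "0 \<le> P" by (simp add: P_def)
    have "card ((\<Union>m\<in>{..<c0 * Suc s}. X4 s m) \<union> X5 s) \<le> (\<Sum>m\<in>{..<c0 * Suc s}. card (X4 s m)) + card (X5 s)"
      by (rule order_trans[OF card_Un_le add_right_mono[OF card_UN_le]]) simp
    then have "real (card ((\<Union>m\<in>{..<c0 * Suc s}. X4 s m) \<union> X5 s)) \<le> (\<Sum>m\<in>{..<c0 * Suc s}. real (card (X4 s m))) + real (card (X5 s))"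
      unfolding of_nat_sum[symmetric] of_nat_add[symmetric] of_nat_le_iff .
    also have "\<dots> \<le> (\<Sum>m\<in>{..<c0 * Suc s}. 576 * small_const C D * 16 ^ s * P) + orth_const k C D * 48 ^ s * P"
    proof (intro add_mono sum_mono)
      show "real (card (X4 s m)) \<le> 576 * small_const C D * 16 ^ s * P" for m using b4[of s m] by (simp add: P_def)
      show "real (card (X5 s)) \<le> orth_const k C D * 48 ^ s * P" using b5[of s] by (simp add: P_def)
    qed
    also have "\<dots> = real c0 * (576 * small_const C D * (real (Suc s) * 16 ^ s) * P) + orth_const k C D * 48 ^ s * P"
      by (simp add: algebra_simps)
    also have "\<dots> \<le> real c0 * (576 * small_const C D * 48 ^ s * P) + orth_const k C D * 48 ^ s * P"
    proof -
      \<comment> \<open>The number \<open>c0 * Suc s\<close> of scales treated singly is absorbed so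
        that both contributions carry \<open>48 ^ s\<close>.\<close>
      have "real (Suc s) \<le> 3 ^ s" by (induction s) auto
      then have "real (Suc s) * 16 ^ s \<le> 3 ^ s * (16::real) ^ s" by (intro mult_right_mono) auto
      also have "\<dots> = 48 ^ s" by (simp flip: power_mult_distrib)
      finally show ?thesis using P0 small_const_nonneg by (intro add_right_mono mult_left_mono mult_right_mono) auto
    qed
    also have "\<dots> = level_const * 48 ^ s * decay \<theta> D s / (\<beta> s)\<^sup>2 * real (card F)"
      by (simp add: level_const_def P_def algebra_simps add_divide_distrib)
    also have "\<dots> \<le> 900 * level_const / \<alpha>\<^sup>2 * \<rho> ^ s * real (card F)"
      unfolding \<beta>_def by (intro mult_right_mono level_beta s \<alpha>) auto
    finally show ?thesis .
  qed
  define U3 where "U3 = (\<Union>m\<in>{\<sigma>..J}. X3 m)"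
  define U4 where "U4 = (\<Union>s\<in>{\<sigma>..<J}. (\<Union>m\<in>{..<c0 * Suc s}. X4 s m) \<union> X5 s)"
  have u3: "real (card U3) \<le> 9 * small_const C D / \<alpha>\<^sup>2 * real (card F) * (\<rho> ^ \<sigma> / (1 - \<rho>))"
  proof -
    have "card U3 \<le> (\<Sum>m\<in>{\<sigma>..J}. card (X3 m))" unfolding U3_def by (intro card_UN_le) simp
    then have "real (card U3) \<le> (\<Sum>m\<in>{\<sigma>..J}. real (card (X3 m)))" unfolding of_nat_sum[symmetric] of_nat_le_iff .
    also have "\<dots> \<le> (\<Sum>m\<in>{\<sigma>..J}. 9 * small_const C D / \<alpha>\<^sup>2 * real (card F) * \<rho> ^ m)" by (intro sum_mono b3)
    also have "\<dots> \<le> 9 * small_const C D / \<alpha>\<^sup>2 * real (card F) * (\<rho> ^ \<sigma> / (1 - \<rho>))"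
      unfolding sum_distrib_left[symmetric] using small_const_nonneg \<rho>
      by (intro mult_left_mono sum_geometric_tail) auto
    finally show ?thesis .
  qed
  have u4: "real (card U4) \<le> 900 * level_const / \<alpha>\<^sup>2 * real (card F) * (\<rho> ^ \<sigma> / (1 - \<rho>))"
  proof -
    have "card U4 \<le> (\<Sum>s\<in>{\<sigma>..<J}. card ((\<Union>m\<in>{..<c0 * Suc s}. X4 s m) \<union> X5 s))"
      unfolding U4_def by (intro card_UN_le) simp
    then have "real (card U4) \<le> (\<Sum>s\<in>{\<sigma>..<J}. real (card ((\<Union>m\<in>{..<c0 * Suc s}. X4 s m) \<union> X5 s)))"
      unfolding of_nat_sum[symmetric] of_nat_le_iff .
    also have "\<dots> \<le> (\<Sum>s\<in>{\<sigma>..<J}. 900 * level_const / \<alpha>\<^sup>2 * \<rho> ^ s * real (card F))"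
      by (intro sum_mono b45) auto
    also have "\<dots> = 900 * level_const / \<alpha>\<^sup>2 * real (card F) * (\<Sum>s\<in>{\<sigma>..<J}. \<rho> ^ s)"
      unfolding sum_distrib_left by (intro sum.cong refl) simp
    also have "\<dots> \<le> 900 * level_const / \<alpha>\<^sup>2 * real (card F) * (\<rho> ^ \<sigma> / (1 - \<rho>))"
      using level_const_nonneg \<rho> by (intro mult_left_mono sum_geometric_tail) auto
    finally show ?thesis .
  qed
  have "finite (X1 \<union> X2 \<union> U3 \<union> U4)"
    using X by (intro finite_subset[OF _ X]) (auto simp: X1_def X2_def U3_def U4_def X3_def X4_def X5_def)
  then have "card X \<le> card (X1 \<union> X2 \<union> U3 \<union> U4)"
    using cover by (intro card_mono) (auto simp: U3_def U4_def)
  also have "\<dots> \<le> card X1 + card X2 + card U3 + card U4"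
    by (meson add_le_mono card_Un_le order.refl order_trans)
  finally have "real (card X) \<le> real (card X1) + real (card X2) + real (card U3) + real (card U4)"
    by linarith
  also have "\<dots> \<le> 2 ^ D * real (card F) * (2 ^ (\<sigma> * k) / \<alpha>) + 18 * 2 ^ D * real (card F) * (2 ^ (\<sigma> * k) / \<alpha>)
      + 9 * small_const C D / \<alpha>\<^sup>2 * real (card F) * (\<rho> ^ \<sigma> / (1 - \<rho>))
      + 900 * level_const / \<alpha>\<^sup>2 * real (card F) * (\<rho> ^ \<sigma> / (1 - \<rho>))"
    by (intro add_mono b1 b2 u3 u4)
  also have "\<dots> = 2 ^ D * real (card F) * (2 ^ (\<sigma> * k) / \<alpha>) + 18 * 2 ^ D * real (card F) * (2 ^ (\<sigma> * k) / \<alpha>)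
      + (9 * small_const C D + 900 * level_const) / (1 - \<rho>) * (\<rho> ^ \<sigma> / \<alpha>\<^sup>2) * real (card F)"
    by (simp add: add_divide_distrib distrib_right distrib_left mult_ac)
  also have "\<dots> \<le> scale_const * (2 ^ (\<sigma> * k) / \<alpha> + \<rho> ^ \<sigma> / \<alpha>\<^sup>2) * real (card F)"
  proof -
    define a where "a = (9 * small_const C D + 900 * level_const) / (1 - \<rho>)"
    define u where "u = 2 ^ (\<sigma> * k) / \<alpha> * real (card F)"
    define w where "w = \<rho> ^ \<sigma> / \<alpha>\<^sup>2 * real (card F)"
    have nn: "0 \<le> a" "0 \<le> u" "0 \<le> w"
      using small_const_nonneg level_const_nonneg \<rho> \<alpha> by (auto simp: a_def u_def w_def)
    have "19 * 2 ^ D * u + a * w \<le> (19 * 2 ^ D + a) * (u + w)"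
      using nn by (simp add: algebra_simps)
    also have "u + w = (2 ^ (\<sigma> * k) / \<alpha> + \<rho> ^ \<sigma> / \<alpha>\<^sup>2) * real (card F)"
      by (simp add: u_def w_def distrib_right)
    finally show ?thesis
      unfolding scale_const_def a_def[symmetric] by (simp add: u_def w_def mult_ac)
  qed
  finally show ?thesis .
qed

end

section \<open>The restricted weak-type bound\<close>

text \<open>The two terms balance at the real exponent \<open>y\<close> with
  \<open>2 powr ((2 * \<gamma> - \<kappa>) * y) = 1 / \<alpha>\<close>. Rounding \<open>y\<close>
  down only decreases the first term and increases the second by at most
  \<open>4 powr (\<gamma> - \<kappa>)\<close>; \<open>\<alpha> \<le> 1\<close> makes
  \<open>y\<close> nonnegative.\<close>

lemma optimise_scale:
  fixes \<alpha> \<gamma> \<kappa> N K c :: real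
  assumes \<alpha>: "0 < \<alpha>" "\<alpha> \<le> 1" and \<gamma>: "\<kappa> < \<gamma>" "0 \<le> \<kappa>" and Kc: "0 \<le> K" "0 \<le> c"
    and N: "\<And>\<sigma>::nat. N \<le> K * (2 powr (\<kappa> * real \<sigma>) / \<alpha> + 4 powr ((\<kappa> - \<gamma>) * real \<sigma>) / \<alpha>\<^sup>2) * c"
  shows "N \<le> K * (1 + 4 powr (\<gamma> - \<kappa>)) * \<alpha> powr (- (2 * \<gamma> / (2 * \<gamma> - \<kappa>))) * c"
proof -
  define b where "b = 2 * \<gamma> - \<kappa>"
  define p where "p = 2 * \<gamma> / b"
  define y where "y = - log 2 \<alpha> / b"
  define \<sigma> where "\<sigma> = nat \<lfloor>y\<rfloor>"
  have b: "b > 0" using \<gamma> by (simp add: b_def)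
  have "log 2 \<alpha> \<le> 0" using \<alpha> by simp
  then have y0: "0 \<le> y" unfolding y_def using b by (intro divide_nonneg_pos) auto
  have \<sigma>: "real \<sigma> \<le> y" "y - 1 \<le> real \<sigma>" using y0 unfolding \<sigma>_def by linarith+
  have pow2: "2 powr (t * y) = \<alpha> powr (- t / b)" for t
  proof -
    have "2 powr (t * y) = 2 powr (log 2 \<alpha> * (- t / b))" by (simp add: y_def mult.commute)
    also have "\<dots> = (2 powr (log 2 \<alpha>)) powr (- t / b)" by (simp only: powr_powr)
    finally show ?thesis using \<alpha> by simp
  qed
  have "2 * \<gamma> = \<kappa> + b" by (simp add: b_def)
  then have p: "p = \<kappa> / b + 1" using b by (simp add: p_def add_divide_distrib)
  have e1: "- \<kappa> / b + - 1 = - p" by (simp add: p)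
  have "2 * (\<gamma> - \<kappa>) = b - \<kappa>" by (simp add: b_def)
  then have e2: "2 * (\<gamma> - \<kappa>) / b + - 2 = - p" using b by (simp add: p diff_divide_distrib)
  have "2 powr (\<kappa> * real \<sigma>) / \<alpha> \<le> 2 powr (\<kappa> * y) / \<alpha>"
    using \<alpha> \<gamma> \<sigma> by (intro divide_right_mono powr_mono mult_left_mono) auto
  also have "\<dots> = \<alpha> powr (- \<kappa> / b) * \<alpha> powr (- 1)"
    using \<alpha> by (simp add: pow2 powr_minus_divide)
  also have "\<dots> = \<alpha> powr (- p)" by (simp only: powr_add[symmetric] e1)
  finally have 1: "2 powr (\<kappa> * real \<sigma>) / \<alpha> \<le> \<alpha> powr (- p)" .
  have "4 powr ((\<kappa> - \<gamma>) * real \<sigma>) \<le> 4 powr ((\<gamma> - \<kappa>) + (\<kappa> - \<gamma>) * y)"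
  proof (rule powr_mono)
    have "(\<gamma> - \<kappa>) * (y - 1) \<le> (\<gamma> - \<kappa>) * real \<sigma>" using \<gamma> \<sigma> by (intro mult_left_mono) auto
    then show "(\<kappa> - \<gamma>) * real \<sigma> \<le> (\<gamma> - \<kappa>) + (\<kappa> - \<gamma>) * y" by (simp add: algebra_simps)
  qed simp
  also have "\<dots> = 4 powr (\<gamma> - \<kappa>) * 4 powr ((\<kappa> - \<gamma>) * y)" by (rule powr_add)
  also have "4 powr ((\<kappa> - \<gamma>) * y) = 2 powr (2 * (\<kappa> - \<gamma>) * y)"
    by (simp only: powr_4 mult.assoc)
  also have "\<dots> = \<alpha> powr (2 * (\<gamma> - \<kappa>) / b)" unfolding pow2 by (simp add: algebra_simps)
  finally have "4 powr ((\<kappa> - \<gamma>) * real \<sigma>) / \<alpha>\<^sup>2 \<le> 4 powr (\<gamma> - \<kappa>) * \<alpha> powr (2 * (\<gamma> - \<kappa>) / b) / \<alpha>\<^sup>2"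
    by (intro divide_right_mono) auto
  also have "\<dots> = 4 powr (\<gamma> - \<kappa>) * (\<alpha> powr (2 * (\<gamma> - \<kappa>) / b) * \<alpha> powr (- 2))"
    using \<alpha> by (simp add: powr_minus_divide powr_numeral)
  also have "\<dots> = 4 powr (\<gamma> - \<kappa>) * \<alpha> powr (- p)" by (simp only: powr_add[symmetric] e2)
  finally have 2: "4 powr ((\<kappa> - \<gamma>) * real \<sigma>) / \<alpha>\<^sup>2 \<le> 4 powr (\<gamma> - \<kappa>) * \<alpha> powr (- p)" .
  have "N \<le> K * (2 powr (\<kappa> * real \<sigma>) / \<alpha> + 4 powr ((\<kappa> - \<gamma>) * real \<sigma>) / \<alpha>\<^sup>2) * c" by (rule N)
  also have "\<dots> \<le> K * (\<alpha> powr (- p) + 4 powr (\<gamma> - \<kappa>) * \<alpha> powr (- p)) * c"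
    using Kc 1 2 by (intro mult_right_mono mult_left_mono add_mono) auto
  finally show ?thesis by (simp add: p_def b_def algebra_simps)
qed

lemma (in weyl_setting) weak_type_positive:
  fixes F X :: "(int ^ 'd::finite) set" and j n :: "int ^ 'd \<Rightarrow> nat"
  assumes "CARD('d) = D" "finite F" "0 < \<alpha>" "\<alpha> \<le> 1" "finite X"
    and "\<And>x. x \<in> X \<Longrightarrow> j x \<ge> 1" "\<And>x. x \<in> X \<Longrightarrow> n x < 2 ^ (j x * k)"
    and "\<And>x. x \<in> X \<Longrightarrow> \<alpha> \<le> (2 ^ j x) ^ k / (2 ^ j x) ^ D * real (rep_count k (2 ^ j x) (n x) F x)"
  shows "real (card X) \<le> scale_const * (1 + 4 powr (\<theta> * real D - real k))
    * \<alpha> powr (- (2 * (\<theta> * real D) / (2 * (\<theta> * real D) - real k))) * real (card F)"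
proof (rule optimise_scale[OF assms(3,4) D])
  show "0 \<le> scale_const" by (rule scale_const_nonneg)
  fix \<sigma> :: nat
  have "2 ^ (\<sigma> * k) = 2 powr (real k * real \<sigma>)"
    using powr_realpow[of 2 "\<sigma> * k"] by (simp add: mult.commute)
  then show "real (card X) \<le> scale_const * (2 powr (real k * real \<sigma>) / \<alpha> + 4 powr ((real k - \<theta> * real D) * real \<sigma>) / \<alpha>\<^sup>2) * real (card F)"
    using scale_estimate[OF assms(1-3,5-8), of \<sigma>] by (simp add: \<rho>_power)
qed auto

section \<open>Orthants and the counting of sphere points\<close>

definition reflect :: "('d::finite \<Rightarrow> bool) \<Rightarrow> int ^ 'd \<Rightarrow> int ^ 'd" where
  "reflect \<epsilon> x = (\<chi> i. if \<epsilon> i then x $ i else - x $ i)"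

lemma reflect_reflect [simp]: "reflect \<epsilon> (reflect \<epsilon> x) = x"
  by (simp add: reflect_def vec_eq_iff)

lemma reflect_diff: "reflect \<epsilon> (x - y) = reflect \<epsilon> x - reflect \<epsilon> y"
  by (simp add: reflect_def vec_eq_iff)

lemma inj_reflect: "inj_on (reflect \<epsilon>) A"
  by (metis inj_onI reflect_reflect)

lemma finite_bounded_vec: "finite {m :: int ^ 'd::finite. \<forall>i. \<bar>m $ i\<bar> \<le> B}"
proof (rule finite_subset)
  show "{m :: int ^ 'd. \<forall>i. \<bar>m $ i\<bar> \<le> B} \<subseteq> vec_lambda ` (UNIV \<rightarrow>\<^sub>E {- B..B})"
  proof
    fix m :: "int ^ 'd" assume "m \<in> {m. \<forall>i. \<bar>m $ i\<bar> \<le> B}"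
    then have "vec_nth m \<in> UNIV \<rightarrow>\<^sub>E {- B..B}" by (auto simp: abs_le_iff) (metis minus_le_iff)
    moreover have "m = vec_lambda (vec_nth m)" by (simp add: vec_eq_iff)
    ultimately show "m \<in> vec_lambda ` (UNIV \<rightarrow>\<^sub>E {- B..B})" by blast
  qed
qed (intro finite_imageI finite_PiE; simp)

lemma lattice_sphere_coord:
  assumes m: "m \<in> lattice_sphere k r" and r: "r > 0" and k: "k \<ge> 1"
  shows "real_of_int \<bar>m $ i\<bar> \<le> r"
proof -
  have "\<bar>m $ i\<bar> ^ k \<le> (\<Sum>i\<in>UNIV. \<bar>m $ i\<bar> ^ k)"
    by (intro member_le_sum) auto
  then have "real_of_int (\<bar>m $ i\<bar> ^ k) \<le> real_of_int (\<Sum>i\<in>UNIV. \<bar>m $ i\<bar> ^ k)" by (simp only: of_int_le_iff)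
  also have "\<dots> = r ^ k" using m by (simp add: lattice_sphere_def)
  finally have "real_of_int \<bar>m $ i\<bar> ^ k \<le> r ^ k" by simp
  then show ?thesis using r k by (meson less_eq_real_def not_le power_mono_iff of_int_0_le_iff abs_ge_zero zero_less_one less_le_trans)
qed

lemma finite_lattice_sphere:
  assumes "r > 0" "k \<ge> 1"
  shows "finite (lattice_sphere k r :: (int ^ 'd::finite) set)"
proof (rule finite_subset[OF _ finite_bounded_vec])
  show "(lattice_sphere k r :: (int ^ 'd) set) \<subseteq> {m. \<forall>i. \<bar>m $ i\<bar> \<le> \<lfloor>r\<rfloor>}"
    using lattice_sphere_coord[OF _ assms] by (auto simp: le_floor_iff)
qed

lemma sphere_count_ge_1:
  assumes "r \<in> radii TYPE('d::finite) k" "k \<ge> 1"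
  shows "1 \<le> sphere_count TYPE('d) k r"
proof -
  have r: "r > 0" "(lattice_sphere k r :: (int ^ 'd) set) \<noteq> {}" using assms by (auto simp: radii_def)
  then have "0 < card (lattice_sphere k r :: (int ^ 'd) set)"
    using finite_lattice_sphere[OF r(1) assms(2)] by (simp add: card_gt_0_iff)
  then show ?thesis by (simp add: sphere_count_def)
qed

text \<open>The comparison for large radii extends to all radii: below the threshold
  \<open>r ^ m\<close> is bounded, and the sphere has at least one point.\<close>

lemma sphere_count_lower_bound:
  assumes "comparable_on {r \<in> radii TYPE('d::finite) k. r \<ge> r0}
      (\<lambda>r. real (sphere_count TYPE('d) k r)) (\<lambda>r. r ^ m)" and k: "k \<ge> 1"
  shows "\<exists>c. 0 < c \<and> c \<le> 1 \<and> (\<forall>r\<in>radii TYPE('d) k. c * r ^ m \<le> real (sphere_count TYPE('d) k r))"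
proof -
  obtain C where C: "C > 0" and le: "\<And>r. r \<in> radii TYPE('d) k \<Longrightarrow> r \<ge> r0 \<Longrightarrow> r ^ m \<le> C * real (sphere_count TYPE('d) k r)"
    using assms unfolding comparable_on_def by blast
  define R where "R = max r0 1"
  have R: "R \<ge> 1" "R \<ge> r0" by (simp_all add: R_def)
  have R0: "0 < R ^ m" using R by simp
  define c where "c = min 1 (min (1 / C) (1 / R ^ m))"
  have c: "0 < c" "c \<le> 1" "c \<le> 1 / C" "c \<le> 1 / R ^ m" using C R0 by (auto simp: c_def)
  have "c * r ^ m \<le> real (sphere_count TYPE('d) k r)" if r: "r \<in> radii TYPE('d) k" for r
  proof (cases "r \<ge> r0")
    case True
    have r0: "0 < r" using r by (simp add: radii_def)
    have "c * r ^ m \<le> 1 / C * r ^ m" using c r0 by (intro mult_right_mono) auto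
    also have "\<dots> \<le> real (sphere_count TYPE('d) k r)" using le[OF r True] C by (simp add: divide_le_eq mult.commute)
    finally show ?thesis .
  next
    case False
    have r0: "0 < r" using r by (simp add: radii_def)
    have "c * r ^ m \<le> 1 / R ^ m * R ^ m"
      using c r0 R R0 False by (intro mult_mono power_mono) auto
    also have "\<dots> = 1" using R(1) by simp
    also have "\<dots> \<le> real (sphere_count TYPE('d) k r)" using sphere_count_ge_1[OF r k] by simp
    finally show ?thesis .
  qed
  then show ?thesis using c by blast
qed

lemma sphere_avg_indicator:
  fixes F :: "(int ^ 'd::finite) set"
  assumes "r \<in> radii TYPE('d) k" "k \<ge> 1"
  shows "cmod (sphere_avg k r (indicator F) x)
    = real (card {y \<in> lattice_sphere k r. x - y \<in> F}) / real (sphere_count TYPE('d) k r)"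
proof -
  have r: "r > 0" using assms by (simp add: radii_def)
  have "(\<Sum>y\<in>lattice_sphere k r. indicator F (x - y)) = (\<Sum>y\<in>{y \<in> lattice_sphere k r. x - y \<in> F}. 1 :: complex)"
    using finite_lattice_sphere[OF r assms(2)] by (intro sum.mono_neutral_cong_right) (auto simp: indicator_def)
  then show ?thesis by (simp add: sphere_avg_def norm_divide norm_mult)
qed

text \<open>The signs of the coordinates of \<open>y\<close> give a reflection into the nonnegative
  orthant. Points with a zero coordinate may be counted in several orthants, which an upper bound
  permits.\<close>

lemma sphere_points_le_rep_count:
  fixes F :: "(int ^ 'd::finite) set"
  assumes r: "0 < r" "r < 2 ^ j" and n: "real n = r ^ k" and k: "k \<ge> 1" and F: "finite F"
  shows "card {y \<in> lattice_sphere k r. x - y \<in> F}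
    \<le> (\<Sum>\<epsilon>\<in>UNIV. rep_count k (2 ^ j) n (reflect \<epsilon> ` F) (reflect \<epsilon> x))"
proof -
  let ?V = "\<lambda>\<epsilon>. {v \<in> nbox (2 ^ j). (\<Sum>i\<in>UNIV. v i ^ k) = n \<and> reflect \<epsilon> x - emb 1 v \<in> reflect \<epsilon> ` F}"
  have "{y \<in> lattice_sphere k r. x - y \<in> F} \<subseteq> (\<Union>\<epsilon>. (\<lambda>v. reflect \<epsilon> (emb 1 v)) ` ?V \<epsilon>)"
  proof
    fix y assume "y \<in> {y \<in> lattice_sphere k r. x - y \<in> F}"
    then have y: "y \<in> lattice_sphere k r" "x - y \<in> F" by auto
    define \<epsilon> where "\<epsilon> = (\<lambda>i. 0 \<le> y $ i)"
    define v where "v = (\<lambda>i. nat \<bar>y $ i\<bar>)"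
    have emb: "emb 1 v = reflect \<epsilon> y" by (simp add: emb_def reflect_def v_def \<epsilon>_def vec_eq_iff)
    have "v i < 2 ^ j" for i
    proof -
      have "real (v i) \<le> r" using lattice_sphere_coord[OF y(1) r(1) k, of i] by (simp add: v_def)
      then have "real (v i) < real (2 ^ j)" unfolding of_nat_power of_nat_numeral using r(2) by linarith
      then show ?thesis by (simp only: of_nat_less_iff)
    qed
    moreover have "(\<Sum>i\<in>UNIV. v i ^ k) = n"
    proof -
      have "real (\<Sum>i\<in>UNIV. v i ^ k) = real_of_int (\<Sum>i\<in>UNIV. \<bar>y $ i\<bar> ^ k)" by (simp add: v_def)
      also have "\<dots> = real n" using y(1) n by (simp add: lattice_sphere_def)
      finally show ?thesis by (simp only: of_nat_eq_iff)
    qed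
    moreover have "reflect \<epsilon> x - emb 1 v \<in> reflect \<epsilon> ` F"
      unfolding emb reflect_diff[symmetric] using y(2) by blast
    ultimately have "v \<in> ?V \<epsilon>" by (simp add: nbox_def)
    moreover have "y = reflect \<epsilon> (emb 1 v)" unfolding emb by simp
    ultimately show "y \<in> (\<Union>\<epsilon>. (\<lambda>v. reflect \<epsilon> (emb 1 v)) ` ?V \<epsilon>)" by blast
  qed
  then have "card {y \<in> lattice_sphere k r. x - y \<in> F} \<le> card (\<Union>\<epsilon>. (\<lambda>v. reflect \<epsilon> (emb 1 v)) ` ?V \<epsilon>)"
    by (intro card_mono) auto
  also have "\<dots> \<le> (\<Sum>\<epsilon>\<in>UNIV. card ((\<lambda>v. reflect \<epsilon> (emb 1 v)) ` ?V \<epsilon>))"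
    by (intro card_UN_le) simp
  also have "\<dots> \<le> (\<Sum>\<epsilon>\<in>UNIV. rep_count k (2 ^ j) n (reflect \<epsilon> ` F) (reflect \<epsilon> x))"
    unfolding rep_count_def by (intro sum_mono card_image_le) simp
  finally show ?thesis .
qed

lemma dyadic_interval:
  fixes r :: real
  assumes "r \<ge> 1"
  obtains j where "j \<ge> 1" "r < 2 ^ j" "2 ^ j \<le> 2 * r"
proof -
  obtain m where m: "r < 2 ^ m" using real_arch_pow[of 2 r] by auto
  define j where "j = (LEAST m. r < 2 ^ m)"
  have j: "r < 2 ^ j" unfolding j_def by (rule LeastI[of _ m]) (rule m)
  have j1: "j \<ge> 1" using j assms by (cases j) auto
  have "\<not> r < 2 ^ (j - 1)" unfolding j_def by (rule not_less_Least) (use j1 in \<open>simp add: j_def\<close>)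
  moreover have "(2::real) ^ j = 2 * 2 ^ (j - 1)" using j1 by (cases j) auto
  ultimately show thesis using j j1 that[of j] by simp
qed

text \<open>The estimates concern finite \<open>X\<close> only; uniformity in \<open>X\<close>
  yields the finiteness of the superlevel set itself.\<close>

lemma finite_card_le:
  assumes "\<And>X. X \<subseteq> L \<Longrightarrow> finite X \<Longrightarrow> real (card X) \<le> b"
  shows "finite L \<and> real (card L) \<le> b"
proof -
  have "finite L"
  proof (rule ccontr)
    assume "infinite L"
    then obtain X where "finite X" "card X = nat \<lceil>b\<rceil> + 1" "X \<subseteq> L"
      using infinite_arbitrarily_large by blast
    then show False using assms[of X] by linarith
  qed
  then show ?thesis using assms by blast
qed

text \<open>One of the \<open>2 ^ d\<close> orthants carries its share of the average, and replacing
  \<open>r\<close> by the power of two in \<open>(r, 2 * r]\<close> costs at most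
  \<open>2 ^ d\<close> more; hence \<open>4 ^ d\<close>. The bound \<open>\<alpha> < 1\<close> holds
  because averages of an indicator are at most 1.\<close>

lemma maximal_level_set:
  fixes F :: "(int ^ 'd::finite) set"
  assumes F: "finite F" and \<alpha>: "\<alpha> > 0" and k: "k \<ge> 1" "CARD('d) > k"
    and c: "0 < c" "\<And>r. r \<in> radii TYPE('d) k \<Longrightarrow> c * r ^ (CARD('d) - k) \<le> real (sphere_count TYPE('d) k r)"
    and x: "full_maximal k (indicator F) x > ennreal \<alpha>"
  shows "\<alpha> < 1 \<and> (\<exists>\<epsilon> j n. j \<ge> 1 \<and> n < 2 ^ (j * k) \<and>
    c * \<alpha> / 4 ^ CARD('d) \<le> (2 ^ j) ^ k / (2 ^ j) ^ CARD('d) * real (rep_count k (2 ^ j) n (reflect \<epsilon> ` F) (reflect \<epsilon> x)))"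
proof -
  let ?D = "CARD('d)"
  obtain r where r: "r \<in> radii TYPE('d) k" and "ennreal \<alpha> < ennreal (cmod (sphere_avg k r (indicator F) x))"
    using x unfolding full_maximal_def less_SUP_iff by blast
  then have avg: "\<alpha> < cmod (sphere_avg k r (indicator F) x)"
    using \<alpha> by (simp add: ennreal_less_iff)
  let ?P = "{y \<in> lattice_sphere k r. x - y \<in> F}" and ?N = "sphere_count TYPE('d) k r"
  have r0: "r > 0" using r by (simp add: radii_def)
  have N1: "?N \<ge> 1" by (rule sphere_count_ge_1[OF r k(1)])
  have "card ?P \<le> ?N"
    unfolding sphere_count_def using finite_lattice_sphere[OF r0 k(1)] by (intro card_mono) auto
  then have "real (card ?P) / real ?N \<le> 1" using N1 by (simp add: divide_le_eq)
  then have \<alpha>1: "\<alpha> < 1" using avg unfolding sphere_avg_indicator[OF r k(1)] by linarith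
  have P: "\<alpha> * real ?N < real (card ?P)"
    using avg N1 unfolding sphere_avg_indicator[OF r k(1)] by (simp add: less_divide_eq)
  obtain m :: "int ^ 'd" where m: "m \<in> lattice_sphere k r" using r by (auto simp: radii_def)
  define n where "n = nat (\<Sum>i\<in>UNIV. \<bar>m $ i\<bar> ^ k)"
  have "real n = real_of_int (\<Sum>i\<in>UNIV. \<bar>m $ i\<bar> ^ k)" unfolding n_def by (simp add: sum_nonneg)
  then have n: "real n = r ^ k" using m by (simp add: lattice_sphere_def)
  have "0 < real n" using r0 n by simp
  then have "1 \<le> real n" by simp
  then have "1 \<le> r ^ k" by (simp only: n)
  \<comment> \<open>A radius is at least 1, since its \<open>k\<close>-th power is a positive
    integer.\<close>
  then have r1: "1 \<le> r" using r0 k(1) by (meson less_eq_real_def not_le power_less_one_iff zero_less_one less_le_trans)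
  obtain j where j: "j \<ge> 1" "r < 2 ^ j" "2 ^ j \<le> 2 * r" using dyadic_interval[OF r1] by blast
  have "real n < (2 ^ j) ^ k" unfolding n using r0 j k by (intro power_strict_mono) auto
  then have "real n < real (2 ^ (j * k))" by (simp add: power_mult)
  then have nj: "n < 2 ^ (j * k)" by (simp only: of_nat_less_iff)
  let ?R = "\<lambda>\<epsilon>. real (rep_count k (2 ^ j) n (reflect \<epsilon> ` F) (reflect \<epsilon> x))"
  define T where "T = c * \<alpha> * r ^ (?D - k) / 2 ^ ?D"
  have "\<exists>\<epsilon>. T \<le> ?R \<epsilon>"
  proof (rule ccontr)
    assume "\<not> ?thesis"
    then have "(\<Sum>\<epsilon>\<in>UNIV. ?R \<epsilon>) \<le> (\<Sum>\<epsilon>\<in>(UNIV :: ('d \<Rightarrow> bool) set). T)"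
      by (intro sum_mono) (auto simp: not_le less_imp_le)
    also have "\<dots> = c * r ^ (?D - k) * \<alpha>" by (simp add: T_def card_fun)
    also have "\<dots> \<le> real ?N * \<alpha>" using c(2)[OF r] \<alpha> by (intro mult_right_mono) auto
    also have "\<dots> < real (card ?P)" using P by (simp add: mult.commute)
    also have "\<dots> \<le> real (\<Sum>\<epsilon>\<in>UNIV. rep_count k (2 ^ j) n (reflect \<epsilon> ` F) (reflect \<epsilon> x))"
      unfolding of_nat_le_iff by (rule sphere_points_le_rep_count[OF r0 j(2) n k(1) F])
    finally show False by simp
  qed
  then obtain \<epsilon> where \<epsilon>: "T \<le> ?R \<epsilon>" by blast
  have "c * \<alpha> / 4 ^ ?D \<le> (2 ^ j) ^ k / (2 ^ j) ^ ?D * T"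
  proof -
    have "(2 ^ j) ^ (?D - k) \<le> (2 * r) ^ (?D - k)" using j by (intro power_mono) auto
    also have "\<dots> = 2 ^ (?D - k) * r ^ (?D - k)" by (rule power_mult_distrib)
    also have "\<dots> \<le> 2 ^ ?D * r ^ (?D - k)" using r0 by (intro mult_right_mono power_increasing) auto
    finally have A: "(2 ^ j) ^ (?D - k) \<le> 2 ^ ?D * r ^ (?D - k)" .
    have B: "((2::real) ^ j) ^ ?D = (2 ^ j) ^ (?D - k) * (2 ^ j) ^ k" using k by (simp flip: power_add)
    define z where "z = ((2::real) ^ j) ^ (?D - k)"
    define u where "u = ((2::real) ^ j) ^ k"
    have zu: "z > 0" "u > 0" by (simp_all add: z_def u_def)
    have four: "(4::real) ^ ?D = 2 ^ ?D * 2 ^ ?D" by (simp flip: power_mult_distrib)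
    have "c * \<alpha> / 4 ^ ?D = 1 / z * (c * \<alpha> * (z / 2 ^ ?D) / 2 ^ ?D)"
      using zu by (simp add: four)
    also have "\<dots> \<le> 1 / z * (c * \<alpha> * (r ^ (?D - k)) / 2 ^ ?D)"
      using A \<alpha> c(1) zu by (intro mult_left_mono divide_right_mono) (auto simp: z_def[symmetric] divide_le_eq mult.commute)
    also have "\<dots> = u / (z * u) * T" using zu by (simp add: T_def)
    finally show ?thesis unfolding B by (simp only: z_def u_def)
  qed
  also have "\<dots> \<le> (2 ^ j) ^ k / (2 ^ j) ^ ?D * ?R \<epsilon>" using \<epsilon> by (intro mult_left_mono) auto
  finally show ?thesis using \<alpha>1 j(1) nj by blast
qed

theorem corollary1:
  fixes k :: nat and \<theta> :: real
  assumes "k \<ge> 3"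
    and "CARD('d::finite) > k"
    and "\<exists>r0::real. comparable_on {r \<in> radii TYPE('d) k. r \<ge> r0}
           (\<lambda>r. real (sphere_count TYPE('d) k r)) (\<lambda>r. r ^ (CARD('d) - k))"
    and "0 < \<theta>" and "\<theta> < 1 / (real k * (real k + 2))"
    and "sup_hypothesis k \<theta>"
    and "real CARD('d) > max (real k * (real k + 2)) (real k / \<theta>)"
  shows "restricted_weak_type (real CARD('d) / (real CARD('d) - real k / (2 * \<theta>)))
           (full_maximal k :: (int ^ 'd \<Rightarrow> complex) \<Rightarrow> int ^ 'd \<Rightarrow> ennreal)"
proof -
  define D where "D = CARD('d)"
  define \<gamma> where "\<gamma> = \<theta> * real D"
  define p where "p = 2 * \<gamma> / (2 * \<gamma> - real k)"
  have k1: "k \<ge> 1" using assms(1) by simp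
  have "3 * 5 \<le> real k * (real k + 2)" using assms(1) by (intro mult_mono) auto
  then have "1 / (real k * (real k + 2)) \<le> 1 / 2" by (intro divide_left_mono) auto
  then have \<theta>: "\<theta> \<le> 1 / 2" using assms(5) by linarith
  obtain C where C: "weyl_bound k \<theta> C"
    using sup_hypothesis_imp_weyl_bound[OF assms(6,4) _ k1] \<theta> by auto
  have "real k / \<theta> < real D" using assms(7) by (simp add: D_def)
  then have \<gamma>: "real k < \<gamma>" using assms(4) by (simp add: \<gamma>_def divide_less_eq mult.commute)
  \<comment> \<open>\<open>\<gamma> + 1\<close> makes the factorisation error small enough, 3 makes
    the smooth sums long enough for the oscillation bound.\<close>
  define c0 where "c0 = max 3 (nat \<lceil>\<gamma> + 1\<rceil>)"
  have c0: "\<gamma> + 1 \<le> real c0" "c0 \<ge> 3" unfolding c0_def by linarith+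
  interpret weyl_setting k \<theta> C D c0
    by unfold_locales (use C assms(1,4) \<theta> \<gamma> c0 in \<open>auto simp: \<gamma>_def\<close>)
  obtain r0 where r0: "comparable_on {r \<in> radii TYPE('d) k. r \<ge> r0}
      (\<lambda>r. real (sphere_count TYPE('d) k r)) (\<lambda>r. r ^ (CARD('d) - k))"
    using assms(3) by blast
  obtain c where c: "0 < c" "c \<le> 1" "\<And>r. r \<in> radii TYPE('d) k \<Longrightarrow> c * r ^ (CARD('d) - k) \<le> real (sphere_count TYPE('d) k r)"
    using sphere_count_lower_bound[OF r0 k1] by blast
  define K where "K = scale_const * (1 + 4 powr (\<gamma> - real k))"
  define B where "B = 2 ^ D * K * (c / 4 ^ D) powr (- p)"
  have K0: "0 \<le> K" using scale_const_nonneg by (simp add: K_def)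
  have main: "finite {x. full_maximal k (indicator F) x > ennreal \<alpha>} \<and>
      real (card {x. full_maximal k (indicator F) x > ennreal \<alpha>}) \<le> B * \<alpha> powr (- p) * real (card F)"
    if F: "finite F" and \<alpha>: "\<alpha> > 0" for F :: "(int ^ 'd) set" and \<alpha> :: real
  proof (rule finite_card_le)
    fix X assume sub: "X \<subseteq> {x. full_maximal k (indicator F) x > ennreal \<alpha>}" and X: "finite X"
    define \<alpha>' where "\<alpha>' = c * \<alpha> / 4 ^ D"
    have \<alpha>'0: "\<alpha>' > 0" using c \<alpha> by (simp add: \<alpha>'_def)
    have lev: "\<alpha> < 1 \<and> (\<exists>\<epsilon> j n. j \<ge> 1 \<and> n < 2 ^ (j * k) \<and>
      \<alpha>' \<le> (2 ^ j) ^ k / (2 ^ j) ^ D * real (rep_count k (2 ^ j) n (reflect \<epsilon> ` F) (reflect \<epsilon> x)))"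
      if "x \<in> X" for x
      using maximal_level_set[OF F \<alpha> k1 assms(2) c(1,3), of x] sub that unfolding \<alpha>'_def D_def by blast
    then obtain E j n where Ejn: "\<And>x. x \<in> X \<Longrightarrow> j x \<ge> 1 \<and> n x < 2 ^ (j x * k) \<and>
      \<alpha>' \<le> (2 ^ j x) ^ k / (2 ^ j x) ^ D * real (rep_count k (2 ^ j x) (n x) (reflect (E x) ` F) (reflect (E x) x))"
      by metis
    show "real (card X) \<le> B * \<alpha> powr (- p) * real (card F)"
    proof (cases "X = {}")
      case False
      then have \<alpha>1: "\<alpha> < 1" using lev by blast
      have "1 * 1 \<le> (4::real) ^ D" by simp
      moreover have "c * \<alpha> \<le> 1 * 1" using c \<alpha> \<alpha>1 by (intro mult_mono) auto
      ultimately have "c * \<alpha> \<le> 4 ^ D" by linarith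
      then have \<alpha>'1: "\<alpha>' \<le> 1" by (simp add: \<alpha>'_def divide_le_eq)
      \<comment> \<open>The points are sorted by the orthant found for them; each class is reflected
        together with \<open>F\<close>, and the \<open>2 ^ D\<close> bounds are added.\<close>
      have piece: "real (card {x \<in> X. E x = \<epsilon>}) \<le> K * \<alpha>' powr (- p) * real (card F)" for \<epsilon>
      proof -
        let ?Y = "reflect \<epsilon> ` {x \<in> X. E x = \<epsilon>}"
        have "real (card ?Y) \<le> scale_const * (1 + 4 powr (\<theta> * real D - real k))
            * \<alpha>' powr (- (2 * (\<theta> * real D) / (2 * (\<theta> * real D) - real k))) * real (card (reflect \<epsilon> ` F))"
          by (rule weak_type_positive[where j = "\<lambda>y. j (reflect \<epsilon> y)" and n = "\<lambda>y. n (reflect \<epsilon> y)"])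
             (use Ejn \<alpha>'0 \<alpha>'1 F X in \<open>auto simp: D_def\<close>)
        then show ?thesis by (simp add: card_image inj_reflect K_def p_def \<gamma>_def)
      qed
      have "X = (\<Union>\<epsilon>. {x \<in> X. E x = \<epsilon>})" by auto
      then have "card X \<le> (\<Sum>\<epsilon>\<in>UNIV. card {x \<in> X. E x = \<epsilon>})"
        using card_UN_le[of "UNIV :: ('d \<Rightarrow> bool) set" "\<lambda>\<epsilon>. {x \<in> X. E x = \<epsilon>}"] by simp
      then have "real (card X) \<le> (\<Sum>\<epsilon>\<in>UNIV. real (card {x \<in> X. E x = \<epsilon>}))"
        unfolding of_nat_sum[symmetric] of_nat_le_iff .
      also have "\<dots> \<le> (\<Sum>\<epsilon>\<in>(UNIV :: ('d \<Rightarrow> bool) set). K * \<alpha>' powr (- p) * real (card F))"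
        by (intro sum_mono piece)
      also have "\<dots> = 2 ^ D * (K * \<alpha>' powr (- p) * real (card F))" by (simp add: card_fun D_def)
      also have "\<alpha>' powr (- p) = (c / 4 ^ D) powr (- p) * \<alpha> powr (- p)"
        using c \<alpha> powr_mult[of "c / 4 ^ D" \<alpha> "- p"] by (simp add: \<alpha>'_def)
      finally show ?thesis by (simp add: B_def mult_ac)
    qed (use K0 in \<open>simp add: B_def\<close>)
  qed
  \<comment> \<open>Numerator and denominator of \<open>p\<close> are divided by
    \<open>2 * \<theta>\<close>.\<close>
  have "real CARD('d) / (real CARD('d) - real k / (2 * \<theta>)) = p"
  proof -
    have "real D - real k / (2 * \<theta>) = (2 * \<gamma> - real k) / (2 * \<theta>)"
      using assms(4) by (simp add: \<gamma>_def field_simps)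
    then show ?thesis using assms(4) by (simp add: p_def \<gamma>_def flip: D_def)
  qed
  then show ?thesis unfolding restricted_weak_type_def using main by blast
qed

end
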